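(* In the setting of the context, for $k\in\{1,\dots,q\}$, the optimal strategy for Player II of the game at level $\Phi^{(k)}$ is the pure strategy $u^{(k)}:=\mathbb E_{\xi\sim\mathcal N(0,Q)}[\xi\mid\sigma(\Phi^{(k)})]$ corresponding to the mixed strategy $\xi\sim\mathcal N(0,Q)$ of Player I. That is, the function $u^{(k)}\in L(\Phi^{(k)},\mathcal B)$ defined by $$u^{(k)}(u):=\mathbb E_{\xi\sim\mathcal N(0,Q)}\big[\xi\,\big|\,[\phi^{(k)}_i,\xi]=[\phi^{(k)}_i,u]\text{ for }i\in\mathcal I^{(k)}\big],\qquad u\in\mathcal B,$$ is the optimal minmax solution of $\inf_{v\in L(\Phi^{(k)},\mathcal B)}\sup_{u\in\mathcal B}\|u-v(u)\|/\|u\|$. Moreover, the level-$k$ gamblets have the representation $$\psi^{(k)}_i=\mathbb E\big[\xi\,\big|\,[\phi^{(k)}_j,\xi]=\delta_{i,j},\ j\in\mathcal I^{(k)}\big],\qquad i\in\mathcal I^{(k)},$$ and the interpolation matrix $R^{(k,k+1)}$ ($k\in\{1,\dots,q-1\}$), defined by $\psi^{(k)}_i=\sum_{j\in\mathcal I^{(k+1)}}R^{(k,k+1)}_{i,j}\psi^{(k+1)}_j$, has the representation $$R^{(k,k+1)}_{i,j}=\mathbb E\big[[\phi^{(k+1)}_j,\xi]\,\big|\,[\phi^{(k)}_l,\xi]=\delta_{i,l},\ l\in\mathcal I^{(k)}\big],\qquad i\in\mathcal I^{(k)},\ j\in\mathcal I^{(k+1)}.$$ Finally, the measure $\xi\sim\mathcal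 N(0,Q)$ is a worst case measure (in the sense described in the context) at all levels of the hierarchy.
   Context: $(\mathcal B,\|\cdot\|)$ is a reflexive separable Banach space with dual $\mathcal B^*$ and pairing $[\cdot,\cdot]$, with $\|u\|^2=[Q^{-1}u,u]$ for a symmetric positive bijective linear operator $Q:\mathcal B^*\to\mathcal B$; $\langle u,v\rangle:=[Q^{-1}u,v]$. Let $q\in\mathbb N^*\cup\{\infty\}$ and let $\mathcal I^{(q)}$ be an index tree of depth $q$, i.e. a finite set of $q$-tuples; $i^{(k)}:=(i_1,\dots,i_k)$ and $\mathcal I^{(k)}:=\{i^{(k)}:i\in\mathcal I^{(q)}\}$. For $k\in\{1,\dots,q-1\}$, $\pi^{(k,k+1)}$ is an $\mathcal I^{(k)}\times\mathcal I^{(k+1)}$ matrix of rank $|\mathcal I^{(k)}|$. $(\phi^{(q)}_i)_{i\in\mathcal I^{(q)}}$ are linearly independent in $\mathcal B^*$ and $\phi^{(k)}_i=\sum_{j\in\mathcal I^{(k+1)}}\pi^{(k,k+1)}_{i,j}\phi^{(k+1)}_j$ for $k\in\{1,\dots,q-1\}$. $\Phi^{(k)}:=\operatorname{span}\{\phi^{(k)}_i:i\in\mathcal I^{(k)}\}$. When $q=\infty$, the ranges of $k$ are read as all finite levels, $\mathcal I^{(\infty)}$ is a set of infinite sequences with every $\mathcal I^{(k)}$ finite, and $(\phi^{(k)}_i)_{i\in\mathcal I^{(k)}}$, $k\ge1$, are families in $\mathcal B^*$, linearly independent for each $k$, satisfying the nesting relation for every $k\ge1$. Gamblets: $\psi^{(k)}_i$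 is the minimizer of $\|\psi\|$ over $\psi\in\mathcal B$ with $[\phi^{(k)}_j,\psi]=\delta_{i,j}$ for $j\in\mathcal I^{(k)}$ (they are linearly independent, and the level-$k$ gamblets lie in the span of the level-$(k+1)$ ones). For a finite-dimensional $\Phi\subset\mathcal B^*$, $L(\Phi,\mathcal B)$ is the set of functions $\mathcal B\to\mathcal B$ measurable from the $\sigma$-algebra $\sigma(\Phi)$ generated by the elements of $\Phi$ to the Borel $\sigma$-algebra. Game at level $\Phi$: Player I chooses $u^{\mathrm I}\in\mathcal B$ and maximizes, Player II chooses $u^{\mathrm{II}}\in L(\Phi,\mathcal B)$ and minimizes, the loss $\|u^{\mathrm I}-u^{\mathrm{II}}(u^{\mathrm I})\|/\|u^{\mathrm I}\|$; a mixed strategy of Player I is a (weak) probability distribution on $\mathcal B$. Gaussian field: $\xi\sim\mathcal N(0,Q)$ is a linear isometry $\varphi\mapsto[\varphi,\xi]$ from $\mathcal B^*$ (with inner product $[\varphi_1,Q\varphi_2]$) into an $L^2$ space of a probability space, whose image consists of centered Gaussian random variables; it is identified with the Gaussian cylinder measure $\mu_Q$. For linearly independent $\phi_1,\dots,\phi_m\in\mathcal B^*$ and $c\in\mathbb R^m$, $\mathbb E[\xi\mid[\phi_i,\xi]=c_i\ \forall i]$ denotes the element $v\in\mathcal B$ such that for every $\varphi\in\mathcal B^*$, $[\varphi,v]=\mathbb E[[\varphi,\xi]\mid[\phi_i,\xi]=c_i\ \forall i]$, the value at $c$ of the (continuous) regression function of $[\varphi,\xi]$ given $([\phi_i,\xi])_i$.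 Worst case measures (for a given $\Phi$). $\mathcal M_2(\mathcal B)$ is the set of Borel probability measures on $\mathcal B$ with finite second moments; $\Psi(v,\mu):=\int\|x-v(x)\|^2d\mu(x)\big/\int\|x\|^2d\mu(x)$. A measure is a worst case measure if it is the second component of a saddle point of $\Psi$ over $L(\Phi,\mathcal B)\times\mathcal M_2(\mathcal B)$, where saddle points are extended to cylinder measures as follows. $(v^*,\mu^* )\in L(\Phi,\mathcal B)\times\mathcal M_2(\mathcal B)$ is an $\epsilon$-saddle point if $\Psi(v^*,\mu)-\epsilon\le\Psi(v^*,\mu^* )\le\Psi(v,\mu^* )+\epsilon$ for all $v\in L(\Phi,\mathcal B)$, $\mu\in\mathcal M_2(\mathcal B)$. A cylinder measure is a finitely additive set function on the cylinder sets of $\mathcal B$ whose push-forward $F_*\mu$ by every continuous linear map $F$ to a finite-dimensional space is a probability measure; $\mu_n\to\mu$ in the weak cylinder measure topology if $F_*\mu_n\to F_*\mu$ weakly for every continuous linear finite-rank projection $F$ on $\mathcal B$. $(v^*,\mu^* )$ with $\mu^*$ a cylinder measure is a saddle point of $\Psi$ if there are $\mu^*_n\in\mathcal M_2(\mathcal B)$ converging to $\mu^*$ in this topology such that $(v^*,\mu^*_n)$ is a $\frac1n$-saddle point for every $n$. The Gaussian cylinder measure $\mu_T$ with covariance $T:\mathcal B^*\to\mathcal B$ is the one for which each $\varphi\in\mathcal B^*$ has law $\mathcal N(0,[\varphi,T\varphi])$. The measure $\mu_Q$, i.e. $\mathcal N(0,Q)$, is called a (universal) worst case measure in that, whatever the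 measurement functions, it generates the worst case measure $\mu_{\Phi^\perp(Q)}$ through shorting, where the short $\Phi^\perp(Q)$ is the symmetric operator with $[s,\Phi^\perp(Q)s]=\inf_{t\in\Phi}[s+t,Q(s+t)]$, $s\in\mathcal B^*$; when $\dim\mathcal B=\infty$, $\mu_Q$ is also itself the component of a saddle point. *)

theory Defs
  imports "HOL-Probability.Probability" "HOL-Library.Extended_Nat"
    "HOL-Library.Function_Algebras"
begin

section \<open>The space and its operator\<close>

text \<open>
  The dual of \<open>'b\<close> is \<open>'b \<Rightarrow>\<^sub>L real\<close> and the pairing \<open>[f, u]\<close> is \<open>blinfun_apply f u\<close>.
  For a metric space, separability is the type class \<open>second_countable_topology\<close>.
\<close>

definition reflexive_space :: "'b::real_normed_vector itself \<Rightarrow> bool" where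
  "reflexive_space _ \<longleftrightarrow>
     (\<forall>F :: ('b \<Rightarrow>\<^sub>L real) \<Rightarrow>\<^sub>L real. \<exists>x. \<forall>f. blinfun_apply F f = blinfun_apply f x)"

definition symmetric_operator :: "(('b::real_normed_vector \<Rightarrow>\<^sub>L real) \<Rightarrow> 'b) \<Rightarrow> bool" where
  "symmetric_operator T \<longleftrightarrow>
     linear T \<and> (\<forall>f g. blinfun_apply f (T g) = blinfun_apply g (T f))"

definition norm_operator :: "(('b::real_normed_vector \<Rightarrow>\<^sub>L real) \<Rightarrow> 'b) \<Rightarrow> bool" where
  "norm_operator Q \<longleftrightarrow>
     symmetric_operator Q \<and> (\<forall>f. 0 \<le> blinfun_apply f (Q f)) \<and> bij Q \<and>
     (\<forall>u. (norm u)\<^sup>2 = blinfun_apply (inv Q u) u)"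

section \<open>Index trees and measurement functions\<close>

text \<open>
  A \<open>q\<close>-tuple, and for \<open>q = \<infinity>\<close> an infinite sequence, is a function on the positive integers
  \<open>n \<le> q\<close> that is \<open>undefined\<close> elsewhere. For \<open>q\<close> finite, level \<open>q\<close> is the
  index tree itself, so the finiteness condition says that the tree is finite.
\<close>

definition tree_level :: "(nat \<Rightarrow> 'i) set \<Rightarrow> nat \<Rightarrow> (nat \<Rightarrow> 'i) set" where
  "tree_level I k = (\<lambda>i. restrict i {1..k}) ` I"

definition index_tree :: "enat \<Rightarrow> (nat \<Rightarrow> 'i) set \<Rightarrow> bool" where
  "index_tree q I \<longleftrightarrow>
     I \<subseteq> extensional {n. 1 \<le> n \<and> enat n \<le> q} \<and>
     (\<forall>k. 1 \<le> k \<and> enat k \<le> q \<longrightarrow> finite (tree_level I k))"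

text \<open>The rank of an \<open>I \<times> J\<close> matrix, as the dimension of its row space.\<close>

definition matrix_rank :: "'i set \<Rightarrow> 'j set \<Rightarrow> ('i \<Rightarrow> 'j \<Rightarrow> real) \<Rightarrow> nat" where
  "matrix_rank I J A =
     vector_space.dim (\<lambda>(c::real) r j. c * r j) ((\<lambda>i j. if j \<in> J then A i j else 0) ` I)"

definition lin_indep_family :: "'i set \<Rightarrow> ('i \<Rightarrow> 'v::real_vector) \<Rightarrow> bool" where
  "lin_indep_family I f \<longleftrightarrow> inj_on f I \<and> independent (f ` I)"

section \<open>The Gaussian field and its conditional expectations\<close>

definition centered_gaussian :: "real \<Rightarrow> real measure" where
  "centered_gaussian v =
     (if v = 0 then return borel 0 else density lborel (\<lambda>x. ennreal (normal_density 0 (sqrt v) x)))"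

text \<open>
  Elements of \<open>L\<^sup>2\<close> are given by representatives, so linearity holds almost everywhere.
\<close>

definition gaussian_field ::
  "'w measure \<Rightarrow> (('b::real_normed_vector \<Rightarrow>\<^sub>L real) \<Rightarrow> 'b) \<Rightarrow> (('b \<Rightarrow>\<^sub>L real) \<Rightarrow> 'w \<Rightarrow> real) \<Rightarrow> bool"
where
  "gaussian_field M Q \<xi> \<longleftrightarrow>
     prob_space M \<and>
     (\<forall>f. \<xi> f \<in> borel_measurable M \<and> integrable M (\<lambda>\<omega>. (\<xi> f \<omega>)\<^sup>2)) \<and>
     (\<forall>a b f g. AE \<omega> in M. \<xi> (a *\<^sub>R f + b *\<^sub>R g) \<omega> = a * \<xi> f \<omega> + b * \<xi> g \<omega>) \<and>
     (\<forall>f g. (\<integral>\<omega>. \<xi> f \<omega> * \<xi> g \<omega> \<partial>M) = blinfun_apply f (Q g)) \<and>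
     (\<forall>f. \<exists>v\<ge>0. distr M borel (\<xi> f) = centered_gaussian v)"

text \<open>
  Regression functions live on the finite-dimensional space of tuples indexed by \<open>J\<close>,
  i.e. on \<open>J \<rightarrow>\<^sub>E UNIV\<close> with the product topology.
\<close>

definition regression_function ::
  "'w measure \<Rightarrow> ('w \<Rightarrow> real) \<Rightarrow> 'j set \<Rightarrow> ('j \<Rightarrow> 'w \<Rightarrow> real) \<Rightarrow> (('j \<Rightarrow> real) \<Rightarrow> real) \<Rightarrow> bool"
where
  "regression_function M X J Y g \<longleftrightarrow>
     continuous_on (J \<rightarrow>\<^sub>E UNIV) g \<and>
     (AE \<omega> in M.
        real_cond_exp M
          (vimage_algebra (space M) (\<lambda>\<omega>. \<lambda>j\<in>J. Y j \<omega>) (\<Pi>\<^sub>M j\<in>J. borel)) X \<omega>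
        = g (\<lambda>j\<in>J. Y j \<omega>))"

definition is_cond_value ::
  "'w measure \<Rightarrow> ('w \<Rightarrow> real) \<Rightarrow> 'j set \<Rightarrow> ('j \<Rightarrow> 'w \<Rightarrow> real) \<Rightarrow> ('j \<Rightarrow> real) \<Rightarrow> real \<Rightarrow> bool"
where
  "is_cond_value M X J Y c r \<longleftrightarrow>
     (\<exists>g. regression_function M X J Y g \<and> r = g (restrict c J))"

definition cond_value ::
  "'w measure \<Rightarrow> ('w \<Rightarrow> real) \<Rightarrow> 'j set \<Rightarrow> ('j \<Rightarrow> 'w \<Rightarrow> real) \<Rightarrow> ('j \<Rightarrow> real) \<Rightarrow> real"
where
  "cond_value M X J Y c = (THE r. is_cond_value M X J Y c r)"

definition is_field_cond_exp ::
  "'w measure \<Rightarrow> (('b::real_normed_vector \<Rightarrow>\<^sub>L real) \<Rightarrow> 'w \<Rightarrow> real) \<Rightarrow>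
   'j set \<Rightarrow> ('j \<Rightarrow> 'b \<Rightarrow>\<^sub>L real) \<Rightarrow> ('j \<Rightarrow> real) \<Rightarrow> 'b \<Rightarrow> bool"
where
  "is_field_cond_exp M \<xi> J \<phi> c v \<longleftrightarrow>
     (\<forall>f. is_cond_value M (\<xi> f) J (\<lambda>j. \<xi> (\<phi> j)) c (blinfun_apply f v))"

definition field_cond_exp ::
  "'w measure \<Rightarrow> (('b::real_normed_vector \<Rightarrow>\<^sub>L real) \<Rightarrow> 'w \<Rightarrow> real) \<Rightarrow>
   'j set \<Rightarrow> ('j \<Rightarrow> 'b \<Rightarrow>\<^sub>L real) \<Rightarrow> ('j \<Rightarrow> real) \<Rightarrow> 'b"
where
  "field_cond_exp M \<xi> J \<phi> c = (THE v. is_field_cond_exp M \<xi> J \<phi> c v)"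

section \<open>The game\<close>

definition sigma_functionals :: "('b::real_normed_vector \<Rightarrow>\<^sub>L real) set \<Rightarrow> 'b measure" where
  "sigma_functionals \<Phi> =
     sigma UNIV (\<Union>f\<in>\<Phi>. {blinfun_apply f -` A | A. A \<in> sets borel})"

definition strategies :: "('b::real_normed_vector \<Rightarrow>\<^sub>L real) set \<Rightarrow> ('b \<Rightarrow> 'b) set" where
  "strategies \<Phi> = measurable (sigma_functionals \<Phi>) borel"

text \<open>
  Losses are extended nonnegative numbers, since a measurable strategy may have infinite loss.
  Division of \<open>ennreal\<close> by \<open>0\<close> gives \<open>0 / 0 = 0\<close> and \<open>a / 0 = \<infinity>\<close> for \<open>a > 0\<close>; this fixes
  the loss at \<open>u = 0\<close> and at the Dirac measure in \<open>0\<close>, which the quotients leave undefined.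
\<close>

definition worst_loss :: "('b::real_normed_vector \<Rightarrow> 'b) \<Rightarrow> ennreal" where
  "worst_loss v = (SUP u. ennreal (norm (u - v u)) / ennreal (norm u))"

section \<open>Worst case measures\<close>

definition M2 :: "'b::real_normed_vector measure set" where
  "M2 = {\<mu>. prob_space \<mu> \<and> sets \<mu> = sets borel \<and> integrable \<mu> (\<lambda>x. (norm x)\<^sup>2)}"

definition Psi :: "('b::real_normed_vector \<Rightarrow> 'b) \<Rightarrow> 'b measure \<Rightarrow> ennreal" where
  "Psi v \<mu> = (\<integral>\<^sup>+x. ennreal ((norm (x - v x))\<^sup>2) \<partial>\<mu>) / (\<integral>\<^sup>+x. ennreal ((norm x)\<^sup>2) \<partial>\<mu>)"

definition eps_saddle_point ::
  "('b::real_normed_vector \<Rightarrow>\<^sub>L real) set \<Rightarrow> real \<Rightarrow> ('b \<Rightarrow> 'b) \<Rightarrow> 'b measure \<Rightarrow> bool"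
where
  "eps_saddle_point \<Phi> \<epsilon> v0 \<mu>0 \<longleftrightarrow>
     v0 \<in> strategies \<Phi> \<and> \<mu>0 \<in> M2 \<and>
     (\<forall>\<mu>\<in>M2. Psi v0 \<mu> \<le> Psi v0 \<mu>0 + ennreal \<epsilon>) \<and>
     (\<forall>v\<in>strategies \<Phi>. Psi v0 \<mu>0 \<le> Psi v \<mu>0 + ennreal \<epsilon>)"

text \<open>
  A continuous linear map into a finite-dimensional space is given, in coordinates of that space,
  by \<open>n\<close> functionals. Cylinder measures are set functions whose values outside of the cylinder
  sets are irrelevant.
\<close>

definition coord_map :: "nat \<Rightarrow> (nat \<Rightarrow> 'b::real_normed_vector \<Rightarrow>\<^sub>L real) \<Rightarrow> 'b \<Rightarrow> nat \<Rightarrow> real" where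
  "coord_map n f x = (\<lambda>i\<in>{..<n}. blinfun_apply (f i) x)"

definition cylinder_sets :: "'b::real_normed_vector set set" where
  "cylinder_sets = {coord_map n f -` A | n f A. A \<in> sets (\<Pi>\<^sub>M i\<in>{..<n}. borel)}"

definition cylinder_measure :: "('b::real_normed_vector set \<Rightarrow> real) \<Rightarrow> bool" where
  "cylinder_measure \<mu> \<longleftrightarrow>
     (\<forall>C\<in>cylinder_sets. \<forall>D\<in>cylinder_sets. C \<inter> D = {} \<longrightarrow> \<mu> (C \<union> D) = \<mu> C + \<mu> D) \<and>
     (\<forall>n f. \<exists>P. prob_space P \<and> sets P = sets (\<Pi>\<^sub>M i\<in>{..<n}. (borel :: real measure)) \<and>
        (\<forall>A\<in>sets P. measure P A = \<mu> (coord_map n f -` A)))"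

definition gaussian_cylinder_measure ::
  "(('b::real_normed_vector \<Rightarrow>\<^sub>L real) \<Rightarrow> 'b) \<Rightarrow> ('b set \<Rightarrow> real) \<Rightarrow> bool"
where
  "gaussian_cylinder_measure T \<mu> \<longleftrightarrow>
     cylinder_measure \<mu> \<and>
     (\<forall>f. \<forall>A\<in>sets borel.
        \<mu> (blinfun_apply f -` A) = measure (centered_gaussian (blinfun_apply f (T f))) A)"

definition finite_rank_projection :: "('b::real_normed_vector \<Rightarrow>\<^sub>L 'b) \<Rightarrow> bool" where
  "finite_rank_projection F \<longleftrightarrow>
     F o\<^sub>L F = F \<and> (\<exists>S. finite S \<and> range (blinfun_apply F) \<subseteq> span S)"

text \<open>
  For \<open>F\<close> of finite rank, the preimage under \<open>F\<close> of a Borel set of \<open>'b\<close> is a cylinder set. The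
  push-forward is regarded as a measure on \<open>'b\<close> that is carried by the range of \<open>F\<close>; since
  the range is closed, this does not affect weak convergence.
\<close>

definition cylinder_pushforward ::
  "('b::real_normed_vector \<Rightarrow>\<^sub>L 'b) \<Rightarrow> ('b set \<Rightarrow> real) \<Rightarrow> 'b measure"
where
  "cylinder_pushforward F \<mu> =
     measure_of UNIV (sets borel) (\<lambda>A. ennreal (\<mu> (blinfun_apply F -` A)))"

definition weak_conv_measures :: "(nat \<Rightarrow> 'b::topological_space measure) \<Rightarrow> 'b measure \<Rightarrow> bool" where
  "weak_conv_measures \<mu>s \<mu> \<longleftrightarrow>
     (\<forall>g :: 'b \<Rightarrow> real. continuous_on UNIV g \<and> bounded (range g) \<longrightarrow>
        (\<lambda>n. \<integral>x. g x \<partial>\<mu>s n) \<longlonglongrightarrow> (\<integral>x. g x \<partial>\<mu>))"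

definition weak_cylinder_conv ::
  "(nat \<Rightarrow> 'b::real_normed_vector measure) \<Rightarrow> ('b set \<Rightarrow> real) \<Rightarrow> bool"
where
  "weak_cylinder_conv \<mu>s \<mu> \<longleftrightarrow>
     (\<forall>F. finite_rank_projection F \<longrightarrow>
        weak_conv_measures (\<lambda>n. distr (\<mu>s n) borel (blinfun_apply F)) (cylinder_pushforward F \<mu>))"

definition saddle_point ::
  "('b::real_normed_vector \<Rightarrow>\<^sub>L real) set \<Rightarrow> ('b \<Rightarrow> 'b) \<Rightarrow> ('b set \<Rightarrow> real) \<Rightarrow> bool"
where
  "saddle_point \<Phi> v0 \<mu>0 \<longleftrightarrow>
     v0 \<in> strategies \<Phi> \<and> cylinder_measure \<mu>0 \<and>
     (\<exists>\<mu>s. (\<forall>n\<ge>1. eps_saddle_point \<Phi> (1 / real n) v0 (\<mu>s n)) \<and> weak_cylinder_conv \<mu>s \<mu>0)"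

definition worst_case_measure ::
  "('b::real_normed_vector \<Rightarrow>\<^sub>L real) set \<Rightarrow> ('b set \<Rightarrow> real) \<Rightarrow> bool"
where
  "worst_case_measure \<Phi> \<mu> \<longleftrightarrow> (\<exists>v. saddle_point \<Phi> v \<mu>)"

definition is_short ::
  "(('b::real_normed_vector \<Rightarrow>\<^sub>L real) \<Rightarrow> 'b) \<Rightarrow> ('b \<Rightarrow>\<^sub>L real) set \<Rightarrow> (('b \<Rightarrow>\<^sub>L real) \<Rightarrow> 'b) \<Rightarrow> bool"
where
  "is_short Q \<Phi> S \<longleftrightarrow>
     symmetric_operator S \<and>
     (\<forall>s. blinfun_apply s (S s) = (INF t\<in>\<Phi>. blinfun_apply (s + t) (Q (s + t))))"

text \<open>
  Gaussian cylinder measures are unique on cylinder sets only, so the statement that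
  \<^emph>\<open>the\<close> Gaussian cylinder measure with covariance \<open>T\<close> is worst case consists of its existence and
  of the property for each set function that represents it.
\<close>

definition gaussian_worst_case ::
  "('b::real_normed_vector \<Rightarrow>\<^sub>L real) set \<Rightarrow> (('b \<Rightarrow>\<^sub>L real) \<Rightarrow> 'b) \<Rightarrow> bool"
where
  "gaussian_worst_case \<Phi> T \<longleftrightarrow>
     (\<exists>\<mu>. gaussian_cylinder_measure T \<mu>) \<and>
     (\<forall>\<mu>. gaussian_cylinder_measure T \<mu> \<longrightarrow> worst_case_measure \<Phi> \<mu>)"

end

theory Submission
  imports Defs
begin

text \<open>
  The operator \<open>Q\<close> identifies \<open>'b\<close> with its dual and turns \<open>'b\<close> into a Hilbert space. The minimality of the
  gamblets says that \<open>\<psi> i\<close> is orthogonal to the kernel of the data \<open>\<phi> j\<close>, so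
  \<open>P x = (\<Sum>j. \<phi> j x *\<^sub>R \<psi> j)\<close> is the orthogonal projection along that kernel. A Gaussian residual that is
  uncorrelated with the data has a symmetric conditional law, hence conditioning the field on the
  data gives exactly \<open>P\<close>.

  A strategy takes the same value at \<open>w\<close> and \<open>- w\<close> for \<open>w\<close> in the kernel; this gives the minmax
  property of \<open>P\<close>. The same reflection, applied to the residual part of a Gaussian vector, bounds the
  loss of every strategy under the laws of truncated expansions of the field. In the limit the
  truncations converge on cylinders to the Gaussian with the shorted covariance or, if the part
  known from the data is retained, to the field itself; the finite contribution of the known
  part then becomes negligible when the dimension is infinite.
\<close>

section \<open>Joint laws are determined by linear combinations\<close>

text \<open>The hypotheses are one-dimensional: a Gaussian field prescribes the law of each single
  \<open>\<xi> f\<close>, and a Gaussian cylinder measure that of each single functional.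
  Conditioning, reflection and cylinder convergence concern joint laws. Since linear combinations of
  coordinates are again single functionals, the Cramer-Wold principle bridges this gap each time. A
  second obstacle is that conditional values are picked by \<open>THE\<close>: continuous regression
  functions agree a priori only almost everywhere, and it takes full support of the law of the data
  to make the value at every \<open>c\<close> unique. In infinite dimension the field is not the law
  of a random vector of the space. Hence only finite-rank vectors occur, and they are compared with
  the field functional by functional. The lower bound on losses avoids conditioning: the points
  \<open>k + w\<close> and \<open>k - w\<close> receive the same answer, so their errors differ by
  \<open>2 w\<close> and cannot both be small. Both Gaussian limits come from one family whose known
  part is scaled by \<delta>: the value 0 yields the short, the value 1 yields
  \<open>Q\<close>.\<close>

lemma weighted_law_unique:
  fixes X :: "'a \<Rightarrow> real" and Y :: "'c \<Rightarrow> real"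
  assumes "prob_space M" "prob_space N"
    and X[measurable]: "X \<in> borel_measurable M" and Y[measurable]: "Y \<in> borel_measurable N"
    and w[measurable]: "w \<in> borel_measurable M" and v[measurable]: "v \<in> borel_measurable N"
    and w_le: "\<And>x. \<bar>w x\<bar> \<le> (1::real)" and v_le: "\<And>x. \<bar>v x\<bar> \<le> (1::real)"
    and eq: "\<And>a s. (\<integral>x. w x * cos (a + s * X x) \<partial>M) = (\<integral>x. v x * cos (a + s * Y x) \<partial>N)"
    and law: "distr M borel X = distr N borel Y"
    and A[measurable]: "A \<in> sets borel"
  shows "(\<integral>x. w x * indicator A (X x) \<partial>M) = (\<integral>x. v x * indicator A (Y x) \<partial>N)"
proof -
  interpret M: prob_space M by fact
  interpret N: prob_space N by fact
  have iw: "integrable M (\<lambda>x. w x * g (X x))"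
    if "g \<in> borel_measurable borel" "\<And>y. \<bar>g y\<bar> \<le> 1" for g :: "real \<Rightarrow> real"
    by (rule M.integrable_const_bound[where B=1])
       (use that w_le in \<open>auto simp: abs_mult intro!: mult_le_one\<close>)
  have iv: "integrable N (\<lambda>x. v x * g (Y x))"
    if "g \<in> borel_measurable borel" "\<And>y. \<bar>g y\<bar> \<le> 1" for g :: "real \<Rightarrow> real"
    by (rule N.integrable_const_bound[where B=1])
       (use that v_le in \<open>auto simp: abs_mult intro!: mult_le_one\<close>)
  have i1: "integrable M (\<lambda>x. g (X x))" "integrable N (\<lambda>x. g (Y x))"
    if "g \<in> borel_measurable borel" "\<And>y. \<bar>g y\<bar> \<le> 1" for g :: "real \<Rightarrow> real"
    using that by (auto intro!: M.integrable_const_bound[where B=1] N.integrable_const_bound[where B=1])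
  have lawg: "(\<integral>x. g (X x) \<partial>M) = (\<integral>x. g (Y x) \<partial>N)"
    if [measurable]: "g \<in> borel_measurable borel" for g :: "real \<Rightarrow> real"
    using arg_cong[OF law, of "\<lambda>D. integral\<^sup>L D g"] by (simp add: integral_distr)
  \<comment> \<open>Levy uniqueness needs probability measures, but \<open>w\<close> may change
    sign. Adding 2 makes the weight at least 1, and the added multiple of the plain law is
    controlled by \<open>law\<close>. The normalization is the same on both sides by
    \<open>eq\<close> at zero phase and frequency.\<close>
  define c where "c = (\<integral>x. w x + 2 \<partial>M)"
  have iw0: "integrable M w" and iv0: "integrable N v"
    using iw[of "\<lambda>_. 1"] iv[of "\<lambda>_. 1"] by auto
  have wb: "-1 \<le> w x" for x using w_le[of x] by auto
  have vb: "-1 \<le> v x" for x using v_le[of x] by auto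
  have c': "c = (\<integral>x. v x + 2 \<partial>N)"
    using eq[of 0 0] iw0 iv0 by (simp add: c_def M.prob_space N.prob_space)
  have "(\<integral>x. -1 \<partial>M) \<le> integral\<^sup>L M w"
    by (rule integral_mono) (use iw0 wb in auto)
  then have c: "c \<ge> 1" using iw0 by (simp add: c_def M.prob_space)
  define D where "D = density M (\<lambda>x. ennreal ((w x + 2) / c))"
  define E where "E = density N (\<lambda>x. ennreal ((v x + 2) / c))"
  have wp: "0 \<le> (w x + 2) / c" for x using wb[of x] c by auto
  have vp: "0 \<le> (v x + 2) / c" for x using vb[of x] c by auto
  have D: "prob_space D" unfolding D_def
  proof (rule prob_spaceI)
    have "emeasure (density M (\<lambda>x. ennreal ((w x + 2) / c))) (space M) = (\<integral>\<^sup>+x. ennreal ((w x + 2) / c) \<partial>M)"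
      by (subst emeasure_density) (auto intro!: nn_integral_cong)
    also have "\<dots> = ennreal (\<integral>x. (w x + 2) / c \<partial>M)"
      by (rule nn_integral_eq_integral) (use iw0 wp in auto)
    also have "(\<integral>x. (w x + 2) / c \<partial>M) = 1" using c by (simp add: c_def[symmetric])
    finally show "emeasure (density M (\<lambda>x. ennreal ((w x + 2) / c)))
      (space (density M (\<lambda>x. ennreal ((w x + 2) / c)))) = 1" by simp
  qed
  have E: "prob_space E" unfolding E_def
  proof (rule prob_spaceI)
    have "emeasure (density N (\<lambda>x. ennreal ((v x + 2) / c))) (space N) = (\<integral>\<^sup>+x. ennreal ((v x + 2) / c) \<partial>N)"
      by (subst emeasure_density) (auto intro!: nn_integral_cong)
    also have "\<dots> = ennreal (\<integral>x. (v x + 2) / c \<partial>N)"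
      by (rule nn_integral_eq_integral) (use iv0 vp in auto)
    also have "(\<integral>x. (v x + 2) / c \<partial>N) = 1" using c by (simp add: c'[symmetric])
    finally show "emeasure (density N (\<lambda>x. ennreal ((v x + 2) / c)))
      (space (density N (\<lambda>x. ennreal ((v x + 2) / c)))) = 1" by simp
  qed
  have [measurable]: "X \<in> borel_measurable D" "Y \<in> borel_measurable E"
    by (auto simp: D_def E_def)
  have Dint: "(\<integral>x. g (X x) \<partial>D) = ((\<integral>x. w x * g (X x) \<partial>M) + 2 * (\<integral>x. g (X x) \<partial>M)) / c"
    if g[measurable]: "g \<in> borel_measurable borel" and b: "\<And>y. \<bar>g y\<bar> \<le> 1" for g :: "real \<Rightarrow> real"
  proof -
    have "(\<integral>x. g (X x) \<partial>D) = (\<integral>x. ((w x + 2) / c) * g (X x) \<partial>M)"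
      unfolding D_def by (subst integral_density) (use wp in auto)
    also have "\<dots> = (\<integral>x. (w x * g (X x) + 2 * g (X x)) / c \<partial>M)"
      by (simp add: algebra_simps)
    finally show ?thesis using iw[OF g b] i1(1)[OF g b] by simp
  qed
  have Eint: "(\<integral>x. g (Y x) \<partial>E) = ((\<integral>x. v x * g (Y x) \<partial>N) + 2 * (\<integral>x. g (Y x) \<partial>N)) / c"
    if g[measurable]: "g \<in> borel_measurable borel" and b: "\<And>y. \<bar>g y\<bar> \<le> 1" for g :: "real \<Rightarrow> real"
  proof -
    have "(\<integral>x. g (Y x) \<partial>E) = (\<integral>x. ((v x + 2) / c) * g (Y x) \<partial>N)"
      unfolding E_def by (subst integral_density) (use vp in auto)
    also have "\<dots> = (\<integral>x. (v x * g (Y x) + 2 * g (Y x)) / c \<partial>N)"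
      by (simp add: algebra_simps)
    finally show ?thesis using iv[OF g b] i1(2)[OF g b] by simp
  qed
  have cs: "(\<integral>x. cos (a + s * X x) \<partial>D) = (\<integral>x. cos (a + s * Y x) \<partial>E)" for a s
    using Dint[of "\<lambda>y. cos (a + s * y)"] Eint[of "\<lambda>y. cos (a + s * y)"]
      lawg[of "\<lambda>y. cos (a + s * y)"] eq[of a s] by simp
  interpret D: prob_space D by fact
  interpret E: prob_space E by fact
  interpret DX: real_distribution "distr D borel X" by (rule D.real_distribution_distr) simp
  interpret EY: real_distribution "distr E borel Y" by (rule E.real_distribution_distr) simp
  have "char (distr D borel X) s = char (distr E borel Y) s" for s
  proof (rule complex_eqI)
    have iD: "integrable D (\<lambda>x. iexp (s * X x))"
      by (rule D.integrable_const_bound[where B=1]) auto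
    have iE: "integrable E (\<lambda>x. iexp (s * Y x))"
      by (rule E.integrable_const_bound[where B=1]) auto
    have *: "char (distr D borel X) s = (\<integral>x. iexp (s * X x) \<partial>D)"
      "char (distr E borel Y) s = (\<integral>x. iexp (s * Y x) \<partial>E)"
      unfolding char_def by (auto simp: integral_distr)
    show "Re (char (distr D borel X) s) = Re (char (distr E borel Y) s)"
      unfolding * using cs[of 0 s] iD iE
      by (simp add: integral_Re[symmetric] Re_exp)
    \<comment> \<open>The phase \<open>a\<close> in \<open>eq\<close> supplies the imaginary part: a
      shift by \<open>-(pi/2)\<close> turns the cosine into a sine.\<close>
    have "(\<integral>x. sin (s * X x) \<partial>D) = (\<integral>x. sin (s * Y x) \<partial>E)"
      using cs[of "-(pi/2)" s] by (simp add: cos_diff)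
    then show "Im (char (distr D borel X) s) = Im (char (distr E borel Y) s)"
      unfolding * using iD iE
      by (simp add: integral_Im[symmetric] Im_exp)
  qed
  then have "distr D borel X = distr E borel Y"
    by (intro Levy_uniqueness DX.real_distribution_axioms EY.real_distribution_axioms ext)
  from arg_cong[OF this, of "\<lambda>D. integral\<^sup>L D (indicator A :: real \<Rightarrow> real)"]
  have "(\<integral>x. indicator A (X x) \<partial>D) = (\<integral>x. (indicator A (Y x)::real) \<partial>E)"
    by (subst (asm) (1 2) integral_distr) auto
  then show ?thesis
    using Dint[of "indicator A"] Eint[of "indicator A"] lawg[of "indicator A"] c
    by (simp add: indicator_def split: if_splits)
qed

text \<open>\<open>K\<close> collects the coordinates already tested by indicators; the others still
  enter through one cosine. An induction step trades one coordinate: with the remaining factors as a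
  bounded weight, equality at all frequencies of \<open>X l\<close> is the hypothesis of
  \<open>weighted_law_unique\<close>.\<close>

lemma cramer_wold_cos:
  fixes X :: "'j \<Rightarrow> 'a \<Rightarrow> real" and Y :: "'j \<Rightarrow> 'c \<Rightarrow> real"
  assumes M: "prob_space M" and N: "prob_space N"
    and X: "\<And>j. j \<in> J \<Longrightarrow> X j \<in> borel_measurable M"
    and Y: "\<And>j. j \<in> J \<Longrightarrow> Y j \<in> borel_measurable N"
    and J: "finite J"
    and law: "\<And>t. distr M borel (\<lambda>x. \<Sum>j\<in>J. t j * X j x) = distr N borel (\<lambda>x. \<Sum>j\<in>J. t j * Y j x)"
    and K: "K \<subseteq> J" and A: "\<And>j. j \<in> K \<Longrightarrow> A j \<in> sets borel"
  shows "(\<integral>x. (\<Prod>j\<in>K. indicator (A j) (X j x)) * cos (a + (\<Sum>j\<in>J-K. t j * X j x)) \<partial>M) =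
         (\<integral>x. (\<Prod>j\<in>K. indicator (A j) (Y j x)) * cos (a + (\<Sum>j\<in>J-K. t j * Y j x)) \<partial>N)"
  using finite_subset[OF K J] K A
proof (induction K arbitrary: a t rule: finite_induct)
  case empty
  have "(\<integral>x. cos (a + x) \<partial>distr M borel (\<lambda>x. \<Sum>j\<in>J. t j * X j x)) =
     (\<integral>x. cos (a + x) \<partial>distr N borel (\<lambda>x. \<Sum>j\<in>J. t j * Y j x))" by (simp only: law)
  then show ?case using X Y by (subst (asm) (1 2) integral_distr) auto
next
  case (insert l K)
  let ?J = "J - insert l K"
  have l: "l \<in> J" "l \<notin> K" and KJ: "K \<subseteq> J" using insert by auto
  have JK: "J - K = insert l ?J" using l by auto
  have [measurable]: "\<And>j. j \<in> K \<Longrightarrow> A j \<in> sets borel" "A l \<in> sets borel"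
    "X l \<in> borel_measurable M" "Y l \<in> borel_measurable N"
    "\<And>j. j \<in> K \<Longrightarrow> X j \<in> borel_measurable M" "\<And>j. j \<in> K \<Longrightarrow> Y j \<in> borel_measurable N"
    "\<And>j. j \<in> ?J \<Longrightarrow> X j \<in> borel_measurable M" "\<And>j. j \<in> ?J \<Longrightarrow> Y j \<in> borel_measurable N"
    using insert.prems X Y l KJ by auto
  interpret M: prob_space M by fact
  interpret N: prob_space N by fact
  define p where "p x = (\<Prod>j\<in>K. indicator (A j) (X j x) :: real)" for x
  define r where "r x = (\<Prod>j\<in>K. indicator (A j) (Y j x) :: real)" for x
  define \<sigma> where "\<sigma> x = a + (\<Sum>j\<in>?J. t j * X j x)" for x
  define \<tau> where "\<tau> x = a + (\<Sum>j\<in>?J. t j * Y j x)" for x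
  have [measurable]: "p \<in> borel_measurable M" "r \<in> borel_measurable N"
      "\<sigma> \<in> borel_measurable M" "\<tau> \<in> borel_measurable N"
    unfolding p_def r_def \<sigma>_def \<tau>_def by measurable
  have p: "\<bar>p x\<bar> \<le> 1" and r: "\<bar>r y\<bar> \<le> 1" for x y
    by (auto simp: p_def r_def abs_prod intro!: prod_le_1)
  have ip: "integrable M (\<lambda>x. p x * cos (f x))" if "f \<in> borel_measurable M" for f
    by (rule M.integrable_const_bound[where B=1])
       (use that p in \<open>auto simp: abs_mult intro!: mult_le_one\<close>)
  have ir: "integrable N (\<lambda>x. r x * cos (f x))" if "f \<in> borel_measurable N" for f
    by (rule N.integrable_const_bound[where B=1])
       (use that r in \<open>auto simp: abs_mult intro!: mult_le_one\<close>)
  \<comment> \<open>As the induction generalizes over \<open>t\<close>, the frequency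
    \<open>s\<close> at \<open>l\<close> can be chosen independently of those at the untouched
    coordinates.\<close>
  have IH: "(\<integral>x. p x * cos (b + e * (\<Sum>j\<in>?J. t j * X j x) + s * X l x) \<partial>M) =
      (\<integral>x. r x * cos (b + e * (\<Sum>j\<in>?J. t j * Y j x) + s * Y l x) \<partial>N)" for b s e
  proof -
    have "(\<Sum>j\<in>J-K. (if j = l then s else e * t j) * f j) = s * f l + e * (\<Sum>j\<in>?J. t j * f j)" for f
    proof -
      have "(\<Sum>j\<in>?J. (if j = l then s else e * t j) * f j) = e * (\<Sum>j\<in>?J. t j * f j)"
        unfolding sum_distrib_left by (intro sum.cong) auto
      then show ?thesis unfolding JK using J by simp
    qed
    with insert.IH[of b "\<lambda>j. if j = l then s else e * t j"] insert.prems KJ show ?thesis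
      unfolding p_def[symmetric] r_def[symmetric] by (simp add: algebra_simps)
  qed
  have "(\<integral>x. (p x * cos (\<sigma> x)) * indicator (A l) (X l x) \<partial>M) =
        (\<integral>x. (r x * cos (\<tau> x)) * indicator (A l) (Y l x) \<partial>N)"
  proof (rule weighted_law_unique[OF M N])
    show "\<bar>p x * cos (\<sigma> x)\<bar> \<le> 1" for x using p[of x] by (auto simp: abs_mult intro!: mult_le_one)
    show "\<bar>r x * cos (\<tau> x)\<bar> \<le> 1" for x using r[of x] by (auto simp: abs_mult intro!: mult_le_one)
    have "(\<Sum>j\<in>J. (if j = l then 1 else 0) * f j) = f l" for f :: "'j \<Rightarrow> real"
      using J l by (simp add: if_distrib[where f="\<lambda>x. x * _"] cong: if_cong)
    with law[of "\<lambda>j. if j = l then 1 else 0"]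
    show "distr M borel (X l) = distr N borel (Y l)" by simp
    fix b s
    \<comment> \<open>The cosine in the weight times the test cosine is a sum of two cosines of
      linear combinations, covered by \<open>IH\<close> with frequencies \<open>-s\<close> and
      \<open>s\<close> at \<open>l\<close>.\<close>
    have prod_cos: "y * cos d * cos e = (y * cos (d - e) + y * cos (d + e)) / 2" for y d e :: real
      using cos_times_cos[of d e] by (simp add: field_simps)
    have "(\<integral>x. p x * cos (\<sigma> x) * cos (b + s * X l x) \<partial>M) =
      (\<integral>x. (p x * cos (a - b + 1 * (\<Sum>j\<in>?J. t j * X j x) + (-s) * X l x) +
             p x * cos (a + b + 1 * (\<Sum>j\<in>?J. t j * X j x) + s * X l x)) / 2 \<partial>M)"
      unfolding prod_cos by (rule Bochner_Integration.integral_cong) (auto simp: \<sigma>_def algebra_simps)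
    also have "\<dots> = (\<integral>x. (r x * cos (a - b + 1 * (\<Sum>j\<in>?J. t j * Y j x) + (-s) * Y l x) +
             r x * cos (a + b + 1 * (\<Sum>j\<in>?J. t j * Y j x) + s * Y l x)) / 2 \<partial>N)"
      using IH[of "a-b" 1 "-s"] IH[of "a+b" 1 s]
      by (simp del: mult_1_left add: ip ir)
    also have "\<dots> = (\<integral>x. r x * cos (\<tau> x) * cos (b + s * Y l x) \<partial>N)"
      unfolding prod_cos by (rule Bochner_Integration.integral_cong) (auto simp: \<tau>_def algebra_simps)
    finally show "(\<integral>x. p x * cos (\<sigma> x) * cos (b + s * X l x) \<partial>M) =
      (\<integral>x. r x * cos (\<tau> x) * cos (b + s * Y l x) \<partial>N)" .
  qed measurable
  then show ?case using insert.hyps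
    by (simp add: p_def r_def \<sigma>_def \<tau>_def mult_ac)
qed

text \<open>For \<open>K = J\<close> and \<open>a = 0\<close> the cosine disappears, and
  \<open>cramer_wold_cos\<close> compares the probabilities of boxes, an intersection-stable
  generator.\<close>

lemma cramer_wold:
  fixes X :: "'j \<Rightarrow> 'a \<Rightarrow> real" and Y :: "'j \<Rightarrow> 'c \<Rightarrow> real"
  assumes M: "prob_space M" and N: "prob_space N"
    and X[measurable]: "\<And>j. j \<in> J \<Longrightarrow> X j \<in> borel_measurable M"
    and Y[measurable]: "\<And>j. j \<in> J \<Longrightarrow> Y j \<in> borel_measurable N"
    and J: "finite J"
    and law: "\<And>t. distr M borel (\<lambda>x. \<Sum>j\<in>J. t j * X j x) = distr N borel (\<lambda>x. \<Sum>j\<in>J. t j * Y j x)"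
  shows "distr M (\<Pi>\<^sub>M j\<in>J. borel) (\<lambda>x. \<lambda>j\<in>J. X j x) = distr N (\<Pi>\<^sub>M j\<in>J. borel) (\<lambda>x. \<lambda>j\<in>J. Y j x)"
proof (rule measure_eqI_PiM_finite[OF J, where A="\<lambda>_. space (\<Pi>\<^sub>M j\<in>J. borel)"])
  interpret M: prob_space M by fact
  interpret N: prob_space N by fact
  fix A :: "'j \<Rightarrow> real set" assume A: "\<And>i. i \<in> J \<Longrightarrow> A i \<in> sets borel"
  have box: "emeasure (distr L (\<Pi>\<^sub>M j\<in>J. borel) (\<lambda>x. \<lambda>j\<in>J. Z j x)) (Pi\<^sub>E J A) =
      ennreal (\<integral>x. (\<Prod>j\<in>J. indicator (A j) (Z j x)) \<partial>L)"
    if L: "prob_space L" and Z[measurable]: "\<And>j. j \<in> J \<Longrightarrow> Z j \<in> borel_measurable L"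
    for L :: "'d measure" and Z
  proof -
    interpret L: prob_space L by fact
    have [measurable]: "Pi\<^sub>E J A \<in> sets (\<Pi>\<^sub>M j\<in>J. borel)" using A J by (auto intro!: sets_PiM_I_finite)
    have S: "(\<lambda>x. \<lambda>j\<in>J. Z j x) -` Pi\<^sub>E J A \<inter> space L = {x\<in>space L. \<forall>j\<in>J. Z j x \<in> A j}"
      by (auto simp: PiE_def Pi_def)
    have [measurable]: "{x\<in>space L. \<forall>j\<in>J. Z j x \<in> A j} \<in> sets L"
      unfolding S[symmetric] by measurable
    have "(\<Prod>j\<in>J. indicator (A j) (Z j x)) = (indicator {x\<in>space L. \<forall>j\<in>J. Z j x \<in> A j} x :: real)"
      if "x \<in> space L" for x
    proof (cases "\<forall>j\<in>J. Z j x \<in> A j")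
      case False
      then show ?thesis using J that by (auto intro!: prod_zero bexI simp: indicator_eq_0_iff)
    qed (use that in simp)
    then have "(\<integral>x. (\<Prod>j\<in>J. indicator (A j) (Z j x)) \<partial>L) =
        (\<integral>x. (indicator {x\<in>space L. \<forall>j\<in>J. Z j x \<in> A j} x :: real) \<partial>L)"
      by (intro Bochner_Integration.integral_cong) auto
    then show ?thesis by (simp add: emeasure_distr S L.emeasure_eq_measure)
  qed
  show "emeasure (distr M (\<Pi>\<^sub>M j\<in>J. borel) (\<lambda>x. \<lambda>j\<in>J. X j x)) (Pi\<^sub>E J A) =
        emeasure (distr N (\<Pi>\<^sub>M j\<in>J. borel) (\<lambda>x. \<lambda>j\<in>J. Y j x)) (Pi\<^sub>E J A)"
    using cramer_wold_cos[OF M N X Y J law order.refl, of A 0] A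
    by (simp add: box M N)
next
  interpret MX: prob_space "distr M (\<Pi>\<^sub>M j\<in>J. borel) (\<lambda>x. \<lambda>j\<in>J. X j x)"
    by (rule prob_space.prob_space_distr[OF M]) measurable
  show "emeasure (distr M (\<Pi>\<^sub>M j\<in>J. borel) (\<lambda>x. \<lambda>j\<in>J. X j x)) (space (\<Pi>\<^sub>M j\<in>J. borel)) \<noteq> \<infinity>" for i :: nat
    by simp
  have "Pi\<^sub>E J (\<lambda>_. UNIV) \<in> prod_algebra J (\<lambda>_. borel)"
    using J by (intro prod_algebraI_finite) auto
  then show "range (\<lambda>_::nat. space (\<Pi>\<^sub>M j\<in>J. borel)) \<subseteq> prod_algebra J (\<lambda>_. borel)"
    by (auto simp: space_PiM)
qed (simp_all)

section \<open>The Hilbert space structure\<close>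

locale norm_operator_space =
  fixes Q :: "('b::real_normed_vector \<Rightarrow>\<^sub>L real) \<Rightarrow> 'b"
  assumes norm_operator: "norm_operator Q"
begin

definition ip :: "'b \<Rightarrow> 'b \<Rightarrow> real" where
  "ip x y = blinfun_apply (inv Q x) y"

lemma linear_Q: "linear Q" and bij_Q: "bij Q"
  and Q_sym: "blinfun_apply f (Q g) = blinfun_apply g (Q f)"
  using norm_operator by (auto simp: norm_operator_def symmetric_operator_def)

lemma Q_inv [simp]: "Q (inv Q x) = x" and inv_Q [simp]: "inv Q (Q f) = f"
  using bij_Q by (simp_all add: bij_is_surj surj_f_inv_f bij_is_inj)

lemma linear_inv_Q: "linear (inv Q)"
proof (rule linearI)
  show "inv Q (x + y) = inv Q x + inv Q y" for x y
    using inv_Q[of "inv Q x + inv Q y"] by (simp add: linear_add[OF linear_Q])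
  show "inv Q (c *\<^sub>R x) = c *\<^sub>R inv Q x" for c x
    using inv_Q[of "c *\<^sub>R inv Q x"] by (simp add: linear_scale[OF linear_Q])
qed

lemma apply_eq_ip: "blinfun_apply f x = ip (Q f) x"
  by (simp add: ip_def)

lemma ip_commute: "ip x y = ip y x"
  unfolding ip_def using Q_sym[of "inv Q x" "inv Q y"] by simp

lemma ip_self: "ip x x = (norm x)\<^sup>2"
  using norm_operator by (simp add: norm_operator_def ip_def)

lemma ip_right: "linear (ip x)"
  unfolding ip_def by (simp add: blinfun.bounded_linear_right bounded_linear.linear)

lemma ip_left: "linear (\<lambda>x. ip x y)"
proof -
  have "(\<lambda>x. ip x y) = ip y" by (rule ext) (rule ip_commute)
  then show ?thesis by (simp only: ip_right)
qed

lemmas ip_right_simps [simp] =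
  linear_add[OF ip_right] linear_diff[OF ip_right] linear_scale[OF ip_right] linear_sum[OF ip_right]
  linear_neg[OF ip_right] linear_0[OF ip_right]

lemmas ip_left_simps [simp] =
  linear_add[OF ip_left] linear_diff[OF ip_left] linear_scale[OF ip_left] linear_sum[OF ip_left]
  linear_neg[OF ip_left] linear_0[OF ip_left]

lemma norm_add_sq: "(norm (x + y))\<^sup>2 = (norm x)\<^sup>2 + 2 * ip x y + (norm y)\<^sup>2"
  unfolding ip_self[symmetric] by (simp add: ip_commute[of y x])

text \<open>Vanishing members are allowed, so that the Gram--Schmidt process applies to linearly dependent sequences.\<close>

definition orthonormal_or_zero :: "(nat \<Rightarrow> 'b) \<Rightarrow> bool" where
  "orthonormal_or_zero e \<longleftrightarrow> (\<forall>i j. ip (e i) (e j) = (if i = j \<and> e i \<noteq> 0 then 1 else 0))"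

abbreviation partial_expansion :: "(nat \<Rightarrow> 'b) \<Rightarrow> nat \<Rightarrow> 'b \<Rightarrow> 'b" where
  "partial_expansion e N x \<equiv> (\<Sum>i<N. ip x (e i) *\<^sub>R e i)"

lemma ip_partial_expansion:
  assumes "orthonormal_or_zero e" "j < N"
  shows "ip (partial_expansion e N x) (e j) = ip x (e j)"
proof -
  have "ip (partial_expansion e N x) (e j) = (\<Sum>i<N. if i = j then ip x (e j) else 0)"
    unfolding ip_left_simps using assms(1)
    by (intro sum.cong) (auto simp: orthonormal_or_zero_def)
  then show ?thesis using assms(2) by simp
qed

text \<open>Pythagoras: the expansion is orthogonal to what it leaves over. This uniform bound in
  \<open>N\<close> is what carries convergence from a dense set to its closure.\<close>

lemma norm_diff_partial_expansion_le:
  assumes "orthonormal_or_zero e"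
  shows "norm (x - partial_expansion e N x) \<le> norm x"
proof -
  let ?p = "partial_expansion e N x"
  have "ip ?p ?p = (\<Sum>j<N. ip x (e j) * ip ?p (e j))"
    by (subst linear_sum[OF ip_right]) simp
  also have "\<dots> = (\<Sum>j<N. ip x (e j) * ip x (e j))"
    using ip_partial_expansion[OF assms] by (intro sum.cong) auto
  also have "\<dots> = ip x ?p" by simp
  finally have "ip ?p (x - ?p) = 0" using ip_commute[of x ?p] by (simp only: linear_diff[OF ip_right])
  moreover have "?p + (x - ?p) = x" by (rule add_diff_eq[THEN trans]) (rule add_diff_cancel_left')
  ultimately have "(norm x)\<^sup>2 = (norm ?p)\<^sup>2 + (norm (x - ?p))\<^sup>2"
    using norm_add_sq[of ?p "x - ?p"] by (simp only: mult_zero_right add_0_right)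
  then have "(norm (x - ?p))\<^sup>2 \<le> (norm x)\<^sup>2"
    using zero_le_power2[of "norm ?p"] by linarith
  then show ?thesis by (rule power2_le_imp_le) (rule norm_ge_zero)
qed

text \<open>\<open>sgn\<close> divides by the norm and sends 0 to 0, so a dependent
  \<open>h n\<close> produces the zero vector and the indices of \<open>h\<close> and its
  orthonormalization stay aligned.\<close>

fun gram_schmidt :: "(nat \<Rightarrow> 'b) \<Rightarrow> nat \<Rightarrow> 'b" where
  "gram_schmidt h n = sgn (h n - (\<Sum>i<n. ip (h n) (gram_schmidt h i) *\<^sub>R gram_schmidt h i))"

declare gram_schmidt.simps [simp del]

lemma gram_schmidt_norm: "ip (gram_schmidt h n) (gram_schmidt h n) = (if gram_schmidt h n \<noteq> 0 then 1 else 0)"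
  by (subst (1 2 3) gram_schmidt.simps) (simp add: ip_self norm_sgn sgn_zero_iff)

lemma gram_schmidt_orthogonal: "i < n \<Longrightarrow> ip (gram_schmidt h n) (gram_schmidt h i) = 0"
proof (induction n arbitrary: i rule: less_induct)
  case (less n)
  let ?e = "gram_schmidt h"
  let ?r = "h n - (\<Sum>l<n. ip (h n) (?e l) *\<^sub>R ?e l)"
  have e: "ip (?e l) (?e i) = (if l = i \<and> ?e i \<noteq> 0 then 1 else 0)" if "l < n" for l
    using less.IH[of l i] less.IH[of i l] that less.prems gram_schmidt_norm[of h i]
    by (cases l i rule: linorder_cases) (auto simp: ip_commute)
  have "(\<Sum>l<n. ip (h n) (?e l) * ip (?e l) (?e i)) = (\<Sum>l<n. if l = i then ip (h n) (?e i) else 0)"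
    by (intro sum.cong) (auto simp: e)
  then have "ip ?r (?e i) = 0" using less.prems by simp
  then show ?case
    by (subst gram_schmidt.simps[of h n]) (simp only: sgn_div_norm linear_scale[OF ip_left] scaleR_zero_right)
qed

lemma orthonormal_or_zero_gram_schmidt: "orthonormal_or_zero (gram_schmidt h)"
  unfolding orthonormal_or_zero_def
  by (metis gram_schmidt_norm gram_schmidt_orthogonal ip_commute linorder_neqE_nat)

lemma gram_schmidt_in_subspace:
  assumes "subspace U" "\<And>n. h n \<in> U"
  shows "gram_schmidt h n \<in> U"
proof (induction n rule: less_induct)
  case (less n)
  show ?case
    by (subst gram_schmidt.simps)
       (auto simp: sgn_div_norm intro!: assms subspace_scale subspace_diff subspace_sum less)
qed

text \<open>Step \<open>n\<close> adds exactly the remainder \<open>r\<close> missing from the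
  earlier vectors, so the expansion is complete at \<open>Suc n\<close>. Being a combination of the
  first \<open>Suc n\<close> vectors, \<open>h n\<close> is orthogonal to all later ones, and longer
  expansions add nothing.\<close>

lemma gram_schmidt_expansion:
  assumes "n < N"
  shows "partial_expansion (gram_schmidt h) N (h n) = h n"
proof -
  let ?e = "gram_schmidt h"
  define r where "r = h n - partial_expansion ?e n (h n)"
  have e: "?e n = sgn r" unfolding r_def by (rule gram_schmidt.simps)
  have "ip (partial_expansion ?e n (h n)) (?e n) = 0"
    by (auto simp: ip_commute[of _ "?e n"] gram_schmidt_orthogonal intro!: sum.neutral)
  then have "ip (h n) (?e n) = ip r (?e n)"
    unfolding r_def by simp
  also have "\<dots> = norm r" by (cases "r = 0") (simp_all add: e sgn_div_norm ip_self power2_eq_square)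
  finally have c: "ip (h n) (?e n) = norm r" .
  have "norm r *\<^sub>R ?e n = r" unfolding e by (cases "r = 0") (simp_all add: sgn_div_norm)
  then have S: "partial_expansion ?e (Suc n) (h n) = h n"
    unfolding sum.lessThan_Suc c by (simp only: r_def add_diff_eq add_diff_cancel_left')
  have "ip (h n) (?e i) = 0" if "n < i" for i
    by (subst S[symmetric], unfold ip_left_simps, intro sum.neutral)
       (use that in \<open>auto simp: ip_commute[of _ "?e i"] gram_schmidt_orthogonal\<close>)
  then have "partial_expansion ?e N (h n) = partial_expansion ?e (Suc n) (h n)"
    using assms by (intro sum.mono_neutral_right) (auto simp: not_less_eq)
  from trans[OF this S] show ?thesis .
qed

text \<open>For \<open>N > n\<close> the remainder operator annihilates \<open>h n\<close>, so the
  remainder of \<open>x\<close> is that of \<open>x - h n\<close>, and it has norm at most that of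
  \<open>x - h n\<close>.\<close>

lemma partial_expansion_tendsto:
  assumes e: "orthonormal_or_zero e" and exp: "\<And>n N. n < N \<Longrightarrow> partial_expansion e N (h n) = h n"
    and x: "x \<in> closure (range h)"
  shows "(\<lambda>N. partial_expansion e N x) \<longlonglongrightarrow> x"
proof (rule LIMSEQ_I)
  fix r :: real assume "0 < r"
  with x obtain n where n: "dist (h n) x < r"
    by (auto simp: closure_approachable)
  show "\<exists>N0. \<forall>N\<ge>N0. norm (partial_expansion e N x - x) < r"
  proof (intro exI[of _ "Suc n"] allI impI)
    fix N assume "Suc n \<le> N"
    then have "partial_expansion e N (h n) = h n" by (intro exp) simp
    then have "x - partial_expansion e N x = (x - h n) - partial_expansion e N (x - h n)"
      by (simp add: scaleR_diff_left sum_subtractf del: ip_right_simps)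
    then have "norm (x - partial_expansion e N x) \<le> norm (x - h n)"
      using norm_diff_partial_expansion_le[OF e, of "x - h n" N] by (simp only:)
    with n show "norm (partial_expansion e N x - x) < r"
      by (simp add: dist_norm norm_minus_commute)
  qed
qed

text \<open>Provides orthonormal coordinates on a finite-dimensional subspace, by which finitely
  many functionals are turned into one random vector or one linear image of independent
  normals.\<close>

lemma finite_expansion:
  assumes "finite S"
  obtains e n where "orthonormal_or_zero e" "\<And>x. x \<in> span S \<Longrightarrow> partial_expansion e n x = x"
proof -
  obtain xs where xs: "set xs = S" using finite_list[OF assms] by auto
  define h where "h i = (if i < length xs then xs ! i else 0)" for i
  let ?p = "partial_expansion (gram_schmidt h) (length xs)"
  have p: "?p (c *\<^sub>R x + y) = c *\<^sub>R ?p x + ?p y" for c x y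
    by (simp only: ip_left_simps real_scaleR_def scaleR_add_left sum.distrib scaleR_sum_right scaleR_scaleR)
  have base: "?p x = x" if "x \<in> S" for x
  proof -
    from that obtain i where i: "i < length xs" "xs ! i = x" unfolding xs[symmetric] in_set_conv_nth by auto
    then have "h i = x" by (simp add: h_def)
    with gram_schmidt_expansion[OF i(1), of h] show ?thesis by (simp only:)
  qed
  have "?p x = x" if "x \<in> span S" for x
    using that
  proof (induction rule: span_induct_alt)
    case base
    show ?case by simp
  next
    case (step c x y)
    show ?case unfolding p step(2) base[OF step(1)] ..
  qed
  with orthonormal_or_zero_gram_schmidt show ?thesis by (rule that)
qed

end

section \<open>Gaussian laws\<close>

text \<open>Scaling a standard normal covers the point mass at \<open>v = 0\<close> and the
  densities uniformly, so later computations need no case distinction.\<close>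

lemma centered_gaussian_eq_distr:
  assumes "0 \<le> v"
  shows "centered_gaussian v = distr std_normal_distribution borel (\<lambda>x. sqrt v * x)"
proof (cases "v = 0")
  case True
  interpret real_distribution std_normal_distribution by (rule real_dist_normal_dist)
  show ?thesis using True by (simp add: centered_gaussian_def distr_const)
next
  case False
  interpret real_distribution std_normal_distribution by (rule real_dist_normal_dist)
  have "distributed std_normal_distribution lborel (\<lambda>x. x) std_normal_density"
    unfolding distributed_def by (simp add: distr_id2 cong: distr_cong)
  from normal_density_affine[OF this, of "sqrt v" 0] False assms
  have "distributed std_normal_distribution lborel (\<lambda>x. sqrt v * x) (normal_density 0 (sqrt v))"
    by simp
  then have "distr std_normal_distribution lborel (\<lambda>x. sqrt v * x) = density lborel (\<lambda>x. ennreal (normal_density 0 (sqrt v) x))"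
    by (simp add: distributed_def)
  moreover have "distr std_normal_distribution lborel (\<lambda>x. sqrt v * x) = distr std_normal_distribution borel (\<lambda>x. sqrt v * x)"
    by (rule distr_cong) auto
  ultimately show ?thesis using False by (simp add: centered_gaussian_def)
qed

lemma real_distribution_centered_gaussian:
  assumes "0 \<le> v" shows "real_distribution (centered_gaussian v)"
proof -
  interpret real_distribution std_normal_distribution by (rule real_dist_normal_dist)
  show ?thesis unfolding centered_gaussian_eq_distr[OF assms] by (rule real_distribution_distr) simp
qed

lemma char_centered_gaussian:
  assumes "0 \<le> v"
  shows "char (centered_gaussian v) t = complex_of_real (exp (- (v * t\<^sup>2) / 2))"
proof -
  have "char (centered_gaussian v) t = char std_normal_distribution (sqrt v * t)"
    unfolding centered_gaussian_eq_distr[OF assms] char_def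
    by (subst integral_distr) (auto simp: mult_ac)
  then show ?thesis using assms by (simp add: char_std_normal_distribution power_mult_distrib)
qed

lemma centered_gaussian_second_moment:
  assumes "0 \<le> v"
  shows "(\<integral>x. x\<^sup>2 \<partial>centered_gaussian v) = v"
proof -
  have "(\<integral>x. x\<^sup>2 \<partial>centered_gaussian v) = (\<integral>x. v * x\<^sup>2 \<partial>std_normal_distribution)"
    unfolding centered_gaussian_eq_distr[OF assms]
    using assms by (subst integral_distr) (auto simp: power_mult_distrib)
  also have "\<dots> = v" using std_normal_distribution_even_moments[of 1] by simp
  finally show ?thesis .
qed

lemma law_linear_combination_PiM_std_normal:
  fixes c :: "nat \<Rightarrow> real" and n :: nat
  defines "N \<equiv> \<Pi>\<^sub>M i\<in>{..<n}. std_normal_distribution"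
  shows "distr N borel (\<lambda>z. \<Sum>i<n. c i * z i) = centered_gaussian (\<Sum>i<n. (c i)\<^sup>2)"
proof -
  interpret std: real_distribution std_normal_distribution by (rule real_dist_normal_dist)
  interpret N: prob_space N unfolding N_def by (rule prob_space_PiM) (rule std.prob_space_axioms)
  have comp[measurable]: "(\<lambda>z. z i) \<in> borel_measurable N" if "i < n" for i
    using that measurable_component_singleton[of i "{..<n}" "\<lambda>_. std_normal_distribution"] unfolding N_def by simp
  have law: "distr N borel (\<lambda>z. z i) = std_normal_distribution" if "i < n" for i
  proof -
    have "distr N std_normal_distribution (\<lambda>z. z i) = std_normal_distribution"
      unfolding N_def using distr_PiM_component[of "{..<n}" "\<lambda>_. std_normal_distribution" i] that std.prob_space_axioms by simp
    moreover have "distr N std_normal_distribution (\<lambda>z. z i) = distr N borel (\<lambda>z. z i)"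
      by (rule distr_cong) auto
    ultimately show ?thesis by simp
  qed
  have "char (distr N borel (\<lambda>z. \<Sum>i<n. c i * z i)) t = char (centered_gaussian (\<Sum>i<n. (c i)\<^sup>2)) t" for t
  \<comment> \<open>Independence is read off from the product form of the joint law, a criterion for
    nonempty index sets; the empty sum is constantly 0.\<close>
  proof (cases "n = 0")
    case True
    then show ?thesis by (simp add: char_def integral_distr N.prob_space centered_gaussian_def integral_return)
  next
    case False
    have "distr N (\<Pi>\<^sub>M i\<in>{..<n}. borel) (\<lambda>z. \<lambda>i\<in>{..<n}. z i) = distr N N (\<lambda>z. z)"
      by (rule distr_cong) (auto simp: N_def space_PiM PiE_def extensional_restrict intro!: sets_PiM_cong)
    also have "\<dots> = N" by (rule distr_id)
    also have "\<dots> = (\<Pi>\<^sub>M i\<in>{..<n}. distr N borel (\<lambda>z. z i))"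
      unfolding N_def by (rule PiM_cong) (use law in \<open>auto simp: N_def\<close>)
    finally have "N.indep_vars (\<lambda>_. borel) (\<lambda>i z. z i) {..<n}"
      by (subst N.indep_vars_iff_distr_eq_PiM') (use False in auto)
    then have indep: "N.indep_vars (\<lambda>_. borel) (\<lambda>i z. c i * z i) {..<n}"
      by (rule N.indep_vars_compose2) auto
    have "char (distr N borel (\<lambda>z. \<Sum>i<n. c i * z i)) t = (\<Prod>i<n. char (distr N borel (\<lambda>z. c i * z i)) t)"
      by (rule N.char_distr_sum[OF indep])
    also have "\<dots> = (\<Prod>i<n. complex_of_real (exp (- ((c i)\<^sup>2 * t\<^sup>2) / 2)))"
    proof (rule prod.cong[OF refl])
      fix i assume "i \<in> {..<n}"
      then have i: "i < n" by simp
      have "char (distr N borel (\<lambda>z. c i * z i)) t = char (distr N borel (\<lambda>z. z i)) (c i * t)"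
        unfolding char_def using comp[OF i] by (subst (1 2) integral_distr) (auto simp: mult_ac)
      then show "char (distr N borel (\<lambda>z. c i * z i)) t = complex_of_real (exp (- ((c i)\<^sup>2 * t\<^sup>2) / 2))"
        by (simp add: law[OF i] char_std_normal_distribution power_mult_distrib)
    qed
    also have "\<dots> = complex_of_real (exp (\<Sum>i<n. - ((c i)\<^sup>2 * t\<^sup>2) / 2))"
      by (simp add: exp_sum)
    also have "(\<Sum>i<n. - ((c i)\<^sup>2 * t\<^sup>2) / 2) = - ((\<Sum>i<n. (c i)\<^sup>2) * t\<^sup>2) / 2"
      by (simp add: sum_divide_distrib sum_distrib_right sum_negf)
    also have "complex_of_real (exp \<dots>) = char (centered_gaussian (\<Sum>i<n. (c i)\<^sup>2)) t"
      by (rule char_centered_gaussian[symmetric]) (simp add: sum_nonneg)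
    finally show ?thesis .
  qed
  then show ?thesis
    by (intro Levy_uniqueness ext N.real_distribution_distr real_distribution_centered_gaussian sum_nonneg)
       auto
qed

lemma std_normal_interval_pos:
  assumes "a < b"
  shows "emeasure std_normal_distribution {a<..<b} \<noteq> 0"
proof
  assume "emeasure std_normal_distribution {a<..<b} = 0"
  then have "(\<integral>\<^sup>+x. ennreal (std_normal_density x) * indicator {a<..<b} x \<partial>lborel) = 0"
    by (subst (asm) emeasure_density) auto
  then have "AE x in lborel. ennreal (std_normal_density x) * indicator {a<..<b} x = 0"
    by (subst (asm) nn_integral_0_iff_AE) auto
  then have "AE x in lborel. x \<notin> {a<..<b}"
  proof eventually_elim
    case (elim x)
    then show ?case using normal_density_pos[of 1 0 x] by (auto simp: indicator_def ennreal_eq_0_iff)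
  qed
  then have "emeasure lborel {a<..<b} = 0"
    by (subst (asm) AE_iff_measurable[where N="{a<..<b}"]) auto
  then show False using assms by simp
qed

section \<open>Variances, almost sure linearity and joint laws of the field\<close>

locale gaussian_field_space = norm_operator_space Q
  for Q :: "('b::real_normed_vector \<Rightarrow>\<^sub>L real) \<Rightarrow> 'b" +
  fixes M :: "'w measure" and \<xi> :: "('b \<Rightarrow>\<^sub>L real) \<Rightarrow> 'w \<Rightarrow> real"
  assumes gaussian_field: "gaussian_field M Q \<xi>"
begin

sublocale prob_space M
  using gaussian_field by (simp add: gaussian_field_def)

lemma field_measurable [measurable]: "\<xi> f \<in> borel_measurable M"
  and integrable_field_sq: "integrable M (\<lambda>\<omega>. (\<xi> f \<omega>)\<^sup>2)"
  and field_linear: "AE \<omega> in M. \<xi> (a *\<^sub>R f + b *\<^sub>R g) \<omega> = a * \<xi> f \<omega> + b * \<xi> g \<omega>"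
  and field_cov: "expectation (\<lambda>\<omega>. \<xi> f \<omega> * \<xi> g \<omega>) = blinfun_apply f (Q g)"
  using gaussian_field by (auto simp: gaussian_field_def)

lemma apply_Q_self: "blinfun_apply f (Q f) = (norm (Q f))\<^sup>2"
  by (simp add: apply_eq_ip ip_self)

lemma integrable_field: "integrable M (\<xi> f)"
  by (rule square_integrable_imp_integrable) (auto intro: integrable_field_sq)

text \<open>The definition of the field grants some centered Gaussian law; the covariance identity
  fixes its second moment and hence its variance.\<close>

lemma law_field: "distr M borel (\<xi> f) = centered_gaussian (blinfun_apply f (Q f))"
proof -
  obtain v where v: "0 \<le> v" "distr M borel (\<xi> f) = centered_gaussian v"
    using gaussian_field unfolding gaussian_field_def by blast
  have "v = (\<integral>x. x\<^sup>2 \<partial>distr M borel (\<xi> f))"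
    unfolding v(2) by (rule centered_gaussian_second_moment[OF v(1), symmetric])
  also have "\<dots> = expectation (\<lambda>\<omega>. \<xi> f \<omega> * \<xi> f \<omega>)"
    by (subst integral_distr) (auto simp: power2_eq_square)
  finally show ?thesis using v(2) by (simp add: field_cov)
qed

lemma AE_field_sum:
  assumes "finite J"
  shows "AE \<omega> in M. \<xi> (\<Sum>j\<in>J. t j *\<^sub>R F j) \<omega> = (\<Sum>j\<in>J. t j * \<xi> (F j) \<omega>)"
  using assms
proof induction
  case empty
  show ?case using field_linear[of 0 0 0 0] by simp
next
  case (insert j J)
  from insert.IH field_linear[of "t j" "F j" 1 "\<Sum>j\<in>J. t j *\<^sub>R F j"] show ?case
    by eventually_elim (use insert.hyps in simp)
qed

lemma AE_field_diff: "AE \<omega> in M. \<xi> (f - g) \<omega> = \<xi> f \<omega> - \<xi> g \<omega>"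
  using field_linear[of 1 f "-1" g] by simp

lemma AE_field_minus: "AE \<omega> in M. \<xi> (- f) \<omega> = - \<xi> f \<omega>"
  using field_linear[of "-1" f 0 0] by simp

lemma law_field_sum:
  assumes "finite J"
  shows "distr M borel (\<lambda>\<omega>. \<Sum>j\<in>J. t j * \<xi> (F j) \<omega>) =
    centered_gaussian (\<Sum>i\<in>J. \<Sum>j\<in>J. t i * t j * blinfun_apply (F i) (Q (F j)))"
proof -
  have "distr M borel (\<lambda>\<omega>. \<Sum>j\<in>J. t j * \<xi> (F j) \<omega>) = distr M borel (\<xi> (\<Sum>j\<in>J. t j *\<^sub>R F j))"
    by (rule distr_cong_AE) (use AE_field_sum[OF assms, of t F] in \<open>auto intro: AE_mp\<close>)
  moreover have "blinfun_apply (\<Sum>j\<in>J. t j *\<^sub>R F j) (Q (\<Sum>j\<in>J. t j *\<^sub>R F j)) =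
      (\<Sum>i\<in>J. \<Sum>j\<in>J. t i * t j * blinfun_apply (F i) (Q (F j)))"
    by (simp add: blinfun.sum_left blinfun.sum_right blinfun.scaleR_left blinfun.scaleR_right
        linear_sum[OF linear_Q] linear_scale[OF linear_Q] sum_distrib_left mult.assoc)
      (intro sum.cong refl arg_cong2[where f="(*)"] Q_sym)
  ultimately show ?thesis by (simp only: law_field)
qed

text \<open>A centered Gaussian family is determined by its Gram matrix. Applied to sign changes of
  members uncorrelated with the data, this is the source of every reflection argument.\<close>

lemma joint_law_eqI:
  assumes J: "finite J"
    and gram: "\<And>i j. i \<in> J \<Longrightarrow> j \<in> J \<Longrightarrow> blinfun_apply (F i) (Q (F j)) = blinfun_apply (G i) (Q (G j))"
  shows "distr M (\<Pi>\<^sub>M j\<in>J. borel) (\<lambda>\<omega>. \<lambda>j\<in>J. \<xi> (F j) \<omega>) =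
         distr M (\<Pi>\<^sub>M j\<in>J. borel) (\<lambda>\<omega>. \<lambda>j\<in>J. \<xi> (G j) \<omega>)"
proof (rule cramer_wold[OF prob_space_axioms prob_space_axioms _ _ J])
  show "distr M borel (\<lambda>\<omega>. \<Sum>j\<in>J. t j * \<xi> (F j) \<omega>) = distr M borel (\<lambda>\<omega>. \<Sum>j\<in>J. t j * \<xi> (G j) \<omega>)" for t
    unfolding law_field_sum[OF J] by (intro arg_cong[where f=centered_gaussian] sum.cong) (auto simp: gram)
qed auto

end

lemma open_fun_contains_box:
  fixes U :: "('i \<Rightarrow> 'a::topological_space) set"
  assumes "open U" "z \<in> U"
  obtains X where "\<And>i. open (X i)" "\<And>i. z i \<in> X i" "\<And>w. (\<And>i. w i \<in> X i) \<Longrightarrow> w \<in> U"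
proof -
  have "openin (product_topology (\<lambda>_. euclidean) UNIV) U" using assms(1) by (simp add: open_fun_def)
  from product_topology_open_contains_basis[OF this assms(2)]
  obtain X where X: "z \<in> (\<Pi>\<^sub>E i\<in>UNIV. X i) \<and> (\<forall>i. openin euclidean (X i)) \<and>
      finite {i. X i \<noteq> topspace euclidean} \<and> (\<Pi>\<^sub>E i\<in>UNIV. X i) \<subseteq> U" by (elim exE)
  show ?thesis
  proof (rule that[of X])
    show "w \<in> U" if "\<And>i. w i \<in> X i" for w
    proof -
      have "w \<in> (\<Pi>\<^sub>E i\<in>UNIV. X i)" using that by (simp add: PiE_iff)
      then show ?thesis using X by blast
    qed
  qed (use X in \<open>simp_all add: PiE_iff\<close>)
qed

section \<open>Existence and uniqueness of continuous regression functions\<close>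

context gaussian_field_space
begin

text \<open>\<open>orth\<close> is the system of normal equations for the coefficients
  \<open>a\<close>. Uncorrelatedness alone would not give a conditional expectation; the Gaussian
  reflection of the residual makes its integral over every event of the data equal to its own
  negative.\<close>

lemma regression_function_linear:
  fixes \<phi> :: "'j \<Rightarrow> 'b \<Rightarrow>\<^sub>L real"
  assumes J: "finite J"
    and orth: "\<And>l. l \<in> J \<Longrightarrow> blinfun_apply (f - (\<Sum>j\<in>J. a j *\<^sub>R \<phi> j)) (Q (\<phi> l)) = 0"
  shows "regression_function M (\<xi> f) J (\<lambda>j. \<xi> (\<phi> j)) (\<lambda>y. \<Sum>j\<in>J. a j * y j)"
proof -
  define r where "r = f - (\<Sum>j\<in>J. a j *\<^sub>R \<phi> j)"
  define Y where "Y \<omega> = (\<lambda>j\<in>J. \<xi> (\<phi> j) \<omega>)" for \<omega>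
  define V where "V = vimage_algebra (space M) Y (\<Pi>\<^sub>M j\<in>J. (borel :: real measure))"
  have [measurable]: "Y \<in> measurable M (\<Pi>\<^sub>M j\<in>J. borel)" unfolding Y_def by measurable
  have Ysp: "Y \<in> space M \<rightarrow> space (\<Pi>\<^sub>M j\<in>J. (borel :: real measure))"
    by (auto simp: Y_def space_PiM)
  have sub: "subalgebra M V"
    unfolding subalgebra_def V_def using Ysp by (auto simp: sets_vimage_algebra2)
  interpret V: finite_measure_subalgebra M V
    by standard (rule sub)
  have fr: "AE \<omega> in M. \<xi> f \<omega> = (\<Sum>j\<in>J. a j * \<xi> (\<phi> j) \<omega>) + \<xi> r \<omega>"
    using AE_field_sum[OF J, of a \<phi>] AE_field_diff[of f "\<Sum>j\<in>J. a j *\<^sub>R \<phi> j"]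
    by eventually_elim (simp add: r_def)
  \<comment> \<open>Replacing the residual by its negative preserves the joint law with the data.\<close>
  have zero: "expectation (\<lambda>\<omega>. \<xi> r \<omega> * indicator B (Y \<omega>)) = 0"
    if B[measurable]: "B \<in> sets (\<Pi>\<^sub>M j\<in>J. (borel :: real measure))" for B
  proof -
    \<comment> \<open>\<open>None\<close> carries the residual and \<open>Some j\<close> the datum
      \<open>j\<close>, so that both form one family with a joint law; \<open>k\<close> is the
      integrand as a function on its values.\<close>
    define K where "K = insert None (Some ` J)"
    define k where "k y = y None * (indicator B (\<lambda>j\<in>J. y (Some j)) :: real)" for y :: "'j option \<Rightarrow> real"
    have K: "finite K" "None \<in> K" "\<And>j. j \<in> J \<Longrightarrow> Some j \<in> K" using J by (auto simp: K_def)
    have [measurable]: "k \<in> borel_measurable (\<Pi>\<^sub>M j\<in>K. borel)"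
    proof -
      have [measurable]: "(\<lambda>y. y None) \<in> borel_measurable (\<Pi>\<^sub>M j\<in>K. (borel :: real measure))"
        using K(2) by measurable
      have [measurable]: "(\<lambda>y. \<lambda>j\<in>J. y (Some j)) \<in> measurable (\<Pi>\<^sub>M j\<in>K. (borel :: real measure)) (\<Pi>\<^sub>M j\<in>J. borel)"
        using K(3) by (intro measurable_restrict) measurable
      show ?thesis unfolding k_def by measurable
    qed
    have lawk: "expectation (\<lambda>\<omega>. k (\<lambda>j\<in>K. \<xi> (case_option s \<phi> j) \<omega>)) =
        (\<integral>y. k y \<partial>distr M (\<Pi>\<^sub>M j\<in>K. borel) (\<lambda>\<omega>. \<lambda>j\<in>K. \<xi> (case_option s \<phi> j) \<omega>))" for s
      by (subst integral_distr) auto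
    have kY: "k (\<lambda>j\<in>K. \<xi> (case_option s \<phi> j) \<omega>) = \<xi> s \<omega> * indicator B (Y \<omega>)" for s \<omega>
    proof -
      have "(\<lambda>j\<in>J. (\<lambda>j\<in>K. \<xi> (case_option s \<phi> j) \<omega>) (Some j)) = Y \<omega>"
        unfolding Y_def using K by (intro restrict_ext) auto
      then show ?thesis unfolding k_def using K by simp
    qed
    have "distr M (\<Pi>\<^sub>M j\<in>K. borel) (\<lambda>\<omega>. \<lambda>j\<in>K. \<xi> (case_option r \<phi> j) \<omega>) =
      distr M (\<Pi>\<^sub>M j\<in>K. borel) (\<lambda>\<omega>. \<lambda>j\<in>K. \<xi> (case_option (- r) \<phi> j) \<omega>)"
    proof (rule joint_law_eqI[OF K(1)])
      have "blinfun_apply r (Q (\<phi> l)) = 0" "blinfun_apply (\<phi> l) (Q r) = 0" if "l \<in> J" for l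
        using orth[OF that] Q_sym[of r "\<phi> l"] by (auto simp: r_def)
      then show "blinfun_apply (case_option r \<phi> i) (Q (case_option r \<phi> j)) =
          blinfun_apply (case_option (- r) \<phi> i) (Q (case_option (- r) \<phi> j))" if "i \<in> K" "j \<in> K" for i j
        using that by (auto simp: K_def linear_neg[OF linear_Q] blinfun.minus_left blinfun.minus_right)
    qed
    then have "expectation (\<lambda>\<omega>. \<xi> r \<omega> * indicator B (Y \<omega>)) = expectation (\<lambda>\<omega>. \<xi> (- r) \<omega> * indicator B (Y \<omega>))"
      using lawk[of r] lawk[of "- r"] unfolding kY by simp
    also have "\<dots> = expectation (\<lambda>\<omega>. - (\<xi> r \<omega> * indicator B (Y \<omega>)))"
      by (rule integral_cong_AE) (use AE_field_minus[of r] in \<open>auto elim: AE_mp\<close>)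
    also have "\<dots> = - expectation (\<lambda>\<omega>. \<xi> r \<omega> * indicator B (Y \<omega>))" by simp
    finally show ?thesis by linarith
  qed
  have "AE \<omega> in M. real_cond_exp M V (\<xi> f) \<omega> = (\<Sum>j\<in>J. a j * Y \<omega> j)"
  proof (rule V.real_cond_exp_charact)
    have Yj: "(\<lambda>\<omega>. Y \<omega> j) \<in> borel_measurable V" if "j \<in> J" for j
      unfolding V_def using that
      by (intro measurable_compose[OF measurable_vimage_algebra1[OF Ysp]]) auto
    show "(\<lambda>\<omega>. \<Sum>j\<in>J. a j * Y \<omega> j) \<in> borel_measurable V"
      using Yj by (intro borel_measurable_sum borel_measurable_times) auto
    show intS: "integrable M (\<lambda>\<omega>. \<Sum>j\<in>J. a j * Y \<omega> j)"
      unfolding Y_def using integrable_field by auto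
    show "integrable M (\<xi> f)" by (rule integrable_field)
    fix A assume "A \<in> sets V"
    then obtain B where B[measurable]: "B \<in> sets (\<Pi>\<^sub>M j\<in>J. (borel :: real measure))" and A: "A = Y -` B \<inter> space M"
      unfolding V_def sets_vimage_algebra2[OF Ysp] by auto
    have [measurable]: "A \<in> sets M" unfolding A by measurable
    have "set_lebesgue_integral M A (\<xi> f) =
      expectation (\<lambda>\<omega>. indicator A \<omega> * (\<Sum>j\<in>J. a j * Y \<omega> j) + \<xi> r \<omega> * indicator B (Y \<omega>))"
      unfolding set_lebesgue_integral_def
    proof (rule integral_cong_AE)
      show "AE \<omega> in M. indicat_real A \<omega> *\<^sub>R \<xi> f \<omega> =
        indicat_real A \<omega> * (\<Sum>j\<in>J. a j * Y \<omega> j) + \<xi> r \<omega> * indicat_real B (Y \<omega>)"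
        using fr AE_space by eventually_elim (auto simp: A Y_def indicator_def)
      show "(\<lambda>\<omega>. indicat_real A \<omega> * (\<Sum>j\<in>J. a j * Y \<omega> j) + \<xi> r \<omega> * indicat_real B (Y \<omega>)) \<in> borel_measurable M"
        using borel_measurable_integrable[OF intS] by measurable
    qed measurable
    also have "\<dots> = expectation (\<lambda>\<omega>. indicator A \<omega> * (\<Sum>j\<in>J. a j * Y \<omega> j))"
    proof (subst Bochner_Integration.integral_add)
      show "integrable M (\<lambda>\<omega>. indicat_real A \<omega> * (\<Sum>j\<in>J. a j * Y \<omega> j))"
        using integrable_mult_indicator[OF _ intS, of A] by simp
      show "integrable M (\<lambda>\<omega>. \<xi> r \<omega> * indicat_real B (Y \<omega>))"
        by (rule Bochner_Integration.integrable_bound[OF integrable_field[of r]]) (auto simp: indicator_def)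
    qed (simp add: zero[OF B])
    finally show "set_lebesgue_integral M A (\<xi> f) = set_lebesgue_integral M A (\<lambda>\<omega>. \<Sum>j\<in>J. a j * Y \<omega> j)"
      by (simp add: set_lebesgue_integral_def)
  qed
  moreover have "continuous_on (J \<rightarrow>\<^sub>E UNIV) (\<lambda>y. \<Sum>j\<in>J. a j * y j)"
    by (intro continuous_intros continuous_on_subset[OF continuous_on_product_coordinates]) auto
  ultimately show ?thesis
    unfolding regression_function_def V_def Y_def by auto
qed

text \<open>The data are distributed as a linear image of finitely many independent standard
  normals. Some box around a preimage of the given values is mapped into the open sets
  \<open>B j\<close>, and such a box has positive probability.\<close>

lemma field_full_support:
  fixes \<phi> :: "'j \<Rightarrow> 'b \<Rightarrow>\<^sub>L real"
  assumes J: "finite J" and B: "\<And>j. j \<in> J \<Longrightarrow> open (B j)" "\<And>j. j \<in> J \<Longrightarrow> blinfun_apply (\<phi> j) x \<in> B j"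
  shows "\<not> (AE \<omega> in M. \<exists>j\<in>J. \<xi> (\<phi> j) \<omega> \<notin> B j)"
proof
  assume AE: "AE \<omega> in M. \<exists>j\<in>J. \<xi> (\<phi> j) \<omega> \<notin> B j"
  obtain e n where e: "orthonormal_or_zero e"
    and ex: "\<And>x. x \<in> span ((Q \<circ> \<phi>) ` J) \<Longrightarrow> partial_expansion e n x = x"
    using finite_expansion[of "(Q \<circ> \<phi>) ` J"] J by auto
  have Q\<phi>: "Q (\<phi> j) = (\<Sum>i<n. blinfun_apply (\<phi> j) (e i) *\<^sub>R e i)" if "j \<in> J" for j
  proof -
    have "Q (\<phi> j) \<in> span ((Q \<circ> \<phi>) ` J)" using that by (intro span_base) auto
    from ex[OF this] show ?thesis by (simp only: apply_eq_ip)
  qed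
  interpret std: real_distribution std_normal_distribution by (rule real_dist_normal_dist)
  define N where "N = (\<Pi>\<^sub>M i\<in>{..<n}. std_normal_distribution)"
  interpret N: prob_space N unfolding N_def by (rule prob_space_PiM) (rule std.prob_space_axioms)
  define Y where "Y j z = (\<Sum>i<n. blinfun_apply (\<phi> j) (e i) * z i)" for j and z :: "nat \<Rightarrow> real"
  have [measurable]: "(\<lambda>z. z i) \<in> borel_measurable N" if "i < n" for i
    using that measurable_component_singleton[of i "{..<n}" "\<lambda>_. std_normal_distribution"] unfolding N_def by simp
  have Ym[measurable]: "Y j \<in> borel_measurable N" for j unfolding Y_def by measurable
  have law: "distr M (\<Pi>\<^sub>M j\<in>J. borel) (\<lambda>\<omega>. \<lambda>j\<in>J. \<xi> (\<phi> j) \<omega>) = distr N (\<Pi>\<^sub>M j\<in>J. borel) (\<lambda>z. \<lambda>j\<in>J. Y j z)"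
  proof (rule cramer_wold[OF prob_space_axioms N.prob_space_axioms _ _ J])
    fix t :: "'j \<Rightarrow> real"
    have "(\<Sum>i<n. (\<Sum>j\<in>J. t j * blinfun_apply (\<phi> j) (e i))\<^sup>2) =
      (\<Sum>i<n. \<Sum>k\<in>J. \<Sum>j\<in>J. t k * t j * (blinfun_apply (\<phi> k) (e i) * blinfun_apply (\<phi> j) (e i)))"
      by (simp add: power2_eq_square sum_product mult_ac)
    also have "\<dots> = (\<Sum>k\<in>J. \<Sum>i<n. \<Sum>j\<in>J. t k * t j * (blinfun_apply (\<phi> k) (e i) * blinfun_apply (\<phi> j) (e i)))"
      by (rule sum.swap)
    also have "\<dots> = (\<Sum>k\<in>J. \<Sum>j\<in>J. \<Sum>i<n. t k * t j * (blinfun_apply (\<phi> k) (e i) * blinfun_apply (\<phi> j) (e i)))"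
      by (intro sum.cong refl sum.swap)
    also have "\<dots> = (\<Sum>k\<in>J. \<Sum>j\<in>J. t k * t j * blinfun_apply (\<phi> k) (Q (\<phi> j)))"
      by (intro sum.cong refl)
         (simp add: Q\<phi> blinfun.sum_right blinfun.scaleR_right sum_distrib_left mult_ac)
    finally have *: "(\<Sum>i<n. (\<Sum>j\<in>J. t j * blinfun_apply (\<phi> j) (e i))\<^sup>2) =
      (\<Sum>k\<in>J. \<Sum>j\<in>J. t k * t j * blinfun_apply (\<phi> k) (Q (\<phi> j)))" .
    have "(\<Sum>j\<in>J. t j * Y j z) = (\<Sum>i<n. (\<Sum>j\<in>J. t j * blinfun_apply (\<phi> j) (e i)) * z i)" for z
      unfolding Y_def sum_distrib_left sum_distrib_right by (subst sum.swap) (simp add: mult_ac)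
    then show "distr M borel (\<lambda>\<omega>. \<Sum>j\<in>J. t j * \<xi> (\<phi> j) \<omega>) = distr N borel (\<lambda>z. \<Sum>j\<in>J. t j * Y j z)"
      by (simp only: law_field_sum[OF J] law_linear_combination_PiM_std_normal * N_def)
  qed auto
  have box: "Pi\<^sub>E J B \<in> sets (\<Pi>\<^sub>M j\<in>J. borel)"
    using B J by (intro sets_PiM_I_finite) auto
  let ?S = "(\<lambda>\<omega>. \<lambda>j\<in>J. \<xi> (\<phi> j) \<omega>) -` Pi\<^sub>E J B \<inter> space M"
  have "?S \<in> sets M" by (rule measurable_sets[OF _ box]) measurable
  moreover have "AE \<omega> in M. \<omega> \<notin> ?S" using AE by eventually_elim (auto simp: PiE_def Pi_def)
  ultimately have "emeasure M ?S = 0" by (simp add: AE_iff_measurable[OF _ refl] Collect_conj_eq vimage_def Int_commute)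
  then have "emeasure (distr N (\<Pi>\<^sub>M j\<in>J. borel) (\<lambda>z. \<lambda>j\<in>J. Y j z)) (Pi\<^sub>E J B) = 0"
    unfolding law[symmetric] by (subst emeasure_distr[OF _ box]) auto
  then have N0: "emeasure N ((\<lambda>z. \<lambda>j\<in>J. Y j z) -` Pi\<^sub>E J B \<inter> space N) = 0"
    by (subst (asm) emeasure_distr[OF _ box]) auto
  \<comment> \<open>The point \<open>x\<close> need not lie in the span of the \<open>e i\<close>.
    Its coordinates still reproduce the data, because each \<open>Q (\<phi> j)\<close> lies in that
    span.\<close>
  define z0 where "z0 i = ip x (e i)" for i
  have Yz0: "Y j z0 = blinfun_apply (\<phi> j) x" if "j \<in> J" for j
    unfolding Y_def z0_def by (subst apply_eq_ip[of "\<phi> j" x], subst Q\<phi>[OF that]) (simp add: ip_commute[of x])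
  have contY: "continuous_on UNIV (Y j)" for j
    unfolding Y_def by (intro continuous_intros continuous_on_product_coordinates)
  have "open (\<Inter>j\<in>J. Y j -` B j)"
    using J by (intro open_INT ballI open_vimage B(1) contY)
  moreover have "z0 \<in> (\<Inter>j\<in>J. Y j -` B j)" using Yz0 B by auto
  ultimately obtain X where X: "\<And>i. open (X i)" "\<And>i. z0 i \<in> X i"
      "\<And>w. (\<And>i. w i \<in> X i) \<Longrightarrow> w \<in> (\<Inter>j\<in>J. Y j -` B j)"
    by (rule open_fun_contains_box) blast
  have "\<exists>d>0. {z0 i - d<..<z0 i + d} \<subseteq> X i" for i
  proof -
    obtain d where "0 < d" "ball (z0 i) d \<subseteq> X i"
      using X(1)[of i] X(2)[of i] unfolding open_contains_ball by blast
    then show ?thesis by (auto simp: ball_eq_greaterThanLessThan)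
  qed
  then obtain d where d: "\<And>i. 0 < d i" "\<And>i. {z0 i - d i<..<z0 i + d i} \<subseteq> X i" by metis
  interpret P: product_sigma_finite "\<lambda>_::nat. std_normal_distribution"
    by standard
  let ?I = "\<lambda>i. {z0 i - d i<..<z0 i + d i}"
  have "emeasure N (Pi\<^sub>E {..<n} ?I) = (\<Prod>i<n. emeasure std_normal_distribution (?I i))"
    unfolding N_def by (rule P.emeasure_PiM) auto
  also have "\<dots> \<noteq> 0"
    using d(1) std_normal_interval_pos by (auto simp: prod_zero_iff)
  finally have "emeasure N (Pi\<^sub>E {..<n} ?I) \<noteq> 0" .
  moreover have "emeasure N (Pi\<^sub>E {..<n} ?I) \<le> emeasure N ((\<lambda>z. \<lambda>j\<in>J. Y j z) -` Pi\<^sub>E J B \<inter> space N)"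
  proof (rule emeasure_mono)
    show "(\<lambda>z. \<lambda>j\<in>J. Y j z) -` Pi\<^sub>E J B \<inter> space N \<in> sets N"
      by (rule measurable_sets[OF _ box]) measurable
    show "Pi\<^sub>E {..<n} ?I \<subseteq> (\<lambda>z. \<lambda>j\<in>J. Y j z) -` Pi\<^sub>E J B \<inter> space N"
    proof
      fix z assume z: "z \<in> Pi\<^sub>E {..<n} ?I"
      \<comment> \<open>The open box restricts every index, while \<open>z\<close> carries
        information only below \<open>n\<close>; padding with \<open>z0\<close> leaves each
        \<open>Y j\<close> unchanged.\<close>
      define w where "w i = (if i < n then z i else z0 i)" for i
      have "w i \<in> X i" for i
        using PiE_mem[OF z, of i] d(2)[of i] X(2)[of i] by (auto simp: w_def)
      then have "\<forall>j\<in>J. Y j w \<in> B j" using X(3)[of w] by blast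
      moreover have "Y j w = Y j z" for j unfolding Y_def w_def by (intro sum.cong) auto
      moreover have "z \<in> space N" using z by (auto simp: N_def space_PiM PiE_def)
      ultimately show "z \<in> (\<lambda>z. \<lambda>j\<in>J. Y j z) -` Pi\<^sub>E J B \<inter> space N" by auto
    qed
  qed
  ultimately show False using N0 by simp
qed

text \<open>If two continuous versions differ at \<open>y\<close>, they differ on a neighbourhood of
  \<open>y\<close>. By \<open>surj\<close> the point \<open>y\<close> is a vector of attainable
  values, so the neighbourhood has positive probability, against almost sure equality.\<close>

lemma regression_function_unique:
  fixes \<phi> :: "'j \<Rightarrow> 'b \<Rightarrow>\<^sub>L real"
  assumes J: "finite J"
    and surj: "\<And>c. \<exists>x. \<forall>j\<in>J. blinfun_apply (\<phi> j) x = c j"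
    and g: "regression_function M X J (\<lambda>j. \<xi> (\<phi> j)) g" and h: "regression_function M X J (\<lambda>j. \<xi> (\<phi> j)) h"
    and y: "y \<in> J \<rightarrow>\<^sub>E UNIV"
  shows "g y = h y"
proof (rule ccontr)
  assume neq: "g y \<noteq> h y"
  let ?Y = "\<lambda>\<omega>. \<lambda>j\<in>J. \<xi> (\<phi> j) \<omega>"
  have "continuous_on (J \<rightarrow>\<^sub>E UNIV) (\<lambda>y. g y - h y)"
    using g h by (intro continuous_intros) (auto simp: regression_function_def)
  then obtain U where U: "open U" "U \<inter> (J \<rightarrow>\<^sub>E UNIV) = (\<lambda>y. g y - h y) -` (- {0}) \<inter> (J \<rightarrow>\<^sub>E UNIV)"
    unfolding continuous_on_open_invariant by (metis open_Compl closed_singleton)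
  have "y \<in> U" using U y neq by auto
  with \<open>open U\<close> obtain B where B: "\<And>i. open (B i)" "\<And>i. y i \<in> B i" "\<And>w. (\<And>i. w i \<in> B i) \<Longrightarrow> w \<in> U"
    by (rule open_fun_contains_box) blast
  obtain x where x: "\<And>j. j \<in> J \<Longrightarrow> blinfun_apply (\<phi> j) x = y j" using surj by metis
  have "AE \<omega> in M. g (?Y \<omega>) = h (?Y \<omega>)"
    using g h unfolding regression_function_def by (auto elim: AE_mp)
  then have "AE \<omega> in M. \<exists>j\<in>J. \<xi> (\<phi> j) \<omega> \<notin> B j"
  proof eventually_elim
    case (elim \<omega>)
    show ?case
    proof (rule ccontr)
      assume *: "\<not> (\<exists>j\<in>J. \<xi> (\<phi> j) \<omega> \<notin> B j)"
      have "?Y \<omega> i \<in> B i" for i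
      proof (cases "i \<in> J")
        case False
        \<comment> \<open>The box also restricts indices outside \<open>J\<close>, where both tuples
          are \<open>undefined\<close>.\<close>
        then have "y i = undefined" using y by (auto simp: PiE_def extensional_def)
        then show ?thesis using False B(2)[of i] by simp
      qed (use * in auto)
      then have "?Y \<omega> \<in> U" by (rule B(3))
      then have "?Y \<omega> \<in> U \<inter> (J \<rightarrow>\<^sub>E UNIV)" by auto
      then show False unfolding U(2) using elim by auto
    qed
  qed
  then show False
    using field_full_support[OF J, of B \<phi> x] B x by auto
qed

end

section \<open>Gamblets, strategies and the short\<close>

lemma sets_sigma_functionals:
  "sets (sigma_functionals \<Phi>) = sigma_sets UNIV (\<Union>f\<in>\<Phi>. {blinfun_apply f -` A | A. A \<in> sets borel})"
  unfolding sigma_functionals_def by (rule sets_measure_of) auto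

lemma space_sigma_functionals [simp]: "space (sigma_functionals \<Phi>) = UNIV"
  unfolding sigma_functionals_def by (rule space_measure_of) auto

lemma measurable_sigma_functionals:
  assumes "f \<in> \<Phi>"
  shows "blinfun_apply f \<in> borel_measurable (sigma_functionals \<Phi>)"
proof (rule measurableI)
  fix A :: "real set" assume "A \<in> sets borel"
  then show "blinfun_apply f -` A \<inter> space (sigma_functionals \<Phi>) \<in> sets (sigma_functionals \<Phi>)"
    unfolding sets_sigma_functionals using assms by (auto intro!: sigma_sets.Basic)
qed auto

lemma sigma_functionals_mono:
  assumes "\<Phi> \<subseteq> \<Psi>"
  shows "sets (sigma_functionals \<Phi>) \<subseteq> sets (sigma_functionals \<Psi>)"
  unfolding sets_sigma_functionals by (rule sigma_sets_mono') (use assms in blast)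

lemma sets_sigma_functionals_borel:
  fixes \<Phi> :: "('b::real_normed_vector \<Rightarrow>\<^sub>L real) set"
  shows "sets (sigma_functionals \<Phi>) \<subseteq> sets (borel :: 'b measure)"
proof -
  have "blinfun_apply f -` A \<in> sets borel" if "A \<in> sets borel" for f :: "'b \<Rightarrow>\<^sub>L real" and A
  proof -
    have "blinfun_apply f \<in> borel_measurable borel"
      by (intro borel_measurable_continuous_onI continuous_intros)
    from measurable_sets[OF this that] show ?thesis by simp
  qed
  then have "sigma_sets (space (borel :: 'b measure)) (\<Union>f\<in>\<Phi>. {blinfun_apply f -` A | A. A \<in> sets borel})
      \<subseteq> sets (borel :: 'b measure)"
    by (intro sets.sigma_sets_subset) blast
  then show ?thesis unfolding sets_sigma_functionals by simp
qed

text \<open>The sets that do not separate \<open>x\<close> from \<open>y\<close> are closed under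
  complements and countable unions, and they include the generators.\<close>

lemma sigma_functionals_indiscernible:
  assumes "C \<in> sets (sigma_functionals \<Phi>)" "\<And>f. f \<in> \<Phi> \<Longrightarrow> blinfun_apply f x = blinfun_apply f y"
  shows "x \<in> C \<longleftrightarrow> y \<in> C"
  using assms(1) unfolding sets_sigma_functionals
  by (induction rule: sigma_sets.induct) (use assms(2) in auto)

text \<open>Singletons are Borel, so the level set of \<open>v\<close> through \<open>x\<close>
  belongs to the generated sigma-algebra. Thus a strategy factors through the data, which is the
  restriction on Player II behind both lower bounds.\<close>

lemma strategies_cong:
  assumes v: "v \<in> strategies \<Phi>" and eq: "\<And>f. f \<in> \<Phi> \<Longrightarrow> blinfun_apply f x = blinfun_apply f y"
  shows "v x = v y"
proof -
  have "v -` {v x} \<inter> space (sigma_functionals \<Phi>) \<in> sets (sigma_functionals \<Phi>)"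
    using v unfolding strategies_def by (rule measurable_sets) simp
  then have "x \<in> v -` {v x} \<longleftrightarrow> y \<in> v -` {v x}"
    by (intro sigma_functionals_indiscernible[where \<Phi>=\<Phi>]) (simp_all add: eq)
  then show ?thesis by simp
qed

lemma apply_span_eq:
  assumes "f \<in> span S" "\<And>g. g \<in> S \<Longrightarrow> blinfun_apply g x = blinfun_apply g y"
  shows "blinfun_apply f x = blinfun_apply f y"
  using assms(1)
  by (induction rule: span_induct_alt) (auto simp: assms(2) blinfun.add_left blinfun.scaleR_left)

text \<open>Minimality of the gamblets enters in variational form as
  \<open>gamblet_orthogonal\<close>; the passage from minimizers to this form is
  \<open>minimizer_orthogonal\<close>.\<close>

locale gamblet_space = norm_operator_space Q
  for Q :: "('b::{real_normed_vector, second_countable_topology} \<Rightarrow>\<^sub>L real) \<Rightarrow> 'b" +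
  fixes J :: "'j set" and \<phi> :: "'j \<Rightarrow> 'b \<Rightarrow>\<^sub>L real" and \<psi> :: "'j \<Rightarrow> 'b"
  assumes finite_J: "finite J"
    and dual: "i \<in> J \<Longrightarrow> j \<in> J \<Longrightarrow> blinfun_apply (\<phi> j) (\<psi> i) = (if i = j then 1 else 0)"
    and gamblet_orthogonal: "i \<in> J \<Longrightarrow> (\<And>j. j \<in> J \<Longrightarrow> blinfun_apply (\<phi> j) w = 0) \<Longrightarrow> ip (\<psi> i) w = 0"
begin

definition proj :: "'b \<Rightarrow> 'b" where
  "proj x = (\<Sum>j\<in>J. blinfun_apply (\<phi> j) x *\<^sub>R \<psi> j)"

text \<open>The transpose of \<open>proj\<close>. For the field, \<open>adj f\<close> is the part of
  \<open>f\<close> predicted by the data and \<open>f - adj f\<close> is uncorrelated with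
  them.\<close>

definition adj :: "('b \<Rightarrow>\<^sub>L real) \<Rightarrow> ('b \<Rightarrow>\<^sub>L real)" where
  "adj f = (\<Sum>j\<in>J. blinfun_apply f (\<psi> j) *\<^sub>R \<phi> j)"

abbreviation data_kernel :: "'b set" where
  "data_kernel \<equiv> {w. \<forall>j\<in>J. blinfun_apply (\<phi> j) w = 0}"

lemma linear_proj: "linear proj"
  by (rule linearI)
     (simp_all add: proj_def blinfun.add_right blinfun.scaleR_right scaleR_add_left sum.distrib scaleR_sum_right)

lemma linear_adj: "linear adj"
  by (rule linearI)
     (simp_all add: adj_def blinfun.add_left blinfun.scaleR_left scaleR_add_left sum.distrib scaleR_sum_right)

lemma apply_gamblet_sum:
  assumes "l \<in> J"
  shows "blinfun_apply (\<phi> l) (\<Sum>j\<in>J. c j *\<^sub>R \<psi> j) = c l"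
proof -
  have "blinfun_apply (\<phi> l) (\<Sum>j\<in>J. c j *\<^sub>R \<psi> j) = (\<Sum>j\<in>J. if j = l then c j else 0)"
    unfolding blinfun.sum_right blinfun.scaleR_right
    by (intro sum.cong refl) (use assms in \<open>simp add: dual\<close>)
  then show ?thesis using assms finite_J by simp
qed

lemma apply_proj: "l \<in> J \<Longrightarrow> blinfun_apply (\<phi> l) (proj x) = blinfun_apply (\<phi> l) x"
  unfolding proj_def by (rule apply_gamblet_sum)

lemma diff_proj_in_kernel: "x - proj x \<in> data_kernel"
  by (simp add: blinfun.diff_right apply_proj)

lemma ip_proj_kernel: "w \<in> data_kernel \<Longrightarrow> ip (proj x) w = 0"
  unfolding proj_def ip_left_simps by (intro sum.neutral ballI) (simp add: gamblet_orthogonal)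

lemma proj_kernel: "w \<in> data_kernel \<Longrightarrow> proj w = 0"
  by (simp add: proj_def)

lemma norm_proj_decomposition: "(norm x)\<^sup>2 = (norm (proj x))\<^sup>2 + (norm (x - proj x))\<^sup>2"
  using norm_add_sq[of "proj x" "x - proj x"] ip_proj_kernel[OF diff_proj_in_kernel, of x x]
  by (simp only: add_diff_eq add_diff_cancel_left' mult_zero_right add_0_right)

lemma norm_diff_proj_le: "norm (x - proj x) \<le> norm x"
  by (rule power2_le_imp_le) (use norm_proj_decomposition[of x] zero_le_power2[of "norm (proj x)"] in linarith, simp)

text \<open>\<open>Q (\<phi> l)\<close> represents \<open>\<phi> l\<close> in the inner product and
  is therefore orthogonal to the kernel. Its difference from its projection lies in the kernel and
  is orthogonal to itself.\<close>

lemma proj_Q_data: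
  assumes "l \<in> J"
  shows "proj (Q (\<phi> l)) = Q (\<phi> l)"
proof -
  define w where "w = Q (\<phi> l) - proj (Q (\<phi> l))"
  have w: "w \<in> data_kernel" unfolding w_def by (rule diff_proj_in_kernel)
  have "ip (Q (\<phi> l)) w = 0" using w assms by (simp add: apply_eq_ip[symmetric])
  with ip_proj_kernel[OF w, of "Q (\<phi> l)"] have "ip (Q (\<phi> l) - proj (Q (\<phi> l))) w = 0" by simp
  then have "ip w w = 0" by (simp only: w_def)
  then show ?thesis by (simp add: ip_self w_def)
qed

lemma apply_adj: "blinfun_apply (adj f) x = blinfun_apply f (proj x)"
  by (simp add: adj_def proj_def blinfun.sum_left blinfun.sum_right blinfun.scaleR_left blinfun.scaleR_right mult.commute)

text \<open>This expresses self-adjointness of \<open>proj\<close>. Both sides are fixed by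
  \<open>proj\<close> and have the same data, and \<open>proj\<close> depends on the data
  only.\<close>

lemma Q_adj: "Q (adj f) = proj (Q f)"
proof -
  have "proj (Q (adj f)) = Q (adj f)"
    by (simp add: adj_def linear_sum[OF linear_Q] linear_scale[OF linear_Q]
        linear_sum[OF linear_proj] linear_scale[OF linear_proj] proj_Q_data)
  moreover have "blinfun_apply (\<phi> l) (Q (adj f)) = blinfun_apply (\<phi> l) (Q f)" if "l \<in> J" for l
    unfolding Q_sym[of "\<phi> l"] apply_adj proj_Q_data[OF that] ..
  then have "proj (Q (adj f)) = proj (Q f)" unfolding proj_def by (intro sum.cong) auto
  ultimately show ?thesis by simp
qed

lemma strategies_eq_on_data:
  assumes "v \<in> strategies (span (\<phi> ` J))" "\<And>j. j \<in> J \<Longrightarrow> blinfun_apply (\<phi> j) x = blinfun_apply (\<phi> j) y"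
  shows "v x = v y"
proof (rule strategies_cong[OF assms(1)])
  show "blinfun_apply f x = blinfun_apply f y" if "f \<in> span (\<phi> ` J)" for f
    by (rule apply_span_eq[OF that]) (use assms(2) in auto)
qed

lemma proj_strategy: "proj \<in> strategies (span (\<phi> ` J))"
  unfolding strategies_def proj_def
  by (intro borel_measurable_sum borel_measurable_scaleR measurable_sigma_functionals borel_measurable_const)
     (auto intro: span_base)

text \<open>The game has value 0 if the data determine the point and 1 otherwise. In the second case
  a nonzero \<open>w\<close> in the kernel and \<open>- w\<close> both receive the answer
  \<open>v 0\<close>, and by the triangle inequality one of them is missed by at least
  \<open>norm w\<close>.\<close>

lemma worst_loss_proj_le:
  assumes v: "v \<in> strategies (span (\<phi> ` J))"
  shows "worst_loss proj \<le> worst_loss v"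
proof (cases "data_kernel = {0}")
  case True
  with diff_proj_in_kernel have "x - proj x = 0" for x by blast
  then have "worst_loss proj = 0" by (simp add: worst_loss_def)
  then show ?thesis by simp
next
  case False
  then obtain w where w: "w \<in> data_kernel" "w \<noteq> 0"
    using blinfun.zero_right by blast
  have "ennreal (norm (x - proj x)) / ennreal (norm x) \<le> 1" for x
  proof (cases "x = 0")
    case False
    then have "ennreal (norm (x - proj x)) / ennreal (norm x) = ennreal (norm (x - proj x) / norm x)"
      by (intro divide_ennreal) auto
    also have "\<dots> \<le> 1" using False norm_diff_proj_le[of x] by (simp add: ennreal_le_1 divide_le_eq_1)
    finally show ?thesis .
  qed (simp add: linear_0[OF linear_proj])
  then have "worst_loss proj \<le> 1" unfolding worst_loss_def by (rule SUP_least)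
  also have "1 \<le> worst_loss v"
  proof -
    have eq: "v w = v 0" "v (- w) = v 0"
      using w(1) by (auto intro!: strategies_eq_on_data[OF v] simp: blinfun.minus_right)
    have "2 * norm w = norm ((w - v 0) - (- w - v 0))" by (simp add: scaleR_2[symmetric])
    also have "\<dots> \<le> norm (w - v 0) + norm (- w - v 0)" by (rule norm_triangle_ineq4)
    finally have "norm w \<le> norm (w - v w) \<or> norm w \<le> norm (- w - v (- w))"
      unfolding eq by linarith
    then obtain x where x: "norm x = norm w" "norm w \<le> norm (x - v x)" by (metis norm_minus_cancel)
    have "1 \<le> norm (x - v x) / norm x" using x w(2) by (simp add: le_divide_eq_1)
    then have "1 \<le> ennreal (norm (x - v x) / norm x)" using ennreal_leI[of 1] by simp
    also have "\<dots> = ennreal (norm (x - v x)) / ennreal (norm x)"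
      using x w(2) by (intro divide_ennreal[symmetric]) auto
    also have "\<dots> \<le> worst_loss v" unfolding worst_loss_def by (rule SUP_upper) simp
    finally show ?thesis .
  qed
  finally show ?thesis .
qed

text \<open>Closed form of the shorted operator: the infimum that defines it is a least squares
  problem with minimizer \<open>t = - adj f\<close>.\<close>

definition short :: "('b \<Rightarrow>\<^sub>L real) \<Rightarrow> 'b" where
  "short f = Q (f - adj f)"

lemma short_eq: "short f = Q f - proj (Q f)"
  by (simp add: short_def linear_diff[OF linear_Q] Q_adj)

lemma apply_short: "blinfun_apply f (short g) = blinfun_apply (f - adj f) (Q (g - adj g))"
proof -
  have "blinfun_apply (adj f) (short g) = 0"
    unfolding apply_adj short_eq
    by (simp add: proj_kernel[OF diff_proj_in_kernel])
  then show ?thesis by (simp add: short_def blinfun.diff_left)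
qed

text \<open>Adding \<open>t\<close> from the span does not change the kernel component of
  \<open>Q (s + t)\<close>, which is \<open>short s\<close>. Hence the quadratic form is at least
  the squared norm of \<open>short s\<close>, with equality at \<open>- adj s\<close>.\<close>

lemma is_short_short: "is_short Q (span (\<phi> ` J)) short"
  unfolding is_short_def symmetric_operator_def
proof (intro conjI allI)
  show "linear short"
    unfolding short_def
    by (rule linearI)
       (simp_all add: linear_add[OF linear_adj] linear_scale[OF linear_adj] linear_add[OF linear_Q]
          linear_diff[OF linear_Q] linear_scale[OF linear_Q] scaleR_diff_right)
  show "blinfun_apply f (short g) = blinfun_apply g (short f)" for f g
    unfolding apply_short by (rule Q_sym)
  fix s
  have "blinfun_apply s (short s) \<le> blinfun_apply (s + t) (Q (s + t))" if t: "t \<in> span (\<phi> ` J)" for t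
  proof -
    have "proj (Q t) = Q t"
    proof -
      have "proj (Q t) - Q t = 0" using t
      proof (induction rule: span_induct_alt)
        case (step c x y)
        then show ?case
          by (auto simp: linear_add[OF linear_Q] linear_scale[OF linear_Q] linear_add[OF linear_proj]
              linear_scale[OF linear_proj] proj_Q_data)
      qed (simp add: linear_0[OF linear_Q] linear_0[OF linear_proj])
      then show ?thesis by simp
    qed
    then have *: "Q (s + t) - proj (Q (s + t)) = short s"
      by (simp add: short_eq linear_add[OF linear_Q] linear_add[OF linear_proj])
    have "blinfun_apply s (short s) = (norm (short s))\<^sup>2"
      unfolding apply_short unfolding apply_eq_ip ip_self short_def ..
    also have "\<dots> \<le> (norm (Q (s + t)))\<^sup>2"
      using norm_diff_proj_le[of "Q (s + t)"] unfolding * by (intro power_mono) auto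
    also have "\<dots> = blinfun_apply (s + t) (Q (s + t))"
      unfolding apply_eq_ip ip_self ..
    finally show ?thesis .
  qed
  moreover have "- adj s \<in> span (\<phi> ` J)"
    unfolding adj_def by (intro span_neg span_sum span_scale span_base) auto
  moreover have "blinfun_apply s (short s) = blinfun_apply (s + - adj s) (Q (s + - adj s))"
    unfolding apply_short by simp
  ultimately show "blinfun_apply s (short s) = (INF t\<in>span (\<phi> ` J). blinfun_apply (s + t) (Q (s + t)))"
    by (intro cInf_eq_minimum[symmetric]) (auto intro: image_eqI[where x="- adj s"])
qed

text \<open>The infimum prescribes only the quadratic form; polarization recovers the symmetric
  bilinear form, and the pairing separates points.\<close>

lemma is_short_unique:
  assumes "is_short Q \<Phi> S" "is_short Q \<Phi> T"
  shows "S = T"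
proof
  fix g
  have quad: "blinfun_apply s (S s) = blinfun_apply s (T s)" for s
    using assms by (simp add: is_short_def)
  have polar: "4 * blinfun_apply f (U g) = blinfun_apply (f + g) (U (f + g)) - blinfun_apply (f - g) (U (f - g))"
    if "symmetric_operator U" for U :: "('b \<Rightarrow>\<^sub>L real) \<Rightarrow> 'b" and f :: "'b \<Rightarrow>\<^sub>L real"
  proof -
    have "linear U" "blinfun_apply g (U f) = blinfun_apply f (U g)"
      using that by (auto simp: symmetric_operator_def)
    then show ?thesis
      by (simp add: linear_add linear_diff blinfun.add_left blinfun.add_right blinfun.diff_left blinfun.diff_right)
  qed
  have "blinfun_apply f (S g) = blinfun_apply f (T g)" for f :: "'b \<Rightarrow>\<^sub>L real"
    using polar[of S f] polar[of T f] assms unfolding is_short_def quad by simp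
  then have "ip (S g - T g) (S g - T g) = 0"
    unfolding ip_def by (simp add: blinfun.diff_right)
  then show "S g = T g" by (simp add: ip_self)
qed

end

section \<open>Gaussian cylinder measures\<close>

lemma coord_map_measurable:
  fixes f :: "nat \<Rightarrow> 'b::real_normed_vector \<Rightarrow>\<^sub>L real"
  shows "coord_map n f \<in> measurable (sigma_functionals (f ` {..<n})) (\<Pi>\<^sub>M i\<in>{..<n}. borel)"
  unfolding coord_map_def by (intro measurable_restrict measurable_sigma_functionals) auto

lemma coord_map_vimage_sets:
  assumes "A \<in> sets (\<Pi>\<^sub>M i\<in>{..<n}. borel)"
  shows "coord_map n f -` A \<in> sets (sigma_functionals (f ` {..<n}))"
  using measurable_sets[OF coord_map_measurable assms] by simp

lemma cylinder_set_finite_functionals: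
  assumes "C \<in> cylinder_sets"
  obtains V where "finite V" "C \<in> sets (sigma_functionals V)"
  using assms coord_map_vimage_sets unfolding cylinder_sets_def by blast

text \<open>Treats all Gaussian cylinder limits at once: \<open>f\<close> is to have the law of
  \<open>\<xi> (L f)\<close>, where \<open>L\<close> will be \<open>limit_functional\<close>. Only
  the quadratic form of \<open>T\<close> is related to \<open>Q\<close>, as
  \<open>gaussian_cylinder_measure\<close> refers to nothing else.\<close>

locale transformed_gaussian_field = gaussian_field_space Q M \<xi>
  for Q :: "('b::{real_normed_vector, second_countable_topology} \<Rightarrow>\<^sub>L real) \<Rightarrow> 'b"
    and M :: "'w measure" and \<xi> +
  fixes L :: "('b \<Rightarrow>\<^sub>L real) \<Rightarrow> ('b \<Rightarrow>\<^sub>L real)" and T :: "('b \<Rightarrow>\<^sub>L real) \<Rightarrow> 'b"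
  assumes linear_L: "linear L"
    and covariance: "blinfun_apply f (T f) = blinfun_apply (L f) (Q (L f))"
begin

text \<open>A random vector of the space that realizes the transformed field on the functionals in
  \<open>V\<close> only. For finite \<open>V\<close> a finite-rank vector does so, even where no
  vector realizes the whole field.\<close>

definition represents :: "('b \<Rightarrow>\<^sub>L real) set \<Rightarrow> ('w \<Rightarrow> 'b) \<Rightarrow> bool" where
  "represents V X \<longleftrightarrow>
     X \<in> borel_measurable M \<and> (\<forall>f\<in>V. AE \<omega> in M. blinfun_apply f (X \<omega>) = \<xi> (L f) \<omega>)"

lemma represents_subset: "represents V X \<Longrightarrow> W \<subseteq> V \<Longrightarrow> represents W X"
  by (auto simp: represents_def)

lemma represents_exists:
  assumes "finite V"
  obtains X where "represents V X"
proof -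
  obtain e n where "orthonormal_or_zero e"
    and e: "\<And>x. x \<in> span (Q ` V) \<Longrightarrow> partial_expansion e n x = x"
    using finite_expansion[of "Q ` V"] assms by auto
  define X where "X \<omega> = (\<Sum>i<n. \<xi> (L (inv Q (e i))) \<omega> *\<^sub>R e i)" for \<omega>
  have "represents V X"
    unfolding represents_def
  proof (intro conjI ballI)
    show "X \<in> borel_measurable M" unfolding X_def
      by (intro borel_measurable_sum borel_measurable_scaleR) auto
    fix f assume f: "f \<in> V"
    have "Q f = (\<Sum>i<n. blinfun_apply f (e i) *\<^sub>R e i)"
      using e[of "Q f"] f by (simp only: apply_eq_ip span_base image_eqI)
    then have "inv Q (Q f) = inv Q (\<Sum>i<n. blinfun_apply f (e i) *\<^sub>R e i)" by (rule arg_cong)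
    then have "f = (\<Sum>i<n. blinfun_apply f (e i) *\<^sub>R inv Q (e i))"
      unfolding inv_Q linear_sum[OF linear_inv_Q] linear_scale[OF linear_inv_Q] .
    then have "L f = L (\<Sum>i<n. blinfun_apply f (e i) *\<^sub>R inv Q (e i))" by (rule arg_cong)
    then have Lf: "L f = (\<Sum>i<n. blinfun_apply f (e i) *\<^sub>R L (inv Q (e i)))"
      unfolding linear_sum[OF linear_L] linear_scale[OF linear_L] .
    have "AE \<omega> in M. \<xi> (L f) \<omega> = (\<Sum>i<n. blinfun_apply f (e i) * \<xi> (L (inv Q (e i))) \<omega>)"
      by (subst Lf) (rule AE_field_sum, simp)
    then show "AE \<omega> in M. blinfun_apply f (X \<omega>) = \<xi> (L f) \<omega>"
      by eventually_elim (simp add: X_def blinfun.sum_right blinfun.scaleR_right mult.commute)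
  qed
  then show ?thesis by (rule that)
qed

lemma represents_AE_iff:
  assumes X: "represents V X" and Y: "represents V Y" and C: "C \<in> sets (sigma_functionals V)"
  shows "AE \<omega> in M. X \<omega> \<in> C \<longleftrightarrow> Y \<omega> \<in> C"
  using C unfolding sets_sigma_functionals
proof (induction rule: sigma_sets.induct)
  case (Basic C)
  then obtain f A where f: "f \<in> V" and C: "C = blinfun_apply f -` A" by auto
  have "AE \<omega> in M. blinfun_apply f (X \<omega>) = \<xi> (L f) \<omega>" "AE \<omega> in M. blinfun_apply f (Y \<omega>) = \<xi> (L f) \<omega>"
    using X Y f by (auto simp: represents_def)
  then show ?case by eventually_elim (simp add: C)
next
  case (Union C)
  have "AE \<omega> in M. \<forall>i. X \<omega> \<in> C i \<longleftrightarrow> Y \<omega> \<in> C i"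
    using Union.IH by (simp add: AE_all_countable)
  then show ?case by eventually_elim simp
qed auto

lemma represents_event:
  assumes "represents V X" "C \<in> sets (sigma_functionals W)"
  shows "{\<omega> \<in> space M. X \<omega> \<in> C} \<in> events"
proof -
  have "C \<in> sets borel" using assms(2) sets_sigma_functionals_borel by blast
  moreover have "X \<in> borel_measurable M" using assms(1) by (simp add: represents_def)
  ultimately show ?thesis by measurable
qed

text \<open>Well-definedness of cylinder probabilities: a vector representing
  \<open>V \<union> W\<close> is compared with both \<open>X\<close> and \<open>Y\<close>.\<close>

lemma represents_prob_eq:
  assumes fin: "finite V" "finite W" and X: "represents V X" and Y: "represents W Y"
    and C: "C \<in> sets (sigma_functionals V)" "C \<in> sets (sigma_functionals W)"
  shows "prob {\<omega> \<in> space M. X \<omega> \<in> C} = prob {\<omega> \<in> space M. Y \<omega> \<in> C}"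
proof -
  obtain Z where Z: "represents (V \<union> W) Z" using represents_exists[of "V \<union> W"] fin by auto
  have "AE \<omega> in M. X \<omega> \<in> C \<longleftrightarrow> Z \<omega> \<in> C" "AE \<omega> in M. Y \<omega> \<in> C \<longleftrightarrow> Z \<omega> \<in> C"
    using represents_AE_iff[OF X represents_subset[OF Z] C(1)]
      represents_AE_iff[OF Y represents_subset[OF Z] C(2)] by auto
  then have "AE \<omega> in M. \<omega> \<in> {\<omega> \<in> space M. X \<omega> \<in> C} \<longleftrightarrow> \<omega> \<in> {\<omega> \<in> space M. Y \<omega> \<in> C}"
    by eventually_elim simp
  then show ?thesis
    by (intro finite_measure_eq_AE represents_event[OF X C(1)] represents_event[OF Y C(1)])
qed

text \<open>The choice is harmless: by \<open>represents_prob_eq\<close> all admissible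
  \<open>p\<close> coincide. Sets that depend on no finite family get an arbitrary value.\<close>

definition cylinder_prob :: "'b set \<Rightarrow> real" where
  "cylinder_prob C = (SOME p. \<exists>V X. finite V \<and> represents V X \<and> C \<in> sets (sigma_functionals V) \<and>
     p = prob {\<omega> \<in> space M. X \<omega> \<in> C})"

lemma cylinder_prob_eq:
  assumes "finite V" "represents V X" "C \<in> sets (sigma_functionals V)"
  shows "cylinder_prob C = prob {\<omega> \<in> space M. X \<omega> \<in> C}"
  unfolding cylinder_prob_def
proof (rule someI2)
  show "\<exists>V' X'. finite V' \<and> represents V' X' \<and> C \<in> sets (sigma_functionals V') \<and>
      prob {\<omega> \<in> space M. X \<omega> \<in> C} = prob {\<omega> \<in> space M. X' \<omega> \<in> C}"
    using assms by blast
  show "p = prob {\<omega> \<in> space M. X \<omega> \<in> C}"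
    if "\<exists>V X. finite V \<and> represents V X \<and> C \<in> sets (sigma_functionals V) \<and> p = prob {\<omega> \<in> space M. X \<omega> \<in> C}" for p
    using that represents_prob_eq[OF _ assms(1) _ assms(2) _ assms(3)] by auto
qed

lemma cylinder_prob_coord_map:
  assumes A: "A \<in> sets (\<Pi>\<^sub>M i\<in>{..<n}. borel)"
  shows "cylinder_prob (coord_map n f -` A) = prob {\<omega> \<in> space M. (\<lambda>i\<in>{..<n}. \<xi> (L (f i)) \<omega>) \<in> A}"
proof -
  obtain X where X: "represents (f ` {..<n}) X" using represents_exists[of "f ` {..<n}"] by auto
  have "AE \<omega> in M. \<forall>i\<in>{..<n}. blinfun_apply (f i) (X \<omega>) = \<xi> (L (f i)) \<omega>"
    using X by (intro AE_finite_allI) (auto simp: represents_def)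
  then have "AE \<omega> in M. \<omega> \<in> {\<omega> \<in> space M. X \<omega> \<in> coord_map n f -` A} \<longleftrightarrow>
      \<omega> \<in> {\<omega> \<in> space M. (\<lambda>i\<in>{..<n}. \<xi> (L (f i)) \<omega>) \<in> A}"
  proof eventually_elim
    case (elim \<omega>)
    then have "coord_map n f (X \<omega>) = (\<lambda>i\<in>{..<n}. \<xi> (L (f i)) \<omega>)"
      unfolding coord_map_def by (intro restrict_ext) simp
    then show ?case by simp
  qed
  moreover have "{\<omega> \<in> space M. (\<lambda>i\<in>{..<n}. \<xi> (L (f i)) \<omega>) \<in> A} \<in> events" using A by measurable
  ultimately show ?thesis
    unfolding cylinder_prob_eq[OF finite_imageI[OF finite_lessThan] X coord_map_vimage_sets[OF A]]
    by (intro finite_measure_eq_AE represents_event[OF X coord_map_vimage_sets[OF A]]) auto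
qed

lemma measure_law_L:
  assumes "A \<in> sets borel"
  shows "measure (centered_gaussian (blinfun_apply f (T f))) A = prob {\<omega> \<in> space M. \<xi> (L f) \<omega> \<in> A}"
  unfolding covariance law_field[symmetric]
  by (subst measure_distr) (use assms in \<open>auto simp: vimage_def Int_def conj_commute\<close>)

lemma gaussian_cylinder_measure_cylinder_prob: "gaussian_cylinder_measure T cylinder_prob"
  unfolding gaussian_cylinder_measure_def cylinder_measure_def
proof (intro conjI ballI allI impI)
  fix C D :: "'b set" assume "C \<in> cylinder_sets" "D \<in> cylinder_sets" and disj: "C \<inter> D = {}"
  then obtain V W where VW: "finite V" "C \<in> sets (sigma_functionals V)" "finite W" "D \<in> sets (sigma_functionals W)"
    by (metis cylinder_set_finite_functionals)
  then have CD: "C \<in> sets (sigma_functionals (V \<union> W))" "D \<in> sets (sigma_functionals (V \<union> W))" "finite (V \<union> W)"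
    using sigma_functionals_mono[of V "V \<union> W"] sigma_functionals_mono[of W "V \<union> W"] by auto
  obtain X where X: "represents (V \<union> W) X" using represents_exists[OF CD(3)] by auto
  have "{\<omega> \<in> space M. X \<omega> \<in> C \<union> D} = {\<omega> \<in> space M. X \<omega> \<in> C} \<union> {\<omega> \<in> space M. X \<omega> \<in> D}" by auto
  moreover have "prob \<dots> = prob {\<omega> \<in> space M. X \<omega> \<in> C} + prob {\<omega> \<in> space M. X \<omega> \<in> D}"
    by (intro finite_measure_Union represents_event[OF X CD(1)] represents_event[OF X CD(2)]) (use disj in auto)
  ultimately show "cylinder_prob (C \<union> D) = cylinder_prob C + cylinder_prob D"
    using cylinder_prob_eq[OF CD(3) X, of "C \<union> D"] cylinder_prob_eq[OF CD(3) X CD(1)]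
      cylinder_prob_eq[OF CD(3) X CD(2)] sets.Un[OF CD(1,2)] by simp
next
  fix n and f :: "nat \<Rightarrow> 'b \<Rightarrow>\<^sub>L real"
  let ?Y = "\<lambda>\<omega>. \<lambda>i\<in>{..<n}. \<xi> (L (f i)) \<omega>"
  let ?P = "distr M (\<Pi>\<^sub>M i\<in>{..<n}. borel) ?Y"
  have "prob_space ?P" by (rule prob_space_distr) measurable
  moreover have "measure ?P A = cylinder_prob (coord_map n f -` A)" if "A \<in> sets ?P" for A
  proof -
    have A: "A \<in> sets (\<Pi>\<^sub>M i\<in>{..<n}. borel)" using that by simp
    show ?thesis unfolding cylinder_prob_coord_map[OF A]
      by (subst measure_distr[OF _ A]) (auto simp: vimage_def Int_def conj_commute)
  qed
  ultimately show "\<exists>P. prob_space P \<and> sets P = sets (\<Pi>\<^sub>M i\<in>{..<n}. (borel :: real measure)) \<and>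
        (\<forall>A\<in>sets P. measure P A = cylinder_prob (coord_map n f -` A))"
    by (intro exI[of _ ?P]) simp
next
  fix f :: "'b \<Rightarrow>\<^sub>L real" and A :: "real set" assume A: "A \<in> sets borel"
  let ?A = "{y \<in> space (\<Pi>\<^sub>M i\<in>{..<1::nat}. (borel :: real measure)). y 0 \<in> A}"
  have "?A \<in> sets (\<Pi>\<^sub>M i\<in>{..<1::nat}. borel)" using A by measurable
  from cylinder_prob_coord_map[OF this, of "\<lambda>_. f"]
  have "cylinder_prob (coord_map 1 (\<lambda>_. f) -` ?A) = prob {\<omega> \<in> space M. \<xi> (L f) \<omega> \<in> A}"
    by (simp add: space_PiM)
  moreover have "coord_map 1 (\<lambda>_. f) -` ?A = blinfun_apply f -` A"
    by (auto simp: coord_map_def space_PiM)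
  ultimately show "cylinder_prob (blinfun_apply f -` A) = measure (centered_gaussian (blinfun_apply f (T f))) A"
    by (simp add: measure_law_L[OF A])
qed

text \<open>Uniqueness on cylinder sets. A linear combination of the coordinates is one functional
  \<open>h\<close>, whose law under \<mu> is prescribed; Cramer-Wold then determines the joint
  law.\<close>

lemma gaussian_cylinder_measure_coord_map:
  assumes \<mu>: "gaussian_cylinder_measure T \<mu>" and A: "A \<in> sets (\<Pi>\<^sub>M i\<in>{..<n}. borel)"
  shows "\<mu> (coord_map n f -` A) = prob {\<omega> \<in> space M. (\<lambda>i\<in>{..<n}. \<xi> (L (f i)) \<omega>) \<in> A}"
proof -
  obtain P where P: "prob_space P" and sets_P: "sets P = sets (\<Pi>\<^sub>M i\<in>{..<n}. (borel :: real measure))"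
    and P_eq: "\<And>A. A \<in> sets P \<Longrightarrow> measure P A = \<mu> (coord_map n f -` A)"
    using \<mu> unfolding gaussian_cylinder_measure_def cylinder_measure_def by metis
  interpret P: prob_space P by fact
  have space_P: "space P = {..<n} \<rightarrow>\<^sub>E UNIV"
    using sets_eq_imp_space_eq[OF sets_P] by (simp add: space_PiM)
  have mP[measurable]: "(\<lambda>y. y i) \<in> borel_measurable P" if "i < n" for i
    using measurable_component_singleton[of i "{..<n}" "\<lambda>_. borel"] that
    by (simp cong: measurable_cong_sets add: measurable_cong_sets[OF sets_P refl])
  have "distr P (\<Pi>\<^sub>M i\<in>{..<n}. borel) (\<lambda>y. \<lambda>i\<in>{..<n}. y i) =
      distr M (\<Pi>\<^sub>M i\<in>{..<n}. borel) (\<lambda>\<omega>. \<lambda>i\<in>{..<n}. \<xi> (L (f i)) \<omega>)"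
  proof (rule cramer_wold[OF P prob_space_axioms])
    fix t :: "nat \<Rightarrow> real"
    define h where "h = (\<Sum>i<n. t i *\<^sub>R f i)"
    have Lh: "L h = (\<Sum>i<n. t i *\<^sub>R L (f i))"
      unfolding h_def linear_sum[OF linear_L] linear_scale[OF linear_L] ..
    show "distr P borel (\<lambda>y. \<Sum>i<n. t i * y i) = distr M borel (\<lambda>\<omega>. \<Sum>i<n. t i * \<xi> (L (f i)) \<omega>)"
    proof (rule measure_eqI)
      fix A assume "A \<in> sets (distr P borel (\<lambda>y. \<Sum>i<n. t i * y i))"
      then have A[measurable]: "A \<in> sets borel" by simp
      let ?A = "{y \<in> space P. (\<Sum>i<n. t i * y i) \<in> A}"
      have "?A \<in> sets P" by measurable
      have "coord_map n f -` ?A = blinfun_apply h -` A"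
        by (auto simp: coord_map_def space_P h_def blinfun.sum_left blinfun.scaleR_left)
      then have "measure P ?A = prob {\<omega> \<in> space M. \<xi> (L h) \<omega> \<in> A}"
        using P_eq[OF \<open>?A \<in> sets P\<close>] \<mu> A
        by (simp add: gaussian_cylinder_measure_def measure_law_L[OF A])
      also have "\<dots> = prob {\<omega> \<in> space M. (\<Sum>i<n. t i * \<xi> (L (f i)) \<omega>) \<in> A}"
      proof (rule finite_measure_eq_AE)
        show "AE \<omega> in M. \<omega> \<in> {\<omega> \<in> space M. \<xi> (L h) \<omega> \<in> A} \<longleftrightarrow>
            \<omega> \<in> {\<omega> \<in> space M. (\<Sum>i<n. t i * \<xi> (L (f i)) \<omega>) \<in> A}"
          using AE_field_sum[of "{..<n}" t "\<lambda>i. L (f i)"] unfolding Lh by (auto elim: AE_mp)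
      qed measurable
      finally have *: "measure P ?A = prob {\<omega> \<in> space M. (\<Sum>i<n. t i * \<xi> (L (f i)) \<omega>) \<in> A}" .
      have "emeasure (distr P borel (\<lambda>y. \<Sum>i<n. t i * y i)) A = ennreal (measure P ?A)"
        by (subst emeasure_distr) (auto simp: P.emeasure_eq_measure vimage_def Int_def conj_commute)
      moreover have "emeasure (distr M borel (\<lambda>\<omega>. \<Sum>i<n. t i * \<xi> (L (f i)) \<omega>)) A =
          ennreal (prob {\<omega> \<in> space M. (\<Sum>i<n. t i * \<xi> (L (f i)) \<omega>) \<in> A})"
        by (subst emeasure_distr) (auto simp: emeasure_eq_measure vimage_def Int_def conj_commute)
      ultimately show "emeasure (distr P borel (\<lambda>y. \<Sum>i<n. t i * y i)) A =
          emeasure (distr M borel (\<lambda>\<omega>. \<Sum>i<n. t i * \<xi> (L (f i)) \<omega>)) A" using * by simp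
    qed simp
  qed auto
  moreover have "distr P (\<Pi>\<^sub>M i\<in>{..<n}. borel) (\<lambda>y. \<lambda>i\<in>{..<n}. y i) = distr P P (\<lambda>y. y)"
    by (rule distr_cong) (auto simp: sets_P space_P PiE_def extensional_restrict)
  ultimately have "P = distr M (\<Pi>\<^sub>M i\<in>{..<n}. borel) (\<lambda>\<omega>. \<lambda>i\<in>{..<n}. \<xi> (L (f i)) \<omega>)" by simp
  then have "measure P A = prob {\<omega> \<in> space M. (\<lambda>i\<in>{..<n}. \<xi> (L (f i)) \<omega>) \<in> A}"
    by (simp add: measure_distr[OF _ A] vimage_def Int_def conj_commute)
  then show ?thesis using P_eq[of A] A by (simp add: sets_P)
qed

end

section \<open>Approximate saddle points\<close>

lemma strategies_borel_measurable:
  fixes v :: "'b::real_normed_vector \<Rightarrow> 'b"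
  assumes "v \<in> strategies \<Phi>"
  shows "v \<in> borel_measurable borel"
proof (rule measurableI)
  fix A :: "'b set" assume "A \<in> sets borel"
  with assms have "v -` A \<inter> space (sigma_functionals \<Phi>) \<in> sets (sigma_functionals \<Phi>)"
    unfolding strategies_def by (rule measurable_sets)
  then show "v -` A \<inter> space borel \<in> sets borel" using sets_sigma_functionals_borel[of \<Phi>] by auto
qed auto

lemma blinfun_apply_borel_measurable [measurable]:
  "blinfun_apply (f :: 'b::real_normed_vector \<Rightarrow>\<^sub>L 'c::real_normed_vector) \<in> borel_measurable borel"
  by (intro borel_measurable_continuous_onI continuous_intros)

text \<open>Mean square convergence gives almost sure convergence only along subsequences; this
  lemma returns from those to the full sequence of integrals.\<close>

lemma tendsto_if_subsequences:
  fixes a :: "nat \<Rightarrow> 'a::metric_space"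
  assumes "\<And>r :: nat \<Rightarrow> nat. strict_mono r \<Longrightarrow> \<exists>s :: nat \<Rightarrow> nat. strict_mono s \<and> (\<lambda>n. a (r (s n))) \<longlonglongrightarrow> l"
  shows "a \<longlonglongrightarrow> l"
proof (rule ccontr)
  assume "\<not> a \<longlonglongrightarrow> l"
  then obtain d where d: "0 < d" "\<not> (\<forall>\<^sub>F n in sequentially. dist (a n) l < d)"
    unfolding tendsto_iff by blast
  obtain r :: "nat \<Rightarrow> nat" where r: "strict_mono r" "\<And>n. \<not> dist (a (r n)) l < d"
    using not_eventually_sequentiallyD[OF d(2)] by blast
  obtain s where "(\<lambda>n. a (r (s n))) \<longlonglongrightarrow> l" using assms[OF r(1)] by blast
  then have "\<forall>\<^sub>F n in sequentially. dist (a (r (s n))) l < d" using d(1) by (rule tendstoD)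
  then show False using r(2) by simp
qed

section \<open>A basis of the kernel and upper bounds for the loss of the projection\<close>

context gamblet_space
begin

lemma subspace_data_kernel: "subspace data_kernel"
  by (auto simp: subspace_def blinfun.add_right blinfun.scaleR_right)

text \<open>\<open>x - proj x\<close> does not increase norms and fixes the kernel, so it maps a
  countable dense set of the space to a dense sequence of the kernel, which is then
  orthonormalized.\<close>

lemma kernel_basis:
  obtains e where "orthonormal_or_zero e" "\<And>i. e i \<in> data_kernel"
    "\<And>r. r \<in> data_kernel \<Longrightarrow> (\<lambda>N. partial_expansion e N r) \<longlonglongrightarrow> r"
proof -
  obtain D :: "'b set" where D: "countable D" "\<And>X. open X \<Longrightarrow> X \<noteq> {} \<Longrightarrow> \<exists>d\<in>D. d \<in> X"
    using countable_dense_exists by blast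
  have "D \<noteq> {}" using D(2)[of UNIV] by auto
  then have D_range: "range (from_nat_into D) = D" using D(1) by (rule range_from_nat_into)
  define h where "h n = from_nat_into D n - proj (from_nat_into D n)" for n
  have h: "h n \<in> data_kernel" for n unfolding h_def by (rule diff_proj_in_kernel)
  have closure: "r \<in> closure (range h)" if r: "r \<in> data_kernel" for r
    unfolding closure_approachable
  proof (intro allI impI)
    fix \<epsilon> :: real assume "0 < \<epsilon>"
    then obtain d where d: "d \<in> D" "d \<in> ball r \<epsilon>" using D(2)[of "ball r \<epsilon>"] by auto
    then obtain n where n: "d = from_nat_into D n" using D_range by blast
    have "h n - r = (d - r) - proj (d - r)"
      by (simp add: h_def n linear_diff[OF linear_proj] proj_kernel[OF r])
    then have "norm (h n - r) \<le> norm (d - r)" by (simp only: norm_diff_proj_le)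
    also have "\<dots> < \<epsilon>" using d(2) by (simp add: dist_norm norm_minus_commute)
    finally show "\<exists>y\<in>range h. dist y r < \<epsilon>" by (auto simp: dist_norm)
  qed
  show ?thesis
  proof (rule that[of "gram_schmidt h"])
    show "gram_schmidt h i \<in> data_kernel" for i
      by (rule gram_schmidt_in_subspace[OF subspace_data_kernel h])
    show "(\<lambda>N. partial_expansion (gram_schmidt h) N r) \<longlonglongrightarrow> r" if "r \<in> data_kernel" for r
      by (rule partial_expansion_tendsto[OF orthonormal_or_zero_gram_schmidt gram_schmidt_expansion closure[OF that]])
  qed (rule orthonormal_or_zero_gram_schmidt)
qed

lemma Psi_proj_le_1:
  assumes "\<mu> \<in> M2"
  shows "Psi proj \<mu> \<le> 1"
proof -
  have le: "(\<integral>\<^sup>+x. ennreal ((norm (x - proj x))\<^sup>2) \<partial>\<mu>) \<le> (\<integral>\<^sup>+x. ennreal ((norm x)\<^sup>2) \<partial>\<mu>)" (is "?a \<le> ?b")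
    by (intro nn_integral_mono ennreal_leI power_mono norm_diff_proj_le) simp
  show ?thesis
  proof (cases "?b = 0")
    case True
    \<comment> \<open>This is the Dirac measure at 0, where the convention \<open>0 / 0 = 0\<close>
      of \<open>ennreal\<close> decides.\<close>
    then show ?thesis using le by (simp add: Psi_def)
  next
    case False
    have "?b = ennreal (\<integral>x. (norm x)\<^sup>2 \<partial>\<mu>)"
      using assms by (intro nn_integral_eq_integral) (auto simp: M2_def)
    then have "?b \<noteq> \<infinity>" by simp
    with False have "?b / ?b = 1" by (simp add: ennreal_divide_self top.not_eq_extremum zero_less_iff_neq_zero)
    then show ?thesis using divide_right_mono_ennreal[OF le, of ?b] by (simp add: Psi_def)
  qed
qed

lemma Psi_proj_trivial_kernel:
  assumes "data_kernel = {0}"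
  shows "Psi proj \<mu> = 0"
proof -
  have "x - proj x = 0" for x using diff_proj_in_kernel assms by blast
  then show ?thesis by (simp add: Psi_def)
qed

end

locale gaussian_gamblet_space = gaussian_field_space Q M \<xi> + gamblet_space Q J \<phi> \<psi>
  for Q :: "('b::{real_normed_vector, second_countable_topology} \<Rightarrow>\<^sub>L real) \<Rightarrow> 'b"
    and M :: "'w measure" and \<xi> and J :: "'j set" and \<phi> and \<psi>

text \<open>\<open>approx\<close> truncates the field: the part predicted from the data, scaled by
  \<delta>, plus the first \<open>N\<close> coordinates of the kernel component. Zero vectors in
  \<open>e\<close> accommodate kernels of finite dimension.\<close>

locale worst_case_sequence = gaussian_gamblet_space Q M \<xi> J \<phi> \<psi>
  for Q :: "('b::{real_normed_vector, second_countable_topology} \<Rightarrow>\<^sub>L real) \<Rightarrow> 'b"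
    and M :: "'w measure" and \<xi> and J :: "'j set" and \<phi> and \<psi> +
  fixes e :: "nat \<Rightarrow> 'b" and \<delta> :: real
  assumes e_orthonormal: "orthonormal_or_zero e"
    and e_kernel: "e i \<in> data_kernel"
    and e_expansion: "r \<in> data_kernel \<Longrightarrow> (\<lambda>N. partial_expansion e N r) \<longlonglongrightarrow> r"
begin

definition known :: "'w \<Rightarrow> 'b" where
  "known \<omega> = \<delta> *\<^sub>R (\<Sum>j\<in>J. \<xi> (\<phi> j) \<omega> *\<^sub>R \<psi> j)"

definition residual :: "nat \<Rightarrow> 'w \<Rightarrow> 'b" where
  "residual N \<omega> = (\<Sum>i<N. \<xi> (inv Q (e i)) \<omega> *\<^sub>R e i)"

definition approx :: "nat \<Rightarrow> 'w \<Rightarrow> 'b" where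
  "approx N \<omega> = known \<omega> + residual N \<omega>"

definition approx_law :: "nat \<Rightarrow> 'b measure" where
  "approx_law N = distr M borel (approx N)"

definition known_var :: real where
  "known_var = expectation (\<lambda>\<omega>. (norm (known \<omega>))\<^sup>2)"

text \<open>Every summand is 0 or 1, so this counts the nonzero basis vectors below
  \<open>N\<close>. It is also the second moment of the residual.\<close>

definition residual_dim :: "nat \<Rightarrow> real" where
  "residual_dim N = (\<Sum>i<N. (norm (e i))\<^sup>2)"

lemma known_measurable [measurable]: "known \<in> borel_measurable M"
  unfolding known_def by (intro borel_measurable_sum borel_measurable_scaleR) auto

lemma residual_measurable [measurable]: "residual N \<in> borel_measurable M"
  unfolding residual_def by (intro borel_measurable_sum borel_measurable_scaleR) auto

lemma approx_measurable [measurable]: "approx N \<in> borel_measurable M"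
  unfolding approx_def by (intro borel_measurable_add) measurable

lemma norm_e_sq: "(norm (e i))\<^sup>2 = (if e i = 0 then 0 else 1)"
  using e_orthonormal unfolding ip_self[symmetric] orthonormal_or_zero_def by auto

lemma residual_in_kernel: "residual N \<omega> \<in> data_kernel"
  unfolding residual_def by (intro subspace_sum[OF subspace_data_kernel] subspace_scale[OF subspace_data_kernel] e_kernel)

lemma proj_known: "proj (known \<omega>) = known \<omega>"
  unfolding known_def linear_scale[OF linear_proj]
  by (simp add: proj_def apply_gamblet_sum)

lemma proj_approx: "proj (approx N \<omega>) = known \<omega>"
  unfolding approx_def linear_add[OF linear_proj] proj_known proj_kernel[OF residual_in_kernel] by simp

lemma approx_diff_proj: "approx N \<omega> - proj (approx N \<omega>) = residual N \<omega>"
  unfolding proj_approx by (simp add: approx_def)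

lemma norm_residual_sq: "(norm (residual N \<omega>))\<^sup>2 = (\<Sum>i<N. (norm (e i))\<^sup>2 * (\<xi> (inv Q (e i)) \<omega>)\<^sup>2)"
proof -
  have "(norm (residual N \<omega>))\<^sup>2 = (\<Sum>i<N. \<Sum>j<N. \<xi> (inv Q (e i)) \<omega> * \<xi> (inv Q (e j)) \<omega> * ip (e i) (e j))"
    unfolding ip_self[symmetric] residual_def
    by (simp add: sum_distrib_left mult.assoc) (intro sum.cong refl, simp add: ip_commute)
  also have "\<dots> = (\<Sum>i<N. \<Sum>j<N. if i = j then (norm (e i))\<^sup>2 * (\<xi> (inv Q (e i)) \<omega>)\<^sup>2 else 0)"
    using e_orthonormal unfolding orthonormal_or_zero_def norm_e_sq
    by (intro sum.cong refl) (auto simp: power2_eq_square)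
  also have "\<dots> = (\<Sum>i<N. (norm (e i))\<^sup>2 * (\<xi> (inv Q (e i)) \<omega>)\<^sup>2)" by simp
  finally show ?thesis .
qed

lemma integrable_residual: "integrable M (\<lambda>\<omega>. (norm (residual N \<omega>))\<^sup>2)"
  unfolding norm_residual_sq by (intro Bochner_Integration.integrable_sum integrable_mult_right) (auto intro: integrable_field_sq)

lemma expectation_residual: "expectation (\<lambda>\<omega>. (norm (residual N \<omega>))\<^sup>2) = residual_dim N"
proof -
  have "expectation (\<lambda>\<omega>. (\<xi> (inv Q (e i)) \<omega>)\<^sup>2) = (norm (e i))\<^sup>2" for i
    using field_cov[of "inv Q (e i)" "inv Q (e i)"] unfolding apply_Q_self by (simp add: power2_eq_square)
  then have "expectation (\<lambda>\<omega>. (norm (residual N \<omega>))\<^sup>2) = (\<Sum>i<N. (norm (e i))\<^sup>2 * (norm (e i))\<^sup>2)"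
    unfolding norm_residual_sq by (subst Bochner_Integration.integral_sum) (auto intro: integrable_field_sq)
  also have "\<dots> = residual_dim N" unfolding residual_dim_def norm_e_sq by (intro sum.cong) auto
  finally show ?thesis .
qed

lemma integrable_field_mult: "integrable M (\<lambda>\<omega>. \<xi> f \<omega> * \<xi> g \<omega>)"
proof (rule Bochner_Integration.integrable_bound)
  show "integrable M (\<lambda>\<omega>. (\<xi> f \<omega>)\<^sup>2 + (\<xi> g \<omega>)\<^sup>2)" by (intro Bochner_Integration.integrable_add integrable_field_sq)
  have "\<bar>a * b\<bar> \<le> a\<^sup>2 + b\<^sup>2" for a b :: real
  proof -
    have "2 * (\<bar>a\<bar> * \<bar>b\<bar>) \<le> a\<^sup>2 + b\<^sup>2" using sum_squares_bound[of "\<bar>a\<bar>" "\<bar>b\<bar>"] by (simp add: mult.assoc)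
    moreover have "0 \<le> \<bar>a\<bar> * \<bar>b\<bar>" by simp
    ultimately show ?thesis unfolding abs_mult by linarith
  qed
  then show "AE \<omega> in M. norm (\<xi> f \<omega> * \<xi> g \<omega>) \<le> norm ((\<xi> f \<omega>)\<^sup>2 + (\<xi> g \<omega>)\<^sup>2)" by (auto intro!: AE_I2)
qed measurable

lemma integrable_known: "integrable M (\<lambda>\<omega>. (norm (known \<omega>))\<^sup>2)"
proof -
  have "(norm (known \<omega>))\<^sup>2 = (\<Sum>i\<in>J. \<Sum>j\<in>J. (\<delta> * \<delta> * ip (\<psi> i) (\<psi> j)) * (\<xi> (\<phi> i) \<omega> * \<xi> (\<phi> j) \<omega>))" for \<omega>
    unfolding ip_self[symmetric] known_def
    by (simp add: sum_distrib_left mult_ac) (intro sum.cong refl, simp add: ip_commute)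
  then show ?thesis
    by (simp add: integrable_field_mult)
qed

lemma norm_approx_sq: "(norm (approx N \<omega>))\<^sup>2 = (norm (known \<omega>))\<^sup>2 + (norm (residual N \<omega>))\<^sup>2"
  using norm_proj_decomposition[of "approx N \<omega>"] unfolding proj_approx by (simp add: approx_def)

lemma known_var_nonneg: "0 \<le> known_var" and residual_dim_nonneg: "0 \<le> residual_dim N"
  unfolding known_var_def residual_dim_def by (auto intro: sum_nonneg)

lemma integrable_approx: "integrable M (\<lambda>\<omega>. (norm (approx N \<omega>))\<^sup>2)"
  unfolding norm_approx_sq by (intro Bochner_Integration.integrable_add integrable_known integrable_residual)

lemma approx_law_M2: "approx_law N \<in> M2"
  unfolding M2_def approx_law_def
  by (simp add: prob_space_distr integrable_distr_eq integrable_approx)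

lemma second_moment_approx_law:
  "(\<integral>\<^sup>+x. ennreal ((norm x)\<^sup>2) \<partial>approx_law N) = ennreal (known_var + residual_dim N)"
proof -
  have "(\<integral>\<^sup>+x. ennreal ((norm x)\<^sup>2) \<partial>approx_law N) = (\<integral>\<^sup>+\<omega>. ennreal ((norm (approx N \<omega>))\<^sup>2) \<partial>M)"
    unfolding approx_law_def by (subst nn_integral_distr) auto
  also have "\<dots> = ennreal (expectation (\<lambda>\<omega>. (norm (approx N \<omega>))\<^sup>2))"
    by (rule nn_integral_eq_integral[OF integrable_approx]) simp
  also have "expectation (\<lambda>\<omega>. (norm (approx N \<omega>))\<^sup>2) = known_var + residual_dim N"
    unfolding norm_approx_sq
    by (simp add: integrable_known integrable_residual expectation_residual known_var_def)
  finally show ?thesis .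
qed

lemma nn_integral_residual: "(\<integral>\<^sup>+\<omega>. ennreal ((norm (residual N \<omega>))\<^sup>2) \<partial>M) = ennreal (residual_dim N)"
  unfolding expectation_residual[symmetric] by (rule nn_integral_eq_integral[OF integrable_residual]) simp

lemma proj_loss_approx_law:
  "(\<integral>\<^sup>+x. ennreal ((norm (x - proj x))\<^sup>2) \<partial>approx_law N) = ennreal (residual_dim N)"
proof -
  have [measurable]: "proj \<in> borel_measurable borel" by (rule strategies_borel_measurable[OF proj_strategy])
  have [measurable]: "(\<lambda>x. x - proj x) \<in> borel_measurable borel" by (intro borel_measurable_diff) auto
  have "(\<integral>\<^sup>+x. ennreal ((norm (x - proj x))\<^sup>2) \<partial>approx_law N) = (\<integral>\<^sup>+\<omega>. ennreal ((norm (residual N \<omega>))\<^sup>2) \<partial>M)"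
    unfolding approx_law_def by (subst nn_integral_distr) (auto simp: approx_diff_proj)
  then show ?thesis by (simp only: nn_integral_residual)
qed

text \<open>
  The known part and the residual are independent and symmetric, so changing the sign of the residual
  does not change the law; a strategy does not see this change.
\<close>

lemma strategy_loss_approx_law:
  assumes v: "v \<in> strategies (span (\<phi> ` J))"
  shows "ennreal (residual_dim N) \<le> (\<integral>\<^sup>+x. ennreal ((norm (x - v x))\<^sup>2) \<partial>approx_law N)"
proof -
  have [measurable]: "v \<in> borel_measurable borel" by (rule strategies_borel_measurable[OF v])
  define g where "g x = ennreal ((norm (x - v x))\<^sup>2)" for x
  have [measurable]: "(\<lambda>x. x - v x) \<in> borel_measurable borel" by (intro borel_measurable_diff) auto
  have [measurable]: "g \<in> borel_measurable borel" unfolding g_def by measurable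
  \<comment> \<open>\<open>Inl\<close> indexes the data and \<open>Inr\<close> the residual
    coefficients; \<open>x\<close> below rebuilds the random vector from these values.\<close>
  define K where "K = Inl ` J \<union> Inr ` {..<N}"
  have K: "finite K" "\<And>j. j \<in> J \<Longrightarrow> Inl j \<in> K" "\<And>i. i < N \<Longrightarrow> Inr i \<in> K"
    using finite_J by (auto simp: K_def)
  define x where "x y = \<delta> *\<^sub>R (\<Sum>j\<in>J. y (Inl j) *\<^sub>R \<psi> j) + (\<Sum>i<N. y (Inr i) *\<^sub>R e i)" for y :: "'j + nat \<Rightarrow> real"
  have [measurable]: "x \<in> borel_measurable (\<Pi>\<^sub>M k\<in>K. borel)"
    unfolding x_def
    by (intro borel_measurable_add borel_measurable_sum borel_measurable_scaleR borel_measurable_const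
        measurable_component_singleton) (auto simp: K)
  define F where "F = case_sum \<phi> (\<lambda>i. inv Q (e i))"
  define G where "G = case_sum \<phi> (\<lambda>i. - inv Q (e i))"
  have "distr M (\<Pi>\<^sub>M k\<in>K. borel) (\<lambda>\<omega>. \<lambda>k\<in>K. \<xi> (F k) \<omega>) = distr M (\<Pi>\<^sub>M k\<in>K. borel) (\<lambda>\<omega>. \<lambda>k\<in>K. \<xi> (G k) \<omega>)"
  proof (rule joint_law_eqI[OF K(1)])
    have "blinfun_apply (\<phi> j) (e i) = 0" "blinfun_apply (inv Q (e i)) (Q (\<phi> j)) = 0" if "j \<in> J" for i j
      using e_kernel[of i] that Q_sym[of "inv Q (e i)" "\<phi> j"] by auto
    then show "blinfun_apply (F i) (Q (F j)) = blinfun_apply (G i) (Q (G j))" if "i \<in> K" "j \<in> K" for i j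
      using that by (auto simp: K_def F_def G_def linear_neg[OF linear_Q] blinfun.minus_left blinfun.minus_right)
  qed
  then have "(\<integral>\<^sup>+y. g (x y) \<partial>distr M (\<Pi>\<^sub>M k\<in>K. borel) (\<lambda>\<omega>. \<lambda>k\<in>K. \<xi> (F k) \<omega>)) =
    (\<integral>\<^sup>+y. g (x y) \<partial>distr M (\<Pi>\<^sub>M k\<in>K. borel) (\<lambda>\<omega>. \<lambda>k\<in>K. \<xi> (G k) \<omega>))" by simp
  then have xFG: "(\<integral>\<^sup>+\<omega>. g (x (\<lambda>k\<in>K. \<xi> (F k) \<omega>)) \<partial>M) = (\<integral>\<^sup>+\<omega>. g (x (\<lambda>k\<in>K. \<xi> (G k) \<omega>)) \<partial>M)"
    by (subst (asm) (1 2) nn_integral_distr) auto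
  have xF: "x (\<lambda>k\<in>K. \<xi> (F k) \<omega>) = approx N \<omega>" for \<omega>
    unfolding x_def approx_def known_def residual_def F_def using K
    by (intro arg_cong2[where f=plus] arg_cong[where f="scaleR \<delta>"] sum.cong) auto
  have "AE \<omega> in M. \<forall>i\<in>{..<N}. \<xi> (- inv Q (e i)) \<omega> = - \<xi> (inv Q (e i)) \<omega>"
    by (intro AE_finite_allI AE_field_minus) auto
  then have "AE \<omega> in M. g (x (\<lambda>k\<in>K. \<xi> (G k) \<omega>)) = g (known \<omega> - residual N \<omega>)"
  proof eventually_elim
    case (elim \<omega>)
    have "x (\<lambda>k\<in>K. \<xi> (G k) \<omega>) = known \<omega> + (\<Sum>i<N. - (\<xi> (inv Q (e i)) \<omega> *\<^sub>R e i))"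
      unfolding x_def known_def G_def using K elim
      by (intro arg_cong2[where f=plus] arg_cong[where f="scaleR \<delta>"] sum.cong) auto
    also have "\<dots> = known \<omega> - residual N \<omega>" by (simp add: sum_negf residual_def)
    finally show ?case by simp
  qed
  then have sym: "(\<integral>\<^sup>+\<omega>. g (approx N \<omega>) \<partial>M) = (\<integral>\<^sup>+\<omega>. g (known \<omega> - residual N \<omega>) \<partial>M)"
    using xFG unfolding xF by (simp cong: nn_integral_cong_AE)
  have [measurable]: "(\<lambda>\<omega>. known \<omega> - residual N \<omega>) \<in> borel_measurable M"
    by (intro borel_measurable_diff) measurable
  \<comment> \<open>With the common answer subtracted, the two errors \<open>a\<close> and
    \<open>b\<close> satisfy \<open>a - b = 2 w\<close> for the residual \<open>w\<close>. Hence
    \<open>4 |w|^2\<close> is at most \<open>2 (|a|^2 + |b|^2)\<close>, whatever the answer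
    is.\<close>
  have point: "2 * ennreal ((norm (residual N \<omega>))\<^sup>2) \<le> g (approx N \<omega>) + g (known \<omega> - residual N \<omega>)" for \<omega>
  proof -
    let ?w = "residual N \<omega>" and ?k = "known \<omega>"
    have veq: "v (?k - ?w) = v (?k + ?w)"
      by (rule strategies_eq_on_data[OF v])
         (use residual_in_kernel[of N \<omega>] in \<open>simp add: blinfun.add_right blinfun.diff_right\<close>)
    define a where "a = ?k + ?w - v (?k + ?w)"
    define b where "b = ?k - ?w - v (?k + ?w)"
    have "a - b = 2 *\<^sub>R ?w" by (simp add: a_def b_def scaleR_2)
    then have "2 * norm ?w = norm (a - b)" by simp
    also have "\<dots> \<le> norm a + norm b" by (rule norm_triangle_ineq4)
    finally have "(2 * norm ?w)\<^sup>2 \<le> (norm a + norm b)\<^sup>2" by (intro power_mono) auto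
    also have "\<dots> \<le> 2 * ((norm a)\<^sup>2 + (norm b)\<^sup>2)"
      using sum_squares_bound[of "norm a" "norm b"] by (simp add: power2_sum algebra_simps)
    finally have "2 * (norm ?w)\<^sup>2 \<le> (norm a)\<^sup>2 + (norm b)\<^sup>2" by (simp add: power_mult_distrib)
    then have "ennreal (2 * (norm ?w)\<^sup>2) \<le> ennreal ((norm a)\<^sup>2 + (norm b)\<^sup>2)" by (rule ennreal_leI)
    then show ?thesis
      unfolding g_def veq approx_def a_def[symmetric] b_def[symmetric]
      by (simp add: ennreal_mult ennreal_plus)
  qed
  have "2 * ennreal (residual_dim N) = (\<integral>\<^sup>+\<omega>. 2 * ennreal ((norm (residual N \<omega>))\<^sup>2) \<partial>M)"
    by (subst nn_integral_cmult) (auto simp: nn_integral_residual)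
  also have "\<dots> \<le> (\<integral>\<^sup>+\<omega>. g (approx N \<omega>) + g (known \<omega> - residual N \<omega>) \<partial>M)"
    by (intro nn_integral_mono point)
  also have "\<dots> = 2 * (\<integral>\<^sup>+\<omega>. g (approx N \<omega>) \<partial>M)"
    by (subst nn_integral_add) (auto simp: sym[symmetric] mult_2)
  also have "(\<integral>\<^sup>+\<omega>. g (approx N \<omega>) \<partial>M) = (\<integral>\<^sup>+x. g x \<partial>approx_law N)"
    unfolding approx_law_def by (subst nn_integral_distr) auto
  finally show ?thesis
    unfolding g_def by (simp add: ennreal_mult_le_mult_iff)
qed

text \<open>The loss of \<open>proj\<close> here is
  \<open>residual_dim N / (known_var + residual_dim N)\<close>, while no measure makes it exceed 1;
  the bound on \<open>known_var\<close> keeps the gap within \<epsilon>. With a trivial kernel the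
  loss of \<open>proj\<close> is 0 under every measure.\<close>

lemma eps_saddle_point_approx_law:
  assumes \<epsilon>: "0 < \<epsilon>"
    and close: "data_kernel = {0} \<or> (0 < residual_dim N \<and> known_var \<le> \<epsilon> * residual_dim N)"
  shows "eps_saddle_point (span (\<phi> ` J)) \<epsilon> proj (approx_law N)"
  unfolding eps_saddle_point_def
proof (intro conjI ballI)
  show "proj \<in> strategies (span (\<phi> ` J))" by (rule proj_strategy)
  show "approx_law N \<in> M2" by (rule approx_law_M2)
next
  fix v assume "v \<in> strategies (span (\<phi> ` J))"
  then have "Psi proj (approx_law N) \<le> Psi v (approx_law N)"
    unfolding Psi_def proj_loss_approx_law by (intro divide_right_mono_ennreal strategy_loss_approx_law)
  then show "Psi proj (approx_law N) \<le> Psi v (approx_law N) + ennreal \<epsilon>" by (rule order_trans) simp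
next
  fix \<mu> :: "'b measure" assume \<mu>: "\<mu> \<in> M2"
  from close show "Psi proj \<mu> \<le> Psi proj (approx_law N) + ennreal \<epsilon>"
  proof
    assume "data_kernel = {0}"
    then show ?thesis by (simp add: Psi_proj_trivial_kernel)
  next
    assume *: "0 < residual_dim N \<and> known_var \<le> \<epsilon> * residual_dim N"
    let ?k = "residual_dim N"
    have pos: "0 < known_var + ?k" using * known_var_nonneg by linarith
    have "known_var + ?k \<le> ?k + \<epsilon> * (known_var + ?k)"
      using * mult_nonneg_nonneg[OF less_imp_le[OF \<epsilon>] known_var_nonneg] by (simp add: distrib_left)
    then have "1 \<le> ?k / (known_var + ?k) + \<epsilon>" using pos by (simp add: field_simps)
    then have "1 \<le> ennreal (?k / (known_var + ?k) + \<epsilon>)" using ennreal_leI[of 1] by simp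
    also have "\<dots> = ennreal (?k / (known_var + ?k)) + ennreal \<epsilon>"
      using \<epsilon> pos * by (intro ennreal_plus) auto
    also have "ennreal (?k / (known_var + ?k)) = Psi proj (approx_law N)"
      unfolding Psi_def proj_loss_approx_law second_moment_approx_law
      using pos * by (intro divide_ennreal[symmetric]) auto
    finally show ?thesis using Psi_proj_le_1[OF \<mu>] by (rule order_trans[rotated])
  qed
qed

end

section \<open>Convergence of the truncations on cylinders\<close>

context worst_case_sequence
begin

text \<open>The limit of \<open>f\<close> applied to \<open>approx N\<close> is the field at this
  functional. It is \<open>f - adj f\<close>, with the shorted covariance, for \<delta> = 0 and
  \<open>f\<close> itself for \<delta> = 1.\<close>

definition limit_functional :: "('b \<Rightarrow>\<^sub>L real) \<Rightarrow> ('b \<Rightarrow>\<^sub>L real)" where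
  "limit_functional f = (f - adj f) + \<delta> *\<^sub>R adj f"

lemma linear_limit_functional: "linear limit_functional"
  by (rule linearI)
     (simp_all add: limit_functional_def linear_add[OF linear_adj] linear_scale[OF linear_adj] algebra_simps)

text \<open>The known parts cancel, so the error is the field at the functional \<open>h N\<close>.
  The isometry turns its mean square into the squared error of a partial expansion of
  \<open>short f\<close>, a vector of the kernel.\<close>

lemma approx_mean_square_error:
  "(\<lambda>N. expectation (\<lambda>\<omega>. (blinfun_apply f (approx N \<omega>) - \<xi> (limit_functional f) \<omega>)\<^sup>2)) \<longlonglongrightarrow> 0"
proof -
  define h where "h N = (\<Sum>i<N. blinfun_apply f (e i) *\<^sub>R inv Q (e i)) - (f - adj f)" for N
  have "expectation (\<lambda>\<omega>. (blinfun_apply f (approx N \<omega>) - \<xi> (limit_functional f) \<omega>)\<^sup>2) =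
      (norm (partial_expansion e N (short f) - short f))\<^sup>2" for N
  proof -
    let ?s = "\<Sum>i<N. blinfun_apply f (e i) *\<^sub>R inv Q (e i)"
    have "AE \<omega> in M. \<xi> (adj f) \<omega> = (\<Sum>j\<in>J. blinfun_apply f (\<psi> j) * \<xi> (\<phi> j) \<omega>)"
      unfolding adj_def by (rule AE_field_sum[OF finite_J])
    moreover have "AE \<omega> in M. \<xi> ?s \<omega> = (\<Sum>i<N. blinfun_apply f (e i) * \<xi> (inv Q (e i)) \<omega>)"
      by (rule AE_field_sum) simp
    moreover have "AE \<omega> in M. \<xi> (limit_functional f) \<omega> = 1 * \<xi> (f - adj f) \<omega> + \<delta> * \<xi> (adj f) \<omega>"
      unfolding limit_functional_def using field_linear[of 1 "f - adj f" \<delta> "adj f"] by simp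
    moreover have "AE \<omega> in M. \<xi> (h N) \<omega> = \<xi> ?s \<omega> - \<xi> (f - adj f) \<omega>"
      unfolding h_def by (rule AE_field_diff)
    ultimately have "AE \<omega> in M. blinfun_apply f (approx N \<omega>) - \<xi> (limit_functional f) \<omega> = \<xi> (h N) \<omega>"
      by eventually_elim
         (simp add: approx_def known_def residual_def blinfun.add_right blinfun.scaleR_right blinfun.sum_right mult.commute)
    then have "AE \<omega> in M. (blinfun_apply f (approx N \<omega>) - \<xi> (limit_functional f) \<omega>)\<^sup>2 = \<xi> (h N) \<omega> * \<xi> (h N) \<omega>"
      by eventually_elim (simp add: power2_eq_square)
    then have "expectation (\<lambda>\<omega>. (blinfun_apply f (approx N \<omega>) - \<xi> (limit_functional f) \<omega>)\<^sup>2) =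
        expectation (\<lambda>\<omega>. \<xi> (h N) \<omega> * \<xi> (h N) \<omega>)"
      by (intro integral_cong_AE) measurable
    also have "\<dots> = (norm (Q (h N)))\<^sup>2" unfolding field_cov by (rule apply_Q_self)
    also have "Q (h N) = (\<Sum>i<N. blinfun_apply f (e i) *\<^sub>R e i) - short f"
      by (simp add: h_def short_def linear_diff[OF linear_Q] linear_sum[OF linear_Q] linear_scale[OF linear_Q])
    also have "(\<Sum>i<N. blinfun_apply f (e i) *\<^sub>R e i) = partial_expansion e N (short f)"
    proof (rule sum.cong[OF refl])
      fix i
      \<comment> \<open>\<open>Q f\<close> and \<open>short f\<close> differ by a vector in the
        range of \<open>proj\<close>, which is orthogonal to \<open>e i\<close>.\<close>
      have "ip (short f) (e i) = blinfun_apply f (e i)"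
        using ip_proj_kernel[OF e_kernel, of "Q f" i] by (simp add: short_eq apply_eq_ip)
      then show "blinfun_apply f (e i) *\<^sub>R e i = ip (short f) (e i) *\<^sub>R e i" by simp
    qed
    finally show ?thesis .
  qed
  moreover have "(\<lambda>N. (norm (partial_expansion e N (short f) - short f))\<^sup>2) \<longlonglongrightarrow> 0"
  proof -
    have "(\<lambda>N. partial_expansion e N (short f)) \<longlonglongrightarrow> short f"
      unfolding short_eq by (rule e_expansion) (rule diff_proj_in_kernel)
    then have "(\<lambda>N. norm (partial_expansion e N (short f) - short f)) \<longlonglongrightarrow> 0"
      by (intro tendsto_norm_zero) (simp add: LIM_zero_iff)
    from tendsto_power[OF this, of 2] show ?thesis by simp
  qed
  ultimately show ?thesis by (simp only:)
qed

lemma finite_rank_coordinates: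
  fixes F :: "'b \<Rightarrow>\<^sub>L 'b"
  assumes "finite_rank_projection F"
  obtains m and f :: "nat \<Rightarrow> 'b \<Rightarrow>\<^sub>L real" and b
  where "\<And>x. blinfun_apply F x = (\<Sum>i<m. blinfun_apply (f i) x *\<^sub>R b i)"
proof -
  obtain S where S: "finite S" "range (blinfun_apply F) \<subseteq> span S"
    using assms by (auto simp: finite_rank_projection_def)
  obtain b m where "orthonormal_or_zero b" and b: "\<And>x. x \<in> span S \<Longrightarrow> partial_expansion b m x = x"
    using finite_expansion[OF S(1)] by auto
  have "blinfun_apply F x = (\<Sum>i<m. blinfun_apply (inv Q (b i) o\<^sub>L F) x *\<^sub>R b i)" for x
  proof -
    have "partial_expansion b m (blinfun_apply F x) = blinfun_apply F x" using S(2) by (intro b) auto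
    then show ?thesis by (simp add: ip_commute[of "blinfun_apply F x"]) (simp add: ip_def)
  qed
  then show ?thesis by (rule that)
qed

text \<open>Under a finite-rank map the limit is the law of an actual random vector \<open>Z\<close>
  on the same probability space, so weak convergence follows from convergence of the vectors
  themselves and dominated convergence.\<close>

lemma weak_cylinder_conv_approx_law:
  assumes covariance: "\<And>f. blinfun_apply f (T f) = blinfun_apply (limit_functional f) (Q (limit_functional f))"
    and \<mu>: "gaussian_cylinder_measure T \<mu>" and N: "\<And>n. n \<le> N n"
  shows "weak_cylinder_conv (\<lambda>n. approx_law (N n)) \<mu>"
  unfolding weak_cylinder_conv_def
proof (intro allI impI)
  fix F :: "'b \<Rightarrow>\<^sub>L 'b" assume "finite_rank_projection F"
  then obtain m and f :: "nat \<Rightarrow> 'b \<Rightarrow>\<^sub>L real" and b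
    where F: "\<And>x. blinfun_apply F x = (\<Sum>i<m. blinfun_apply (f i) x *\<^sub>R b i)"
    by (rule finite_rank_coordinates) blast
  interpret transformed_gaussian_field Q M \<xi> limit_functional T
    by (intro transformed_gaussian_field.intro transformed_gaussian_field_axioms.intro
        gaussian_field_space_axioms linear_limit_functional covariance)
  define Z where "Z \<omega> = (\<Sum>i<m. \<xi> (limit_functional (f i)) \<omega> *\<^sub>R b i)" for \<omega>
  have [measurable]: "Z \<in> borel_measurable M"
    unfolding Z_def by (intro borel_measurable_sum borel_measurable_scaleR) auto
  have "cylinder_pushforward F \<mu> = measure_of UNIV (sets borel) (emeasure (distr M borel Z))"
    unfolding cylinder_pushforward_def
  proof (rule measure_of_eq)
    fix A assume "A \<in> sigma_sets UNIV (sets (borel :: 'b measure))"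
    then have A[measurable]: "A \<in> sets borel"
      using sets.sigma_sets_eq[of "borel :: 'b measure"] by simp
    let ?B = "{y \<in> space (\<Pi>\<^sub>M i\<in>{..<m}. (borel :: real measure)). (\<Sum>i<m. y i *\<^sub>R b i) \<in> A}"
    have "(\<lambda>y. \<Sum>i<m. y i *\<^sub>R b i) \<in> borel_measurable (\<Pi>\<^sub>M i\<in>{..<m}. (borel :: real measure))"
      by (intro borel_measurable_sum borel_measurable_scaleR measurable_component_singleton) auto
    then have B: "?B \<in> sets (\<Pi>\<^sub>M i\<in>{..<m}. borel)" by measurable
    \<comment> \<open>In the coordinates \<open>f\<close> the preimage becomes a cylinder set, on
      which \<mu> is known.\<close>
    have "blinfun_apply F -` A = coord_map m f -` ?B"
      by (auto simp: coord_map_def space_PiM F)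
    then have "\<mu> (blinfun_apply F -` A) = prob {\<omega> \<in> space M. (\<lambda>i\<in>{..<m}. \<xi> (limit_functional (f i)) \<omega>) \<in> ?B}"
      using gaussian_cylinder_measure_coord_map[OF \<mu> B, of f] by simp
    also have "\<dots> = prob {\<omega> \<in> space M. Z \<omega> \<in> A}"
      by (simp add: space_PiM Z_def)
    finally have "\<mu> (blinfun_apply F -` A) = prob {\<omega> \<in> space M. Z \<omega> \<in> A}" .
    then show "ennreal (\<mu> (blinfun_apply F -` A)) = emeasure (distr M borel Z) A"
      by (subst emeasure_distr) (auto simp: emeasure_eq_measure vimage_def Int_def conj_commute)
  qed simp
  also have "\<dots> = distr M borel Z" using measure_of_of_measure[of "distr M borel Z"] by simp
  finally have push: "cylinder_pushforward F \<mu> = distr M borel Z" .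
  show "weak_conv_measures (\<lambda>n. distr (approx_law (N n)) borel (blinfun_apply F)) (cylinder_pushforward F \<mu>)"
    unfolding weak_conv_measures_def push
  proof (intro allI impI, elim conjE)
    fix g :: "'b \<Rightarrow> real" assume g: "continuous_on UNIV g" "bounded (range g)"
    then have [measurable]: "g \<in> borel_measurable borel" by (intro borel_measurable_continuous_onI)
    obtain B where B: "\<And>x. \<bar>g x\<bar> \<le> B" using g(2) by (auto simp: bounded_iff)
    have lhs: "(\<integral>x. g x \<partial>distr (approx_law n) borel (blinfun_apply F)) =
        expectation (\<lambda>\<omega>. g (blinfun_apply F (approx n \<omega>)))" for n
      unfolding approx_law_def by (subst distr_distr) (auto simp: integral_distr)
    have rhs: "(\<integral>x. g x \<partial>distr M borel Z) = expectation (\<lambda>\<omega>. g (Z \<omega>))"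
      by (subst integral_distr) auto
    \<comment> \<open>Summing the squared errors lets one subsequence serve all coordinates
      simultaneously.\<close>
    define D where "D n \<omega> = (\<Sum>i<m. (blinfun_apply (f i) (approx n \<omega>) - \<xi> (limit_functional (f i)) \<omega>)\<^sup>2)" for n \<omega>
    have sq: "integrable M (\<lambda>\<omega>. (blinfun_apply f (approx n \<omega>) - \<xi> h \<omega>)\<^sup>2)" for f h n
    proof (rule Bochner_Integration.integrable_bound)
      show "integrable M (\<lambda>\<omega>. 2 * ((norm f)\<^sup>2 * (norm (approx n \<omega>))\<^sup>2 + (\<xi> h \<omega>)\<^sup>2))"
        by (intro integrable_mult_right Bochner_Integration.integrable_add integrable_approx integrable_field_sq)
      have "norm ((blinfun_apply f x - y)\<^sup>2) \<le> norm (2 * ((norm f)\<^sup>2 * (norm x)\<^sup>2 + y\<^sup>2))" for x y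
      proof -
        have "(blinfun_apply f x - y)\<^sup>2 \<le> 2 * ((blinfun_apply f x)\<^sup>2 + y\<^sup>2)"
          using zero_le_power2[of "blinfun_apply f x + y"] by (simp add: power2_sum power2_diff)
        moreover have "(blinfun_apply f x)\<^sup>2 \<le> (norm f * norm x)\<^sup>2"
          using norm_blinfun[of f x] by (simp add: abs_le_square_iff[symmetric] abs_mult)
        ultimately show ?thesis by (simp add: power_mult_distrib)
      qed
      then show "AE \<omega> in M. norm ((blinfun_apply f (approx n \<omega>) - \<xi> h \<omega>)\<^sup>2)
          \<le> norm (2 * ((norm f)\<^sup>2 * (norm (approx n \<omega>))\<^sup>2 + (\<xi> h \<omega>)\<^sup>2))" by (intro AE_I2)
    qed measurable
    have D_int: "integrable M (D n)" for n unfolding D_def by (intro Bochner_Integration.integrable_sum sq)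
    have D_nonneg: "0 \<le> D n \<omega>" for n \<omega> unfolding D_def by (intro sum_nonneg) simp
    have "(\<lambda>n. \<Sum>i<m. expectation (\<lambda>\<omega>. (blinfun_apply (f i) (approx n \<omega>) - \<xi> (limit_functional (f i)) \<omega>)\<^sup>2)) \<longlonglongrightarrow> (\<Sum>i<m. 0)"
      by (intro tendsto_sum approx_mean_square_error)
    then have "(\<lambda>n. expectation (D n)) \<longlonglongrightarrow> 0"
      unfolding D_def by (simp add: sq)
    then have D_lim: "(\<lambda>n. expectation (\<lambda>\<omega>. norm (D n \<omega>))) \<longlonglongrightarrow> 0" using D_nonneg by simp
    show "(\<lambda>n. \<integral>x. g x \<partial>distr (approx_law (N n)) borel (blinfun_apply F)) \<longlonglongrightarrow> (\<integral>x. g x \<partial>distr M borel Z)"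
      unfolding lhs rhs
    proof (rule tendsto_if_subsequences)
      fix r :: "nat \<Rightarrow> nat" assume r: "strict_mono r"
      have "filterlim (\<lambda>n. N (r n)) at_top sequentially"
        by (rule filterlim_at_top_mono[OF filterlim_ident])
           (use N seq_suble[OF r] in \<open>auto intro!: always_eventually intro: order_trans\<close>)
      then have "(\<lambda>n. expectation (\<lambda>\<omega>. norm (D (N (r n)) \<omega>))) \<longlonglongrightarrow> 0"
        by (rule filterlim_compose[OF D_lim])
      from tendsto_L1_AE_subseq[OF D_int this]
      obtain s :: "nat \<Rightarrow> nat" where s: "strict_mono s" "AE \<omega> in M. (\<lambda>n. D (N (r (s n))) \<omega>) \<longlonglongrightarrow> 0"
        by blast
      have "(\<lambda>n. expectation (\<lambda>\<omega>. g (blinfun_apply F (approx (N (r (s n))) \<omega>)))) \<longlonglongrightarrow> expectation (\<lambda>\<omega>. g (Z \<omega>))"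
      proof (rule integral_dominated_convergence)
        show "AE \<omega> in M. (\<lambda>n. g (blinfun_apply F (approx (N (r (s n))) \<omega>))) \<longlonglongrightarrow> g (Z \<omega>)"
          using s(2)
        proof eventually_elim
          case (elim \<omega>)
          have coord: "(\<lambda>n. blinfun_apply (f i) (approx (N (r (s n))) \<omega>)) \<longlonglongrightarrow> \<xi> (limit_functional (f i)) \<omega>"
            if "i < m" for i
          proof -
            let ?d = "\<lambda>n. blinfun_apply (f i) (approx (N (r (s n))) \<omega>) - \<xi> (limit_functional (f i)) \<omega>"
            have "(?d n)\<^sup>2 \<le> D (N (r (s n))) \<omega>" for n
              unfolding D_def by (rule member_le_sum[where f="\<lambda>i. (blinfun_apply (f i) (approx (N (r (s n))) \<omega>) - \<xi> (limit_functional (f i)) \<omega>)\<^sup>2"]) (use that in auto)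
            then have "(\<lambda>n. (?d n)\<^sup>2) \<longlonglongrightarrow> 0"
              by (intro tendsto_sandwich[OF _ _ tendsto_const elim] always_eventually) auto
            then have "(\<lambda>n. sqrt ((?d n)\<^sup>2)) \<longlonglongrightarrow> sqrt 0" by (rule tendsto_real_sqrt)
            then have "?d \<longlonglongrightarrow> 0" by (simp add: tendsto_rabs_zero_iff)
            then show ?thesis by (simp add: LIM_zero_iff)
          qed
          have "(\<lambda>n. blinfun_apply F (approx (N (r (s n))) \<omega>)) \<longlonglongrightarrow> Z \<omega>"
            unfolding F Z_def by (intro tendsto_sum tendsto_scaleR coord tendsto_const) simp
          then show ?case by (rule continuous_on_tendsto_compose[OF g(1)]) auto
        qed
        show "integrable M (\<lambda>_. B)" by simp
      qed (use B in \<open>auto\<close>)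
      with s(1) show "\<exists>s :: nat \<Rightarrow> nat. strict_mono s \<and>
          (\<lambda>n. expectation (\<lambda>\<omega>. g (blinfun_apply F (approx (N (r (s n))) \<omega>)))) \<longlonglongrightarrow> expectation (\<lambda>\<omega>. g (Z \<omega>))"
        by blast
    qed
  qed
qed

text \<open>Truncation levels are chosen diagonally: level \<open>N n\<close> is large enough for
  tolerance \<open>1 / n\<close> and at least \<open>n\<close>, so the same sequence also converges
  on cylinders.\<close>

lemma gaussian_worst_case_limit:
  assumes covariance: "\<And>f. blinfun_apply f (T f) = blinfun_apply (limit_functional f) (Q (limit_functional f))"
    and close: "\<And>\<epsilon>. 0 < \<epsilon> \<Longrightarrow> data_kernel = {0} \<or>
      (\<forall>\<^sub>F N in sequentially. 0 < residual_dim N \<and> known_var \<le> \<epsilon> * residual_dim N)"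
  shows "gaussian_worst_case (span (\<phi> ` J)) T"
proof -
  interpret T: transformed_gaussian_field Q M \<xi> limit_functional T
    by (intro transformed_gaussian_field.intro transformed_gaussian_field_axioms.intro
        gaussian_field_space_axioms linear_limit_functional covariance)
  \<comment> \<open>At \<open>n = 0\<close> only the bound on the level is asked, as
    \<open>1 / real 0 = 0\<close> is not a positive tolerance.\<close>
  have "\<exists>N\<ge>n. 1 \<le> n \<longrightarrow> eps_saddle_point (span (\<phi> ` J)) (1 / real n) proj (approx_law N)" for n
  proof (cases "1 \<le> n")
    case True
    then have pos: "0 < 1 / real n" by simp
    let ?close = "\<lambda>N. data_kernel = {0} \<or> (0 < residual_dim N \<and> known_var \<le> 1 / real n * residual_dim N)"
    have "\<forall>\<^sub>F N in sequentially. ?close N"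
      using close[OF pos]
    proof
      assume "data_kernel = {0}"
      then show ?thesis by (intro always_eventually allI disjI1)
    next
      assume "\<forall>\<^sub>F N in sequentially. 0 < residual_dim N \<and> known_var \<le> 1 / real n * residual_dim N"
      then show ?thesis by (rule eventually_mono) (rule disjI2)
    qed
    then obtain N0 where "\<forall>N\<ge>N0. ?close N" unfolding eventually_sequentially by (rule exE)
    then have N0: "?close N" if "N0 \<le> N" for N using that by (elim allE impE)
    have "eps_saddle_point (span (\<phi> ` J)) (1 / real n) proj (approx_law (max N0 n))"
      by (rule eps_saddle_point_approx_law[OF pos N0]) simp
    then show ?thesis by (intro exI[of _ "max N0 n"]) simp
  qed auto
  then have "\<forall>n. \<exists>N. n \<le> N \<and> (1 \<le> n \<longrightarrow> eps_saddle_point (span (\<phi> ` J)) (1 / real n) proj (approx_law N))"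
    by simp
  from choice[OF this] obtain N where "\<forall>n. n \<le> N n \<and>
      (1 \<le> n \<longrightarrow> eps_saddle_point (span (\<phi> ` J)) (1 / real n) proj (approx_law (N n)))" by (rule exE)
  then have N: "n \<le> N n" "1 \<le> n \<Longrightarrow> eps_saddle_point (span (\<phi> ` J)) (1 / real n) proj (approx_law (N n))" for n
    by simp_all
  have "worst_case_measure (span (\<phi> ` J)) \<mu>" if \<mu>: "gaussian_cylinder_measure T \<mu>" for \<mu>
    unfolding worst_case_measure_def saddle_point_def
  proof (intro exI conjI)
    show "proj \<in> strategies (span (\<phi> ` J))" by (rule proj_strategy)
    show "cylinder_measure \<mu>" using \<mu> by (simp add: gaussian_cylinder_measure_def)
    show "\<forall>n\<ge>1. eps_saddle_point (span (\<phi> ` J)) (1 / real n) proj (approx_law (N n))" using N(2) by blast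
    show "weak_cylinder_conv (\<lambda>n. approx_law (N n)) \<mu>"
      by (rule weak_cylinder_conv_approx_law[OF covariance \<mu> N(1)])
  qed
  then show ?thesis
    unfolding gaussian_worst_case_def using T.gaussian_cylinder_measure_cylinder_prob by blast
qed

section \<open>Growth of the residual dimension\<close>

lemma residual_dim_mono: "N \<le> N' \<Longrightarrow> residual_dim N \<le> residual_dim N'"
  unfolding residual_dim_def by (intro sum_mono2) auto

lemma residual_dim_eventually_pos:
  assumes "data_kernel \<noteq> {0}"
  shows "\<forall>\<^sub>F N in sequentially. 0 < residual_dim N"
proof -
  obtain w where w: "w \<in> data_kernel" "w \<noteq> 0" using assms subspace_0[OF subspace_data_kernel] by blast
  have "\<exists>i. e i \<noteq> 0"
  proof (rule ccontr)
    assume "\<not> (\<exists>i. e i \<noteq> 0)"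
    then have "(\<lambda>N. 0) \<longlonglongrightarrow> w" using e_expansion[OF w(1)] by simp
    then show False using w(2) by (simp add: LIMSEQ_const_iff)
  qed
  then obtain i where i: "e i \<noteq> 0" by blast
  have "0 < residual_dim N" if "Suc i \<le> N" for N
  proof -
    have "0 < residual_dim (Suc i)"
      unfolding residual_dim_def using i by (intro sum_pos2[of _ i]) auto
    then show ?thesis using residual_dim_mono[OF that] by linarith
  qed
  then show ?thesis unfolding eventually_sequentially by blast
qed

text \<open>If only finitely many \<open>e i\<close> were nonzero, they would span the kernel, and
  together with the finitely many gamblets they would span the whole space.\<close>

lemma residual_dim_at_top:
  assumes infinite_dim: "\<not> (\<exists>B. finite B \<and> span B = (UNIV :: 'b set))"
  shows "filterlim residual_dim at_top sequentially"
proof -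
  let ?E = "{i. e i \<noteq> 0}"
  have inf: "infinite ?E"
  proof
    assume fin: "finite ?E"
    have "r \<in> span (e ` ?E)" if r: "r \<in> data_kernel" for r
    proof -
      obtain n where n: "?E \<subseteq> {..<n}" using finite_nat_iff_bounded fin by blast
      have "partial_expansion e N r = (\<Sum>i\<in>?E. ip r (e i) *\<^sub>R e i)" if "n \<le> N" for N
        by (rule sum.mono_neutral_right) (use n that in auto)
      then have "\<forall>\<^sub>F N in sequentially. partial_expansion e N r = (\<Sum>i\<in>?E. ip r (e i) *\<^sub>R e i)"
        unfolding eventually_sequentially by blast
      then have "(\<lambda>N. \<Sum>i\<in>?E. ip r (e i) *\<^sub>R e i) \<longlonglongrightarrow> r"
        by (rule Lim_transform_eventually[OF e_expansion[OF r]])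
      then have "r = (\<Sum>i\<in>?E. ip r (e i) *\<^sub>R e i)" by (simp add: LIMSEQ_const_iff)
      moreover have "(\<Sum>i\<in>?E. ip r (e i) *\<^sub>R e i) \<in> span (e ` ?E)"
        by (intro span_sum span_scale span_base imageI)
      ultimately show ?thesis by (rule ssubst)
    qed
    then have res: "x - proj x \<in> span (\<psi> ` J \<union> e ` ?E)" for x
      using diff_proj_in_kernel span_mono[of "e ` ?E" "\<psi> ` J \<union> e ` ?E"] by blast
    have "proj x \<in> span (\<psi> ` J \<union> e ` ?E)" for x
      unfolding proj_def by (intro span_sum span_scale span_base) auto
    then have "x \<in> span (\<psi> ` J \<union> e ` ?E)" for x using span_add[OF res[of x], of "proj x"] by simp
    then have "span (\<psi> ` J \<union> e ` ?E) = UNIV" by blast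
    moreover have "finite (\<psi> ` J \<union> e ` ?E)" using fin finite_J by simp
    ultimately have "\<exists>B. finite B \<and> span B = (UNIV :: 'b set)" by (intro exI conjI)
    with infinite_dim show False by (rule notE)
  qed
  show ?thesis
    unfolding filterlim_at_top
  proof
    fix C :: real
    obtain m :: nat where m: "C \<le> real m" using real_arch_simple by blast
    obtain E' where E': "E' \<subseteq> ?E" "finite E'" "card E' = m"
      using infinite_arbitrarily_large[OF inf, of m] by blast
    obtain n where n: "E' \<subseteq> {..<n}" using finite_nat_iff_bounded E'(2) by blast
    have "real m = (\<Sum>i\<in>E'. (norm (e i))\<^sup>2)"
      unfolding E'(3)[symmetric] using E'(1) by (simp add: norm_e_sq subset_iff)
    also have "\<dots> \<le> residual_dim n"
      unfolding residual_dim_def using n by (intro sum_mono2) auto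
    finally have "C \<le> residual_dim N" if "n \<le> N" for N
      using m residual_dim_mono[OF that] by linarith
    then show "\<forall>\<^sub>F N in sequentially. C \<le> residual_dim N" unfolding eventually_sequentially by blast
  qed
qed

end

context gaussian_gamblet_space
begin

text \<open>For \<delta> = 0 the known variance vanishes, so every truncation that contains a
  nonzero basis vector is admissible at every tolerance.\<close>

lemma gaussian_worst_case_short: "gaussian_worst_case (span (\<phi> ` J)) short"
proof -
  obtain e where e: "orthonormal_or_zero e" "\<And>i. e i \<in> data_kernel"
    "\<And>r. r \<in> data_kernel \<Longrightarrow> (\<lambda>N. partial_expansion e N r) \<longlonglongrightarrow> r"
    using kernel_basis by blast
  interpret W: worst_case_sequence Q M \<xi> J \<phi> \<psi> e 0
    by unfold_locales (fact e)+
  show ?thesis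
  proof (rule W.gaussian_worst_case_limit)
    show "blinfun_apply f (short f) = blinfun_apply (W.limit_functional f) (Q (W.limit_functional f))" for f
      unfolding apply_short W.limit_functional_def by simp
    have var: "W.known_var = 0" by (simp add: W.known_var_def W.known_def)
    show "data_kernel = {0} \<or>
      (\<forall>\<^sub>F N in sequentially. 0 < W.residual_dim N \<and> W.known_var \<le> \<epsilon> * W.residual_dim N)" if \<epsilon>: "0 < \<epsilon>" for \<epsilon>
    proof (cases "data_kernel = {0}")
      case True
      then show ?thesis by (rule disjI1)
    next
      case False
      then have "\<forall>\<^sub>F N in sequentially. 0 < W.residual_dim N" by (rule W.residual_dim_eventually_pos)
      then have "\<forall>\<^sub>F N in sequentially. 0 < W.residual_dim N \<and> W.known_var \<le> \<epsilon> * W.residual_dim N"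
        by eventually_elim (use \<epsilon> var in simp)
      then show ?thesis by (rule disjI2)
    qed
  qed
qed

text \<open>For \<delta> = 1 the limit functional is the identity. The known variance does not
  depend on \<open>N\<close>, so it is outgrown by the residual dimension.\<close>

lemma gaussian_worst_case_Q:
  assumes "\<not> (\<exists>B. finite B \<and> span B = (UNIV :: 'b set))"
  shows "gaussian_worst_case (span (\<phi> ` J)) Q"
proof -
  obtain e where e: "orthonormal_or_zero e" "\<And>i. e i \<in> data_kernel"
    "\<And>r. r \<in> data_kernel \<Longrightarrow> (\<lambda>N. partial_expansion e N r) \<longlonglongrightarrow> r"
    using kernel_basis by blast
  interpret W: worst_case_sequence Q M \<xi> J \<phi> \<psi> e 1
    by unfold_locales (fact e)+
  show ?thesis
  proof (rule W.gaussian_worst_case_limit)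
    show "blinfun_apply f (Q f) = blinfun_apply (W.limit_functional f) (Q (W.limit_functional f))" for f
      by (simp add: W.limit_functional_def)
    show "data_kernel = {0} \<or>
      (\<forall>\<^sub>F N in sequentially. 0 < W.residual_dim N \<and> W.known_var \<le> \<epsilon> * W.residual_dim N)" if \<epsilon>: "0 < \<epsilon>" for \<epsilon>
    proof (rule disjI2)
      have lim: "filterlim W.residual_dim at_top sequentially" by (rule W.residual_dim_at_top[OF assms])
      then have "\<forall>\<^sub>F N in sequentially. 1 \<le> W.residual_dim N" "\<forall>\<^sub>F N in sequentially. W.known_var / \<epsilon> \<le> W.residual_dim N"
        unfolding filterlim_at_top by auto
      then show "\<forall>\<^sub>F N in sequentially. 0 < W.residual_dim N \<and> W.known_var \<le> \<epsilon> * W.residual_dim N"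
        by eventually_elim (use \<epsilon> in \<open>simp add: field_simps\<close>)
    qed
  qed
qed

end

section \<open>Conditional expectations and gamblets\<close>

text \<open>The first-order condition: moving the minimizer along \<open>w\<close> keeps the
  constraints, so a nonzero inner product would allow a smaller norm.\<close>

lemma (in norm_operator_space) minimizer_orthogonal:
  assumes min: "is_arg_min norm (\<lambda>w. \<forall>j\<in>J. blinfun_apply (\<phi> j) w = c j) x"
    and w: "\<And>j. j \<in> J \<Longrightarrow> blinfun_apply (\<phi> j) w = 0"
  shows "ip x w = 0"
proof (cases "w = 0")
  case False
  \<comment> \<open>This is the minimum point of the quadratic function
    \<open>t \<mapsto> |x + t w|^2\<close>.\<close>
  define t where "t = - (ip x w / (norm w)\<^sup>2)"
  have x: "\<forall>j\<in>J. blinfun_apply (\<phi> j) x = c j" using min by (simp add: is_arg_min_def)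
  have "\<forall>j\<in>J. blinfun_apply (\<phi> j) (x + t *\<^sub>R w) = c j"
    using x w by (simp add: blinfun.add_right blinfun.scaleR_right)
  then have "\<not> norm (x + t *\<^sub>R w) < norm x" using min unfolding is_arg_min_def by blast
  then have "(norm x)\<^sup>2 \<le> (norm (x + t *\<^sub>R w))\<^sup>2" by (intro power_mono) auto
  also have "\<dots> = (norm x)\<^sup>2 + 2 * t * ip x w + t\<^sup>2 * (norm w)\<^sup>2"
    unfolding norm_add_sq by (simp add: power_mult_distrib)
  finally have "0 \<le> 2 * t * ip x w + t\<^sup>2 * (norm w)\<^sup>2" by simp
  also have "\<dots> = - ((ip x w)\<^sup>2 / (norm w)\<^sup>2)"
    using False by (simp add: t_def field_simps power2_eq_square)
  finally have "(ip x w)\<^sup>2 / (norm w)\<^sup>2 \<le> 0" by simp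
  then show ?thesis using False by (simp add: divide_le_0_iff)
qed simp

section \<open>Conditioning the field in terms of gamblets\<close>

context gaussian_gamblet_space
begin

lemma data_values_surjective: "\<exists>x. \<forall>j\<in>J. blinfun_apply (\<phi> j) x = c j"
  by (intro exI[of _ "\<Sum>j\<in>J. c j *\<^sub>R \<psi> j"] ballI apply_gamblet_sum)

text \<open>The gamblets solve the normal equations: the residual functional is
  \<open>f - adj f\<close>, which vanishes on \<open>Q (\<phi> l)\<close> because that vector is
  fixed by \<open>proj\<close>.\<close>

lemma regression_function_field:
  "regression_function M (\<xi> f) J (\<lambda>j. \<xi> (\<phi> j)) (\<lambda>y. \<Sum>j\<in>J. blinfun_apply f (\<psi> j) * y j)"
proof (rule regression_function_linear[OF finite_J])
  fix l assume "l \<in> J"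
  then show "blinfun_apply (f - (\<Sum>j\<in>J. blinfun_apply f (\<psi> j) *\<^sub>R \<phi> j)) (Q (\<phi> l)) = 0"
    unfolding adj_def[symmetric] by (simp add: blinfun.diff_left apply_adj proj_Q_data)
qed

text \<open>Existence and uniqueness of the regression value in one equivalence, which evaluates the
  \<open>THE\<close> of \<open>cond_value\<close>. Biorthogonality makes all data values attainable,
  as uniqueness requires.\<close>

lemma is_cond_value_iff:
  "is_cond_value M (\<xi> f) J (\<lambda>j. \<xi> (\<phi> j)) c r \<longleftrightarrow> r = blinfun_apply f (\<Sum>j\<in>J. c j *\<^sub>R \<psi> j)"
proof -
  let ?g = "\<lambda>y. \<Sum>j\<in>J. blinfun_apply f (\<psi> j) * y j"
  have g: "?g (restrict c J) = blinfun_apply f (\<Sum>j\<in>J. c j *\<^sub>R \<psi> j)"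
    by (simp add: blinfun.sum_right blinfun.scaleR_right mult.commute)
  have "h (restrict c J) = ?g (restrict c J)" if "regression_function M (\<xi> f) J (\<lambda>j. \<xi> (\<phi> j)) h" for h
    by (rule regression_function_unique[OF finite_J data_values_surjective that regression_function_field]) auto
  then show ?thesis
    unfolding is_cond_value_def using regression_function_field[of f] g by metis
qed

lemma cond_value_eq:
  "cond_value M (\<xi> f) J (\<lambda>j. \<xi> (\<phi> j)) c = blinfun_apply f (\<Sum>j\<in>J. c j *\<^sub>R \<psi> j)"
  unfolding cond_value_def is_cond_value_iff by simp

lemma is_field_cond_exp_iff: "is_field_cond_exp M \<xi> J \<phi> c v \<longleftrightarrow> v = (\<Sum>j\<in>J. c j *\<^sub>R \<psi> j)"
proof
  assume "is_field_cond_exp M \<xi> J \<phi> c v"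
  then have eq: "blinfun_apply f v = blinfun_apply f (\<Sum>j\<in>J. c j *\<^sub>R \<psi> j)" for f :: "'b \<Rightarrow>\<^sub>L real"
    unfolding is_field_cond_exp_def is_cond_value_iff by blast
  define d where "d = v - (\<Sum>j\<in>J. c j *\<^sub>R \<psi> j)"
  have "ip d d = 0" unfolding ip_def using eq by (simp add: d_def blinfun.diff_right)
  then show "v = (\<Sum>j\<in>J. c j *\<^sub>R \<psi> j)" by (simp add: ip_self d_def)
next
  assume "v = (\<Sum>j\<in>J. c j *\<^sub>R \<psi> j)"
  then show "is_field_cond_exp M \<xi> J \<phi> c v" by (simp add: is_field_cond_exp_def is_cond_value_iff)
qed

lemma field_cond_exp_eq: "field_cond_exp M \<xi> J \<phi> c = (\<Sum>j\<in>J. c j *\<^sub>R \<psi> j)"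
  unfolding field_cond_exp_def is_field_cond_exp_iff by simp

lemma field_cond_exp_gamblet:
  assumes "i \<in> J"
  shows "field_cond_exp M \<xi> J \<phi> (\<lambda>j. if i = j then 1 else 0) = \<psi> i"
proof -
  have "(\<Sum>j\<in>J. (if i = j then 1 else 0) *\<^sub>R \<psi> j) = (\<Sum>j\<in>J. if i = j then \<psi> j else 0)"
    by (intro sum.cong) auto
  then show ?thesis using assms finite_J by (simp add: field_cond_exp_eq)
qed

end

theorem theorem5p7:
  fixes Q :: "('b::{banach,second_countable_topology} \<Rightarrow>\<^sub>L real) \<Rightarrow> 'b"
    and q :: enat
    and I :: "(nat \<Rightarrow> 'i) set"
    and \<pi> R :: "nat \<Rightarrow> (nat \<Rightarrow> 'i) \<Rightarrow> (nat \<Rightarrow> 'i) \<Rightarrow> real"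
    and \<phi> :: "nat \<Rightarrow> (nat \<Rightarrow> 'i) \<Rightarrow> 'b \<Rightarrow>\<^sub>L real"
    and \<psi> :: "nat \<Rightarrow> (nat \<Rightarrow> 'i) \<Rightarrow> 'b"
    and M :: "'w measure"
    and \<xi> :: "('b \<Rightarrow>\<^sub>L real) \<Rightarrow> 'w \<Rightarrow> real"
    and \<Phi> :: "nat \<Rightarrow> ('b \<Rightarrow>\<^sub>L real) set"
    and u :: "nat \<Rightarrow> 'b \<Rightarrow> 'b"
  assumes reflexive: "reflexive_space TYPE('b)"
    and Q: "norm_operator Q"
    and q: "1 \<le> q"
    and tree: "index_tree q I"
    and rank: "\<And>k. 1 \<le> k \<Longrightarrow> enat (k + 1) \<le> q \<Longrightarrow>
          matrix_rank (tree_level I k) (tree_level I (k + 1)) (\<pi> k) = card (tree_level I k)"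
    and indep: "case q of
          enat m \<Rightarrow> lin_indep_family (tree_level I m) (\<phi> m)
        | \<infinity> \<Rightarrow> (\<forall>k\<ge>1. lin_indep_family (tree_level I k) (\<phi> k))"
    and nesting: "\<And>k i. 1 \<le> k \<Longrightarrow> enat (k + 1) \<le> q \<Longrightarrow> i \<in> tree_level I k \<Longrightarrow>
          \<phi> k i = (\<Sum>j\<in>tree_level I (k + 1). \<pi> k i j *\<^sub>R \<phi> (k + 1) j)"
    and Phi: "\<And>k. \<Phi> k = span (\<phi> k ` tree_level I k)"
    and gamblets: "\<And>k i. 1 \<le> k \<Longrightarrow> enat k \<le> q \<Longrightarrow> i \<in> tree_level I k \<Longrightarrow>
          is_arg_min norm
            (\<lambda>w. \<forall>j\<in>tree_level I k. blinfun_apply (\<phi> k j) w = (if i = j then 1 else 0)) (\<psi> k i)"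
    and interpolation: "\<And>k i. 1 \<le> k \<Longrightarrow> enat (k + 1) \<le> q \<Longrightarrow> i \<in> tree_level I k \<Longrightarrow>
          \<psi> k i = (\<Sum>j\<in>tree_level I (k + 1). R k i j *\<^sub>R \<psi> (k + 1) j)"
    and field: "gaussian_field M Q \<xi>"
    and u: "\<And>k x. u k x =
          field_cond_exp M \<xi> (tree_level I k) (\<phi> k) (\<lambda>i. blinfun_apply (\<phi> k i) x)"
  shows "\<forall>k. 1 \<le> k \<and> enat k \<le> q \<longrightarrow>
      (\<forall>c. \<exists>!v. is_field_cond_exp M \<xi> (tree_level I k) (\<phi> k) c v) \<and>
      is_arg_min worst_loss (\<lambda>v. v \<in> strategies (\<Phi> k)) (u k) \<and>
      (\<forall>i\<in>tree_level I k.
        \<psi> k i = field_cond_exp M \<xi> (tree_level I k) (\<phi> k) (\<lambda>j. if i = j then 1 else 0)) \<and>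
      (enat (k + 1) \<le> q \<longrightarrow> (\<forall>i\<in>tree_level I k. \<forall>j\<in>tree_level I (k + 1).
        R k i j = cond_value M (\<xi> (\<phi> (k + 1) j)) (tree_level I k) (\<lambda>l. \<xi> (\<phi> k l))
                    (\<lambda>l. if i = l then 1 else 0))) \<and>
      (\<exists>!S. is_short Q (\<Phi> k) S) \<and>
      (\<forall>S. is_short Q (\<Phi> k) S \<longrightarrow> gaussian_worst_case (\<Phi> k) S) \<and>
      (\<not> (\<exists>B. finite B \<and> span B = (UNIV :: 'b set)) \<longrightarrow> gaussian_worst_case (\<Phi> k) Q)"
proof (intro allI impI, elim conjE)
  fix k assume k: "1 \<le> k" "enat k \<le> q"
  have gaussian_gamblet: "gaussian_gamblet_space Q M \<xi> (tree_level I k) (\<phi> k) (\<psi> k)"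
    if "1 \<le> k" "enat k \<le> q" for k
  proof -
    interpret norm_operator_space Q by unfold_locales (rule Q)
    show ?thesis
    proof unfold_locales
      show "gaussian_field M Q \<xi>" by (rule field)
      show "finite (tree_level I k)" using tree that by (simp add: index_tree_def)
      show "blinfun_apply (\<phi> k j) (\<psi> k i) = (if i = j then 1 else 0)"
        if "i \<in> tree_level I k" "j \<in> tree_level I k" for i j
        using gamblets[OF \<open>1 \<le> k\<close> \<open>enat k \<le> q\<close> that(1)] that(2) by (simp add: is_arg_min_def)
      show "ip (\<psi> k i) w = 0"
        if "i \<in> tree_level I k" "\<And>j. j \<in> tree_level I k \<Longrightarrow> blinfun_apply (\<phi> k j) w = 0" for i w
        by (rule minimizer_orthogonal[OF gamblets[OF \<open>1 \<le> k\<close> \<open>enat k \<le> q\<close> that(1)] that(2)])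
    qed
  qed
  interpret G: gaussian_gamblet_space Q M \<xi> "tree_level I k" "\<phi> k" "\<psi> k"
    by (rule gaussian_gamblet[OF k])
  have u_proj: "u k = G.proj"
    by (rule ext) (simp add: u G.field_cond_exp_eq G.proj_def)
  show "(\<forall>c. \<exists>!v. is_field_cond_exp M \<xi> (tree_level I k) (\<phi> k) c v) \<and>
      is_arg_min worst_loss (\<lambda>v. v \<in> strategies (\<Phi> k)) (u k) \<and>
      (\<forall>i\<in>tree_level I k.
        \<psi> k i = field_cond_exp M \<xi> (tree_level I k) (\<phi> k) (\<lambda>j. if i = j then 1 else 0)) \<and>
      (enat (k + 1) \<le> q \<longrightarrow> (\<forall>i\<in>tree_level I k. \<forall>j\<in>tree_level I (k + 1).
        R k i j = cond_value M (\<xi> (\<phi> (k + 1) j)) (tree_level I k) (\<lambda>l. \<xi> (\<phi> k l))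
                    (\<lambda>l. if i = l then 1 else 0))) \<and>
      (\<exists>!S. is_short Q (\<Phi> k) S) \<and>
      (\<forall>S. is_short Q (\<Phi> k) S \<longrightarrow> gaussian_worst_case (\<Phi> k) S) \<and>
      (\<not> (\<exists>B. finite B \<and> span B = (UNIV :: 'b set)) \<longrightarrow> gaussian_worst_case (\<Phi> k) Q)"
    unfolding Phi u_proj
  proof (intro conjI allI impI ballI)
    show "\<exists>!v. is_field_cond_exp M \<xi> (tree_level I k) (\<phi> k) c v" for c
      unfolding G.is_field_cond_exp_iff by simp
    show "is_arg_min worst_loss (\<lambda>v. v \<in> strategies (span (\<phi> k ` tree_level I k))) G.proj"
      unfolding is_arg_min_def not_ex
      using G.proj_strategy G.worst_loss_proj_le by (simp add: not_less)
    show "\<psi> k i = field_cond_exp M \<xi> (tree_level I k) (\<phi> k) (\<lambda>j. if i = j then 1 else 0)"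
      if "i \<in> tree_level I k" for i
      by (rule G.field_cond_exp_gamblet[OF that, symmetric])
    show "R k i j = cond_value M (\<xi> (\<phi> (k + 1) j)) (tree_level I k) (\<lambda>l. \<xi> (\<phi> k l)) (\<lambda>l. if i = l then 1 else 0)"
      if q': "enat (k + 1) \<le> q" and i: "i \<in> tree_level I k" and j: "j \<in> tree_level I (k + 1)" for i j
    proof -
      interpret G': gaussian_gamblet_space Q M \<xi> "tree_level I (k + 1)" "\<phi> (k + 1)" "\<psi> (k + 1)"
        by (rule gaussian_gamblet[OF _ q']) simp
      \<comment> \<open>Conditioning at level \<open>k\<close> evaluates the functional at
        \<open>\<psi> k i\<close>; biorthogonality at level \<open>k + 1\<close> then extracts the
        coefficient \<open>R k i j\<close>.\<close>
      have "cond_value M (\<xi> (\<phi> (k + 1) j)) (tree_level I k) (\<lambda>l. \<xi> (\<phi> k l)) (\<lambda>l. if i = l then 1 else 0) =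
          blinfun_apply (\<phi> (k + 1) j) (\<psi> k i)"
        using G.field_cond_exp_gamblet[OF i] by (simp only: G.cond_value_eq G.field_cond_exp_eq)
      also have "\<dots> = R k i j"
        unfolding interpolation[OF k(1) q' i] by (rule G'.apply_gamblet_sum[OF j])
      finally show ?thesis ..
    qed
    show "\<exists>!S. is_short Q (span (\<phi> k ` tree_level I k)) S"
    proof (rule ex1I)
      show "is_short Q (span (\<phi> k ` tree_level I k)) G.short" by (rule G.is_short_short)
      show "S = G.short" if "is_short Q (span (\<phi> k ` tree_level I k)) S" for S
        by (rule G.is_short_unique[OF that G.is_short_short])
    qed
    show "gaussian_worst_case (span (\<phi> k ` tree_level I k)) S"
      if "is_short Q (span (\<phi> k ` tree_level I k)) S" for S
      unfolding G.is_short_unique[OF that G.is_short_short] by (rule G.gaussian_worst_case_short)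
    show "gaussian_worst_case (span (\<phi> k ` tree_level I k)) Q"
      if "\<not> (\<exists>B. finite B \<and> span B = (UNIV :: 'b set))"
      by (rule G.gaussian_worst_case_Q[OF that])
  qed
qed

end
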